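(* Let $d\ge2$, $D=\{1,\dots,d\}$, $X=L^2((0,1)^d)$, $s>0$. For each $\nu\in D$ let $(U_{\nu,m})_{m\ge1}$ be subspaces of $L^2(0,1)$ with $\dim U_{\nu,m}=m$ such that, for a constant $M$, $$E(u,U_{\nu,m})_{L^2(0,1)}\le M\,m^{-s}\|u\|_{H^s(0,1)}\quad\text{for all }u\in H^s(0,1),\ m\ge1,$$ and for $n=(n_1,\dots,n_d)$ let $U_n=U_{1,n_1}\otimes\cdots\otimes U_{d,n_d}$. Let $T$ be a dimension partition tree over $D$. Let $f\in H^s_{\mathrm{mix}}((0,1)^d)$ and $0<\varepsilon<1$. Denote by $N(f,\varepsilon,d)$ the complexity $N(T,r,U_n)$ sufficient (i.e. minimal over admissible ranks $r$ and tuples $n$) to achieve a relative error $\varepsilon$, that is, $e^T_{r,U_n}(f)_X\le\varepsilon\|f\|_{H^s_{\mathrm{mix}}}$, for the approximation of $f$ in the format $\mathcal{T}_r^T(U_n)$. There exists a constant $C_d$ (independent of $f$ and $\varepsilon$), which may depend exponentially on $d$, such that: (i) if $T$ is the trivial tree with depth one, $$N(f,\varepsilon,d)\le C_d\,\varepsilon^{-d/(2s)}\log(\varepsilon^{-1})^{d(d-2)};$$ (ii) and if $T$ is a binary tree, $$N(f,\varepsilon,d)\le C_d\,\varepsilon^{-3/(2s)}\log(\varepsilon^{-1})^{3(d-2)}.$$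
   Context: A dimension partition tree $T$ over $D$ is a rooted tree whose nodes are nonempty subsets of $D$, with root $D$, such that each node $\alpha$ is either a leaf (set of sons $S(\alpha)=\emptyset$) or has a set of sons $S(\alpha)$ forming a partition of $\alpha$ with $\#S(\alpha)\ge2$; the leaves are exactly the singletons $\{1\},\dots,\{d\}$. $\mathcal{I}(T)$ is the set of interior nodes. The trivial tree is $T=\{D,\{1\},\dots,\{d\}\}$. $T$ is binary if $\#S(\alpha)=2$ for every $\alpha\in\mathcal{I}(T)$. $H^s(0,1)$ is the standard (fractional) Sobolev space and $H^s_{\mathrm{mix}}((0,1)^d)=H^s(0,1)\otimes\cdots\otimes H^s(0,1)$ the mixed Sobolev space (Hilbert tensor product with canonical cross norm). $E(u,V)_Y=\inf_{v\in V}\|u-v\|_Y$. For nonempty $\alpha\subsetneq D$ and $\alpha^c=D\setminus\alpha$, $\mathrm{rank}_\alpha(v)$ of $v\in X$ is the minimal $k$ (possibly infinite) such that $v(x)=\sum_{i=1}^k u_i(x_\alpha)w_i(x_{\alpha^c})$ with $L^2$ functions $u_i,w_i$; for $\alpha=D$ one takes $r_D=1$ and the constraint is vacuous. For $r=(r_\alpha)_{\alpha\in T}$ and a subspace $U=U_1\otimes\cdots\otimes U_d$ of $X$, $\mathcal{T}_r^T(U)=\{v\in U:\mathrm{rank}_\alpha(v)\le r_\alpha,\ \alpha\in T\}$ and $e^T_{r,U}(f)_X=\inf_{v\in\mathcal{T}_r^T(U)}\|f-v\|_X$; $r$ is admissible if $\mathcal{T}_r^T(X)\neq\emptyset$. The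 complexity is $$N(T,r,U)=\sum_{\alpha\in\mathcal{I}(T)}r_\alpha\prod_{\beta\in S(\alpha)}r_\beta+\sum_{\nu=1}^d r_\nu\dim(U_\nu),$$ where $r_\nu=r_{\{\nu\}}$. The constants may also depend on the fixed $s$ and $M$.
   Formalization: The factor log(1/ε) is replaced by max(1, log(1/ε)), as the stated bounds fail for ε near 1 when d ≥ 3 (e.g. f = 1); (i) is stated only for d ≥ 3, as for d = 2 it is false (the leaf term can be of order ε^{-3/(2s)}), and there the trivial tree is binary and covered by (ii). *)

theory Defs
  imports "HOL-Analysis.Analysis"
begin

text \<open>Elements of an \<open>L\<^sup>2\<close> space are represented by functions; equality of elements is equality almost
  everywhere. The subspaces and norms below do not depend on the choice of measurable representatives.\<close>

definition L2 :: "'a measure \<Rightarrow> ('a \<Rightarrow> real) set" where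
  "L2 M = {f \<in> borel_measurable M. integrable M (\<lambda>x. (f x)\<^sup>2)}"

definition L2_norm :: "'a measure \<Rightarrow> ('a \<Rightarrow> real) \<Rightarrow> real" where
  "L2_norm M f = sqrt (\<integral>x. (f x)\<^sup>2 \<partial>M)"

definition best_error :: "'a measure \<Rightarrow> ('a \<Rightarrow> real) \<Rightarrow> ('a \<Rightarrow> real) set \<Rightarrow> real" where
  "best_error M u V = (INF v\<in>V. L2_norm M (\<lambda>x. u x - v x))"

text \<open>\<open>V\<close> is an \<open>m\<close>-dimensional linear subspace of \<open>L\<^sup>2\<close>: the set of all (representatives of) linear
  combinations of \<open>m\<close> functions that are linearly independent modulo null sets.\<close>

definition L2_subspace_of_dim :: "'a measure \<Rightarrow> ('a \<Rightarrow> real) set \<Rightarrow> nat \<Rightarrow> bool" where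
  "L2_subspace_of_dim M V m \<longleftrightarrow>
    (\<exists>b :: nat \<Rightarrow> 'a \<Rightarrow> real.
       (\<forall>i<m. b i \<in> L2 M) \<and>
       (\<forall>c :: nat \<Rightarrow> real. (AE x in M. (\<Sum>i<m. c i * b i x) = 0) \<longrightarrow> (\<forall>i<m. c i = 0)) \<and>
       V = {v \<in> L2 M. \<exists>c :: nat \<Rightarrow> real. AE x in M. v x = (\<Sum>i<m. c i * b i x)})"

text \<open>At most one \<open>m\<close> qualifies; this is only used for finite-dimensional subspaces.\<close>

definition L2_dim :: "'a measure \<Rightarrow> ('a \<Rightarrow> real) set \<Rightarrow> nat" where
  "L2_dim M V = (LEAST m. L2_subspace_of_dim M V m)"


text \<open>A point of \<open>(0,1)\<^sup>\<alpha>\<close> for \<open>\<alpha> \<subseteq> {1..d}\<close> is an extensional function on \<open>\<alpha>\<close>, so the variables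
  \<open>x\<^sub>\<alpha>\<close> of a point \<open>x\<close> are \<open>restrict x \<alpha>\<close>.\<close>

definition unit_meas :: "real measure" where
  "unit_meas = restrict_space lborel {0<..<1}"

definition cube_meas :: "nat set \<Rightarrow> (nat \<Rightarrow> real) measure" where
  "cube_meas \<alpha> = PiM \<alpha> (\<lambda>_. unit_meas)"


definition test_function :: "(real \<Rightarrow> real) \<Rightarrow> bool" where
  "test_function \<phi> \<longleftrightarrow>
    (\<forall>k x. ((deriv ^^ k) \<phi>) differentiable (at x)) \<and>
    (\<exists>a b. 0 < a \<and> b < 1 \<and> (\<forall>x. x \<notin> {a..b} \<longrightarrow> \<phi> x = 0))"

definition has_weak_deriv :: "nat \<Rightarrow> (real \<Rightarrow> real) \<Rightarrow> (real \<Rightarrow> real) \<Rightarrow> bool" where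
  "has_weak_deriv k u w \<longleftrightarrow> u \<in> L2 unit_meas \<and> w \<in> L2 unit_meas \<and>
    (\<forall>\<phi>. test_function \<phi> \<longrightarrow>
      (\<integral>x. u x * (deriv ^^ k) \<phi> x \<partial>unit_meas) = (-1) ^ k * (\<integral>x. w x * \<phi> x \<partial>unit_meas))"

text \<open>Weak derivatives are unique up to null sets.\<close>

definition weak_deriv :: "nat \<Rightarrow> (real \<Rightarrow> real) \<Rightarrow> real \<Rightarrow> real" where
  "weak_deriv k u = (SOME w. has_weak_deriv k u w)"

text \<open>The Sobolev--Slobodeckij inner product: for \<open>s = k + \<sigma>\<close> with \<open>k = \<lfloor>s\<rfloor>\<close> and \<open>0 \<le> \<sigma> < 1\<close> the usual
  \<open>H\<^sup>k\<close> inner product, plus for \<open>\<sigma> > 0\<close> the Gagliardo form of order \<open>\<sigma>\<close> of the \<open>k\<close>-th derivatives.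
  On the diagonal the quotient is \<open>0 / 0 = 0\<close>; the diagonal is a null set.\<close>

definition gagliardo :: "real \<Rightarrow> (real \<Rightarrow> real) \<Rightarrow> (real \<Rightarrow> real) \<Rightarrow> real \<times> real \<Rightarrow> real" where
  "gagliardo \<sigma> u v = (\<lambda>(x, y). (u x - u y) * (v x - v y) / \<bar>x - y\<bar> powr (1 + 2 * \<sigma>))"

definition Hs :: "real \<Rightarrow> (real \<Rightarrow> real) set" where
  "Hs s = {u \<in> L2 unit_meas.
     (\<forall>j \<le> nat \<lfloor>s\<rfloor>. \<exists>w. has_weak_deriv j u w) \<and>
     (0 < frac s \<longrightarrow>
        integrable (unit_meas \<Otimes>\<^sub>M unit_meas)
          (gagliardo (frac s) (weak_deriv (nat \<lfloor>s\<rfloor>) u) (weak_deriv (nat \<lfloor>s\<rfloor>) u)))}"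

definition Hs_inner :: "real \<Rightarrow> (real \<Rightarrow> real) \<Rightarrow> (real \<Rightarrow> real) \<Rightarrow> real" where
  "Hs_inner s u v =
     (\<Sum>j\<le>nat \<lfloor>s\<rfloor>. \<integral>x. weak_deriv j u x * weak_deriv j v x \<partial>unit_meas) +
     (if frac s = 0 then 0
      else \<integral>z. gagliardo (frac s) (weak_deriv (nat \<lfloor>s\<rfloor>) u) (weak_deriv (nat \<lfloor>s\<rfloor>) v) z
             \<partial>(unit_meas \<Otimes>\<^sub>M unit_meas))"

definition Hs_norm :: "real \<Rightarrow> (real \<Rightarrow> real) \<Rightarrow> real" where
  "Hs_norm s u = sqrt (Hs_inner s u u)"


text \<open>An element of an algebraic tensor product of \<open>d\<close> function spaces is given by a list of elementary
  tensors \<open>u\<close>, whose \<open>\<nu>\<close>-th factor is \<open>u \<nu>\<close> for \<open>1 \<le> \<nu> \<le> d\<close>.\<close>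

type_synonym tensor = "(nat \<Rightarrow> real \<Rightarrow> real) list"

definition tensor_fun :: "nat \<Rightarrow> tensor \<Rightarrow> (nat \<Rightarrow> real) \<Rightarrow> real" where
  "tensor_fun d F x = (\<Sum>u\<leftarrow>F. \<Prod>\<nu>=1..d. u \<nu> (x \<nu>))"

definition tensors_over :: "nat \<Rightarrow> (nat \<Rightarrow> (real \<Rightarrow> real) set) \<Rightarrow> tensor set" where
  "tensors_over d V = {F. \<forall>u\<in>set F. \<forall>\<nu>\<in>{1..d}. u \<nu> \<in> V \<nu>}"

definition tensor_space :: "nat \<Rightarrow> (nat \<Rightarrow> (real \<Rightarrow> real) set) \<Rightarrow> ((nat \<Rightarrow> real) \<Rightarrow> real) set" where
  "tensor_space d V = {v \<in> L2 (cube_meas {1..d}).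
     \<exists>F \<in> tensors_over d V. AE x in cube_meas {1..d}. v x = tensor_fun d F x}"

text \<open>The canonical inner product on \<open>H\<^sup>s \<otimes> \<dots> \<otimes> H\<^sup>s\<close>, which is multiplicative on elementary tensors.\<close>

definition mix_inner :: "nat \<Rightarrow> real \<Rightarrow> tensor \<Rightarrow> tensor \<Rightarrow> real" where
  "mix_inner d s F G = (\<Sum>u\<leftarrow>F. \<Sum>w\<leftarrow>G. \<Prod>\<nu>=1..d. Hs_inner s (u \<nu>) (w \<nu>))"

definition mix_dist :: "nat \<Rightarrow> real \<Rightarrow> tensor \<Rightarrow> tensor \<Rightarrow> real" where
  "mix_dist d s F G = sqrt (mix_inner d s F F - 2 * mix_inner d s F G + mix_inner d s G G)"

text \<open>The Hilbert tensor product is the completion of the algebraic tensor product in this inner product.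
  It embeds injectively into \<open>L\<^sup>2\<close>, so it is realised as the set of the \<open>L\<^sup>2\<close> limits of the sequences
  that are Cauchy in the canonical norm, normed by the limits of the norms.\<close>

definition mix_approx :: "nat \<Rightarrow> real \<Rightarrow> ((nat \<Rightarrow> real) \<Rightarrow> real) \<Rightarrow> (nat \<Rightarrow> tensor) \<Rightarrow> bool" where
  "mix_approx d s f F \<longleftrightarrow>
     (\<forall>i. F i \<in> tensors_over d (\<lambda>_. Hs s)) \<and>
     (\<forall>e>0. \<exists>N. \<forall>i\<ge>N. \<forall>j\<ge>N. mix_dist d s (F i) (F j) < e) \<and>
     (\<lambda>i. L2_norm (cube_meas {1..d}) (\<lambda>x. f x - tensor_fun d (F i) x)) \<longlonglongrightarrow> 0"

definition Hmix :: "nat \<Rightarrow> real \<Rightarrow> ((nat \<Rightarrow> real) \<Rightarrow> real) set" where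
  "Hmix d s = {f \<in> L2 (cube_meas {1..d}). \<exists>F. mix_approx d s f F}"

text \<open>By the injectivity of the embedding the limit does not depend on the sequence, so for \<open>f\<close> in
  \<open>Hmix d s\<close> the infimum is taken over a singleton.\<close>

definition Hmix_norm :: "nat \<Rightarrow> real \<Rightarrow> ((nat \<Rightarrow> real) \<Rightarrow> real) \<Rightarrow> real" where
  "Hmix_norm d s f =
     Inf {c. \<exists>F. mix_approx d s f F \<and> (\<lambda>i. sqrt (mix_inner d s (F i) (F i))) \<longlonglongrightarrow> c}"


text \<open>A partition tree is given by its set \<open>T\<close> of nodes. The nodes form a laminar family, and the sons of
  a node are the maximal nodes strictly below it, so the tree structure is determined by \<open>T\<close>.\<close>

definition sons :: "nat set set \<Rightarrow> nat set \<Rightarrow> nat set set" where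
  "sons T \<alpha> = {\<beta> \<in> T. \<beta> \<subset> \<alpha> \<and> \<not> (\<exists>\<gamma>\<in>T. \<beta> \<subset> \<gamma> \<and> \<gamma> \<subset> \<alpha>)}"

definition interior_nodes :: "nat set set \<Rightarrow> nat set set" where
  "interior_nodes T = {\<alpha> \<in> T. sons T \<alpha> \<noteq> {}}"

definition partition_tree :: "nat \<Rightarrow> nat set set \<Rightarrow> bool" where
  "partition_tree d T \<longleftrightarrow>
     {1..d} \<in> T \<and>
     (\<forall>\<alpha>\<in>T. \<alpha> \<noteq> {} \<and> \<alpha> \<subseteq> {1..d}) \<and>
     (\<forall>\<alpha>\<in>interior_nodes T. partition_on \<alpha> (sons T \<alpha>) \<and> 2 \<le> card (sons T \<alpha>)) \<and>
     {\<alpha> \<in> T. sons T \<alpha> = {}} = (\<lambda>\<nu>. {\<nu>}) ` {1..d}"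

definition trivial_tree :: "nat \<Rightarrow> nat set set" where
  "trivial_tree d = insert {1..d} ((\<lambda>\<nu>. {\<nu>}) ` {1..d})"

definition binary_tree :: "nat set set \<Rightarrow> bool" where
  "binary_tree T \<longleftrightarrow> (\<forall>\<alpha>\<in>interior_nodes T. card (sons T \<alpha>) = 2)"


definition alpha_rank :: "nat \<Rightarrow> nat set \<Rightarrow> ((nat \<Rightarrow> real) \<Rightarrow> real) \<Rightarrow> enat" where
  "alpha_rank d \<alpha> v = Inf {enat k | k u w.
     (\<forall>i<k. u i \<in> L2 (cube_meas \<alpha>) \<and> w i \<in> L2 (cube_meas ({1..d} - \<alpha>))) \<and>
     (AE x in cube_meas {1..d}.
        v x = (\<Sum>i<k. u i (restrict x \<alpha>) * w i (restrict x ({1..d} - \<alpha>))))}"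

text \<open>There is no rank constraint at the root.\<close>

definition tree_format ::
  "nat \<Rightarrow> nat set set \<Rightarrow> (nat set \<Rightarrow> nat) \<Rightarrow> ((nat \<Rightarrow> real) \<Rightarrow> real) set \<Rightarrow> ((nat \<Rightarrow> real) \<Rightarrow> real) set" where
  "tree_format d T r U = {v \<in> U. \<forall>\<alpha>\<in>T. \<alpha> \<noteq> {1..d} \<longrightarrow> alpha_rank d \<alpha> v \<le> enat (r \<alpha>)}"

definition admissible :: "nat \<Rightarrow> nat set set \<Rightarrow> (nat set \<Rightarrow> nat) \<Rightarrow> bool" where
  "admissible d T r \<longleftrightarrow> r {1..d} = 1 \<and> tree_format d T r (L2 (cube_meas {1..d})) \<noteq> {}"

definition tree_error ::
  "nat \<Rightarrow> nat set set \<Rightarrow> (nat set \<Rightarrow> nat) \<Rightarrow> ((nat \<Rightarrow> real) \<Rightarrow> real) set \<Rightarrow> ((nat \<Rightarrow> real) \<Rightarrow> real) \<Rightarrow> real" where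
  "tree_error d T r U f = best_error (cube_meas {1..d}) f (tree_format d T r U)"

definition tree_complexity ::
  "nat \<Rightarrow> nat set set \<Rightarrow> (nat set \<Rightarrow> nat) \<Rightarrow> (nat \<Rightarrow> (real \<Rightarrow> real) set) \<Rightarrow> nat" where
  "tree_complexity d T r V =
     (\<Sum>\<alpha>\<in>interior_nodes T. r \<alpha> * (\<Prod>\<beta>\<in>sons T \<alpha>. r \<beta>)) +
     (\<Sum>\<nu>=1..d. r {\<nu>} * L2_dim unit_meas (V \<nu>))"

text \<open>The value is \<open>\<infinity>\<close> if no admissible choice of ranks and of \<open>n\<close> achieves the accuracy, so a finite
  upper bound includes the existence of such a choice.\<close>

definition min_complexity ::
  "nat \<Rightarrow> real \<Rightarrow> nat set set \<Rightarrow> (nat \<Rightarrow> nat \<Rightarrow> (real \<Rightarrow> real) set) \<Rightarrow> ((nat \<Rightarrow> real) \<Rightarrow> real) \<Rightarrow> real \<Rightarrow> ereal" where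
  "min_complexity d s T U f \<epsilon> =
     Inf {ereal (real (tree_complexity d T r (\<lambda>\<nu>. U \<nu> (n \<nu>)))) | r n.
       admissible d T r \<and> (\<forall>\<nu>\<in>{1..d}. 1 \<le> n \<nu>) \<and>
       tree_error d T r (tensor_space d (\<lambda>\<nu>. U \<nu> (n \<nu>))) f \<le> \<epsilon> * Hmix_norm d s f}"

definition approx_spaces ::
  "nat \<Rightarrow> real \<Rightarrow> real \<Rightarrow> (nat \<Rightarrow> nat \<Rightarrow> (real \<Rightarrow> real) set) \<Rightarrow> bool" where
  "approx_spaces d s M U \<longleftrightarrow>
     (\<forall>\<nu>\<in>{1..d}. \<forall>m\<ge>1.
        L2_subspace_of_dim unit_meas (U \<nu> m) m \<and>
        (\<forall>u\<in>Hs s. best_error unit_meas u (U \<nu> m) \<le> M * real m powr (- s) * Hs_norm s u))"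

end

theory Submission
  imports Defs "HOL-Real_Asymp.Real_Asymp" "HOL-Probability.Infinite_Product_Measure"
begin

text \<open>Approximate \<open>f\<close> by an algebraic tensor and let \<open>V\<close> be the finite-dimensional span of its factors in
  \<open>H\<^sup>s\<close>. Diagonalising the \<open>L\<^sup>2\<close> inner product gives a basis \<open>e\<close> of \<open>V\<close> that is orthonormal in \<open>H\<^sup>s\<close> and
  orthogonal in \<open>L\<^sup>2\<close>; as \<open>U\<^bsub>\<nu>,k\<^esub>\<close> has dimension \<open>k\<close>, the approximation property bounds the \<open>k\<close>-th
  singular value by \<open>M k\<^bsup>-s\<^esup>\<close>. Truncating the expansion of \<open>f\<close> in the tensor products of the \<open>e k\<close> to the
  hyperbolic cross \<open>\<Prod>(k \<nu> + 1) \<le> y\<^sup>2\<close> therefore costs an error of order \<open>y\<^bsup>-2s\<^esup>\<close> without logarithms. Every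
  index of the cross has a partial product at most \<open>y\<close> over \<open>\<alpha>\<close> or over its complement, so a single
  truncation has all \<open>\<alpha>\<close>-ranks of order \<open>y (1 + ln y)\<^bsup>d-2\<^esup>\<close> simultaneously. Orthogonal projection onto
  \<open>U\<^sub>n\<close> does not increase ranks and costs an error of order \<open>n\<^bsup>-s\<^esup>\<close>, and \<open>n \<approx> y\<^sup>2 \<approx> \<epsilon>\<^bsup>-1/s\<^esup>\<close>.\<close>

section \<open>The fundamental lemma of the calculus of variations\<close>

text \<open>The exact singular functions of the embedding of H^s would call for the spectral theorem
  of a compact operator and for infinite expansions in the completed tensor product. Near f there is
  an algebraic tensor, and for it only a symmetric matrix has to be diagonalised. The price is that
  the basis and its size m depend on f and \<epsilon>, so every bound on singular values, ranks and
  errors has to be uniform in m. Two obstacles come from the encoding. \<open>weak_deriv\<close> is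
  an arbitrary choice, so even linearity of the Sobolev inner product rests on the uniqueness of
  weak derivatives, and this needs enough explicit test functions. And functions stand for classes
  modulo null sets, so the inner products are only semidefinite and null vectors are carried along.
  The leaf bases cost about d R n with R of order \<open>\<epsilon>^(-1/(2s))\<close> up to
  logarithms and n of order \<open>\<epsilon>^(-1/s)\<close>. This is the same power of \<epsilon>
  as R^3, the cost of a binary node, so the fine choice of n does not spoil the rates.\<close>

definition bump :: "real \<Rightarrow> real \<Rightarrow> real \<Rightarrow> real poly \<Rightarrow> nat \<Rightarrow> real \<Rightarrow> real" where
  "bump a b c p k x =
     (if a < x \<and> x < b then poly p x / ((x - a) * (b - x)) ^ k * exp (- c / ((x - a) * (b - x))) else 0)"

text \<open>This is t \<le> exp t at t = c / (q m), raised to the power m and inverted. It lets the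
  exponential beat any power of 1 / q.\<close>

lemma exp_neg_divide_le_power:
  assumes "0 < c" "0 < (q::real)" "0 < m"
  shows "exp (- c / q) \<le> (real m / c) ^ m * q ^ m"
proof -
  have "c / (q * m) \<le> exp (c / (q * m))"
    using exp_ge_add_one_self[of "c / (q * m)"] by linarith
  then have "(c / (q * m)) ^ m \<le> exp (c / (q * m)) ^ m"
    using assms by (intro power_mono) auto
  also have "\<dots> = exp (c / q)"
    using assms by (simp flip: exp_of_nat_mult)
  finally have "inverse (exp (c / q)) \<le> inverse ((c / (q * m)) ^ m)"
    using assms by (intro le_imp_inverse_le) auto
  then show ?thesis
    using assms by (simp add: exp_minus power_divide power_mult_distrib field_simps)
qed

lemma bump_flat:
  assumes "a < b" "0 < c"
  shows "\<exists>K\<ge>0. \<forall>x. \<bar>bump a b c p k x\<bar> \<le> K * ((x - a) * (b - x))\<^sup>2"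
proof -
  have "compact (poly p ` {a..b})"
    by (intro compact_continuous_image continuous_intros compact_Icc)
  then obtain P where P: "\<And>x. x \<in> {a..b} \<Longrightarrow> \<bar>poly p x\<bar> \<le> P"
    using compact_imp_bounded bounded_iff by (metis (no_types, lifting) imageI real_norm_def)
  have "0 \<le> P" using P[of a] assms by force
  \<comment> \<open>Of the k + 2 powers of q gained from the exponential, k cancel the pole of the
    bump and two remain as the claimed square.\<close>
  define K where "K = P * (real (k + 2) / c) ^ (k + 2)"
  have "\<bar>bump a b c p k x\<bar> \<le> K * ((x - a) * (b - x))\<^sup>2" if x: "a < x" "x < b" for x
  proof -
    define q where "q = (x - a) * (b - x)"
    have q: "0 < q" using x by (simp add: q_def)
    have "\<bar>bump a b c p k x\<bar> = \<bar>poly p x\<bar> / q ^ k * exp (- c / q)"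
      using x q by (simp add: bump_def q_def[symmetric] abs_mult)
    also have "\<dots> \<le> P / q ^ k * ((real (k + 2) / c) ^ (k + 2) * q ^ (k + 2))"
      using exp_neg_divide_le_power[OF assms(2) q, of "k + 2"] P[of x] x q \<open>0 \<le> P\<close>
      by (intro mult_mono divide_right_mono) auto
    also have "\<dots> = K * q\<^sup>2"
      using q by (simp add: K_def power_add power2_eq_square)
    finally show ?thesis by (simp add: q_def)
  qed
  moreover have "0 \<le> K" using \<open>0 \<le> P\<close> assms by (simp add: K_def)
  ultimately have "\<forall>x. \<bar>bump a b c p k x\<bar> \<le> K * ((x - a) * (b - x))\<^sup>2"
    by (auto simp: bump_def)
  then show ?thesis using \<open>0 \<le> K\<close> by blast
qed

lemma DERIV_zero_if_quadratic:
  fixes f :: "real \<Rightarrow> real"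
  assumes "\<And>x. \<bar>f x\<bar> \<le> K * ((x - a) * (b - x))\<^sup>2" and y: "y = a \<or> y = b"
  shows "(f has_field_derivative 0) (at y)"
proof -
  have fy: "f y = 0" using assms(1)[of y] y by auto
  have "((\<lambda>h. f (y + h) / h) \<longlongrightarrow> 0) (at 0)"
  proof (rule Lim_null_comparison)
    \<comment> \<open>At x = y + h the product (x - a) (b - x) is h (b - a - h) if y = a and - h (b
      - a + h) if y = b. Its square divided by \<bar>h\<bar> still has a factor
      \<bar>h\<bar>.\<close>
    show "\<forall>\<^sub>F h in at 0. norm (f (y + h) / h) \<le> K * (\<bar>h\<bar> * (b - a - (if y = a then h else - h))\<^sup>2)"
    proof (rule eventually_at_filter[THEN iffD2], rule always_eventually, intro allI impI)
      fix h :: real assume h: "h \<noteq> 0"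
      have "\<bar>f (y + h)\<bar> \<le> K * (\<bar>h\<bar> * (b - a - (if y = a then h else - h))\<^sup>2) * \<bar>h\<bar>"
      proof (cases "y = a")
        case True
        then show ?thesis using assms(1)[of "y + h"] by (simp add: power_mult_distrib power2_eq_square algebra_simps abs_mult_self_eq)
      next
        case False
        then have "y = b" using y by auto
        then show ?thesis using assms(1)[of "y + h"] False by (simp add: power_mult_distrib power2_eq_square algebra_simps abs_mult_self_eq)
      qed
      then show "norm (f (y + h) / h) \<le> K * (\<bar>h\<bar> * (b - a - (if y = a then h else - h))\<^sup>2)"
        using h by (simp add: field_simps)
    qed
    show "((\<lambda>h. K * (\<bar>h\<bar> * (b - a - (if y = a then h else - h))\<^sup>2)) \<longlongrightarrow> 0) (at 0)"
      by (cases "y = a") (auto intro!: tendsto_eq_intros)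
  qed
  then show ?thesis by (simp add: DERIV_def fy)
qed

lemma DERIV_bump:
  assumes "a < b" "0 < c"
  shows "\<exists>p'. \<forall>x. (bump a b c p k has_field_derivative bump a b c p' (k + 2) x) (at x)"
proof -
  define Q where "Q = [:- a, 1:] * [:b, - 1:]"
  \<comment> \<open>The numerator of the derivative of \<open>p / Q ^ k * exp (- c / Q)\<close> over
    the common denominator \<open>Q ^ (k + 2)\<close>.\<close>
  define p' where "p' = pderiv p * Q\<^sup>2 - smult (real k) (p * pderiv Q * Q) + smult c (p * pderiv Q)"
  have Q: "poly Q x = (x - a) * (b - x)" for x by (simp add: Q_def algebra_simps)
  have "(bump a b c p k has_field_derivative bump a b c p' (k + 2) x) (at x)" for x
  proof -
    consider "a < x \<and> x < b" | "x < a \<or> b < x" | "x = a \<or> x = b" by linarith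
    then show ?thesis
    proof cases
      case 1
      have q: "poly Q x > 0" using 1 by (simp add: Q)
      have "((\<lambda>x. poly p x / poly Q x ^ k * exp (- c / poly Q x)) has_field_derivative
          (poly (pderiv p) x * poly Q x ^ k - poly p x * (real k * poly Q x ^ (k - 1) * poly (pderiv Q) x))
            / (poly Q x ^ k * poly Q x ^ k) * exp (- c / poly Q x)
          + exp (- c / poly Q x) * (c * poly (pderiv Q) x / (poly Q x * poly Q x)) * (poly p x / poly Q x ^ k)) (at x)"
        using q by (auto intro!: derivative_eq_intros simp: field_simps)
      also have "(poly (pderiv p) x * poly Q x ^ k - poly p x * (real k * poly Q x ^ (k - 1) * poly (pderiv Q) x))
            / (poly Q x ^ k * poly Q x ^ k) * exp (- c / poly Q x)
          + exp (- c / poly Q x) * (c * poly (pderiv Q) x / (poly Q x * poly Q x)) * (poly p x / poly Q x ^ k)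
          = bump a b c p' (k + 2) x"
        using q 1 unfolding bump_def Q[symmetric] p'_def
        by (cases k) (simp_all add: field_simps power2_eq_square)
      finally show ?thesis
        by (rule has_field_derivative_transform_within_open[of _ _ _ "{a<..<b}"])
          (use 1 in \<open>auto simp: bump_def Q\<close>)
    next
      case 2
      have "bump a b c p' (k + 2) x = 0" using 2 by (auto simp: bump_def)
      moreover have "((\<lambda>_. 0) has_field_derivative 0) (at x)" by simp
      then have "(bump a b c p k has_field_derivative 0) (at x)"
        by (rule has_field_derivative_transform_within_open[of _ _ _ "{..<a} \<union> {b<..}"])
          (use 2 in \<open>auto simp: bump_def\<close>)
      ultimately show ?thesis by simp
    next
      case 3
      obtain K where "\<And>x. \<bar>bump a b c p k x\<bar> \<le> K * ((x - a) * (b - x))\<^sup>2"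
        using bump_flat[OF assms] by blast
      from DERIV_zero_if_quadratic[OF this 3] have "(bump a b c p k has_field_derivative 0) (at x)" .
      moreover have "bump a b c p' (k + 2) x = 0" using 3 by (auto simp: bump_def)
      ultimately show ?thesis by simp
    qed
  qed
  then show ?thesis by blast
qed

lemma deriv_funpow_bump:
  assumes "a < b" "0 < c"
  shows "\<exists>p' k'. (deriv ^^ n) (bump a b c p k) = bump a b c p' k'"
proof (induction n)
  case (Suc n)
  then obtain p1 k1 where 1: "(deriv ^^ n) (bump a b c p k) = bump a b c p1 k1" by blast
  obtain p2 where "\<And>x. (bump a b c p1 k1 has_field_derivative bump a b c p2 (k1 + 2) x) (at x)"
    using DERIV_bump[OF assms] by blast
  then have "deriv (bump a b c p1 k1) = bump a b c p2 (k1 + 2)"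
    by (intro ext DERIV_imp_deriv)
  then show ?case using 1 by auto
qed auto

lemma test_function_bump:
  assumes "0 < a" "a < b" "b < 1" "0 < c"
  shows "test_function (bump a b c p k)"
  unfolding test_function_def
proof (intro conjI allI)
  fix n x
  obtain p' k' where n: "(deriv ^^ n) (bump a b c p k) = bump a b c p' k'"
    using deriv_funpow_bump[OF assms(2,4)] by blast
  show "(deriv ^^ n) (bump a b c p k) differentiable at x"
    unfolding n using DERIV_bump[OF assms(2,4)] real_differentiable_def by blast
  show "\<exists>a' b'. 0 < a' \<and> b' < 1 \<and> (\<forall>x. x \<notin> {a'..b'} \<longrightarrow> bump a b c p k x = 0)"
    using assms by (intro exI[of _ a] exI[of _ b]) (auto simp: bump_def)
qed

section \<open>The unit interval as a probability space, and half-lines as limits of test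
  functions\<close>

lemma space_unit_meas: "space unit_meas = {0<..<1}"
  by (simp add: unit_meas_def space_restrict_space)

lemma prob_space_unit_meas: "prob_space unit_meas"
  by (rule prob_spaceI) (simp add: unit_meas_def space_restrict_space emeasure_restrict_space)

lemma measurable_unit_meas: "f \<in> borel_measurable borel \<Longrightarrow> f \<in> borel_measurable unit_meas"
  unfolding unit_meas_def by (intro measurable_restrict_space1) simp

text \<open>The endpoints tend to 0 and t while c tends to 0, which flattens the exponential to 1
  between them. The summand 3 keeps the left endpoint strictly below the right one for every
  n.\<close>

lemma bump_tendsto_indicator:
  assumes "0 < (t::real)" "0 < x"
  shows "(\<lambda>n. bump (t / (real n + 3)) (t - t / (real n + 3)) (1 / (real n + 1)) 1 0 x)
           \<longlonglongrightarrow> indicator {..<t} x"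
proof (cases "x < t")
  case True
  define a where "a = (\<lambda>n. t / (real n + 3))"
  have a: "a \<longlonglongrightarrow> 0" unfolding a_def by real_asymp
  have "\<forall>\<^sub>F n in sequentially. a n < x" "\<forall>\<^sub>F n in sequentially. a n < t - x"
    using True assms by (auto intro!: order_tendstoD(2)[OF a])
  then have "\<forall>\<^sub>F n in sequentially. exp (- (1 / (real n + 1)) / ((x - a n) * (t - a n - x)))
      = bump (a n) (t - a n) (1 / (real n + 1)) 1 0 x"
    by eventually_elim (auto simp: bump_def)
  moreover have c: "(\<lambda>n. 1 / (real n + 1)) \<longlonglongrightarrow> 0" by real_asymp
  have "(\<lambda>n. exp (- (1 / (real n + 1)) / ((x - a n) * (t - a n - x)))) \<longlonglongrightarrow> exp (- 0 / ((x - 0) * (t - 0 - x)))"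
    by (intro tendsto_intros a c) (use True assms in auto)
  ultimately show ?thesis
    using True by (auto simp: a_def intro: Lim_transform_eventually)
next
  case False
  have "t - t / (real n + 3) < x" for n
    using False assms by (smt (verit, best) divide_pos_pos of_nat_0_le_iff)
  then have "bump (t / (real n + 3)) (t - t / (real n + 3)) (1 / (real n + 1)) 1 0 x = 0" for n
    unfolding bump_def by (smt (verit))
  then show ?thesis using False by simp
qed

lemma bump_abs_le_1: "0 < c \<Longrightarrow> \<bar>bump a b c 1 0 x\<bar> \<le> 1"
  by (auto simp: bump_def)

lemma borel_measurable_test_function:
  assumes "test_function \<phi>"
  shows "(deriv ^^ k) \<phi> \<in> borel_measurable unit_meas"
proof -
  have "continuous_on UNIV ((deriv ^^ k) \<phi>)"
    using assms by (auto simp: test_function_def intro!: continuous_at_imp_continuous_on differentiable_imp_continuous_within)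
  then have "(deriv ^^ k) \<phi> \<in> borel_measurable borel" by (rule borel_measurable_continuous_onI)
  then show ?thesis by (rule measurable_unit_meas)
qed

lemma integral_lessThan_eq_0:
  assumes w: "integrable unit_meas w"
    and 0: "\<And>\<phi>. test_function \<phi> \<Longrightarrow> (\<integral>x. w x * \<phi> x \<partial>unit_meas) = 0"
  shows "(\<integral>x. w x * indicator {..<t} x \<partial>unit_meas) = 0"
proof (cases "0 < t")
  case False
  then have "(\<integral>x. w x * indicator {..<t} x \<partial>unit_meas) = (\<integral>x. 0 \<partial>unit_meas)"
    by (intro Bochner_Integration.integral_cong) (auto simp: space_unit_meas indicator_def)
  then show ?thesis by simp
next
  case True
  \<comment> \<open>Test functions live on (0,1), so the bumps must end below 1. On (0,1) the
    half-lines up to t and up to t' agree.\<close>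
  define t' where "t' = min t 1"
  have t': "0 < t'" "t' \<le> 1" using True by (auto simp: t'_def)
  define \<phi> where "\<phi> n = bump (t' / (real n + 3)) (t' - t' / (real n + 3)) (1 / (real n + 1)) 1 0" for n :: nat
  have test: "test_function (\<phi> n)" for n
    unfolding \<phi>_def
  proof (rule test_function_bump)
    have "t' / (real n + 3) * 2 < t'" using t' by (simp add: field_simps add_pos_nonneg)
    then show "t' / (real n + 3) < t' - t' / (real n + 3)" by (simp add: mult.commute)
    show "0 < t' / (real n + 3)" using t' by simp
    then show "t' - t' / (real n + 3) < 1" using t' by linarith
  qed auto
  have meas: "\<phi> n \<in> borel_measurable unit_meas" for n
    using borel_measurable_test_function[OF test, of 0] by simp
  have "(\<lambda>n. \<integral>x. w x * \<phi> n x \<partial>unit_meas) \<longlonglongrightarrow> (\<integral>x. w x * indicator {..<t'} x \<partial>unit_meas)"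
  proof (rule integral_dominated_convergence)
    show "(\<lambda>x. w x * indicator {..<t'} x) \<in> borel_measurable unit_meas"
      using borel_measurable_integrable[OF w]
      by (intro borel_measurable_times measurable_unit_meas[of "indicator _"]) auto
    show "(\<lambda>x. w x * \<phi> n x) \<in> borel_measurable unit_meas" for n
      using w meas by (intro borel_measurable_times) auto
    show "integrable unit_meas (\<lambda>x. \<bar>w x\<bar>)" using w by simp
    show "AE x in unit_meas. (\<lambda>n. w x * \<phi> n x) \<longlonglongrightarrow> w x * indicator {..<t'} x"
      unfolding \<phi>_def using t'
      by (intro AE_I2 tendsto_intros bump_tendsto_indicator) (auto simp: space_unit_meas)
    show "AE x in unit_meas. norm (w x * \<phi> n x) \<le> \<bar>w x\<bar>" for n
      unfolding \<phi>_def by (intro AE_I2) (auto simp: abs_mult intro!: mult_right_le_one_le bump_abs_le_1)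
  qed
  then have "(\<integral>x. w x * indicator {..<t'} x \<partial>unit_meas) = 0"
    using 0[OF test] by (simp add: LIMSEQ_const_iff)
  also have "(\<integral>x. w x * indicator {..<t'} x \<partial>unit_meas) = (\<integral>x. w x * indicator {..<t} x \<partial>unit_meas)"
    by (intro Bochner_Integration.integral_cong) (auto simp: t'_def space_unit_meas indicator_def)
  finally show ?thesis .
qed

text \<open>The half-lines are an intersection-stable generator of the Borel sets, and the sets over
  which w integrates to 0 form a Dynkin system. So w has integral 0 over every Borel set.\<close>

lemma AE_eq_0_if_test_function:
  assumes w: "integrable unit_meas w"
    and 0: "\<And>\<phi>. test_function \<phi> \<Longrightarrow> (\<integral>x. w x * \<phi> x \<partial>unit_meas) = 0"
  shows "AE x in unit_meas. w x = 0"
proof -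
  interpret prob_space unit_meas by (rule prob_space_unit_meas)
  show ?thesis
  proof (rule density_zero[OF w])
  note lt = integral_lessThan_eq_0[OF w 0]
  have int: "integrable unit_meas (\<lambda>x. w x * indicator B x)" if "B \<in> sets borel" for B
  proof -
    have "integrable unit_meas (\<lambda>x. w x * indicator ({0<..<1} \<inter> B) x)"
      using that by (intro integrable_real_mult_indicator w) (auto simp: unit_meas_def sets_restrict_space)
    also have "?this \<longleftrightarrow> ?thesis"
      by (intro Bochner_Integration.integrable_cong) (auto simp: space_unit_meas indicator_def)
    finally show ?thesis .
  qed
  have total: "(\<integral>x. w x \<partial>unit_meas) = 0"
  proof -
    have "(\<integral>x. w x \<partial>unit_meas) = (\<integral>x. w x * indicator {..<1} x \<partial>unit_meas)"
      by (intro Bochner_Integration.integral_cong) (auto simp: space_unit_meas indicator_def)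
    then show ?thesis using lt by simp
  qed
  have B: "(\<integral>x. w x * indicator B x \<partial>unit_meas) = 0" if "B \<in> sets borel" for B
  proof -
    have sig: "B \<in> sigma_sets UNIV (range lessThan)"
      using that by (simp add: borel_Iio)
    have stable: "Int_stable (range (lessThan :: real \<Rightarrow> _))"
      by (auto simp: Int_stable_def image_iff intro: exI[of _ "min _ _"])
    have sub: "range lessThan \<subseteq> Pow (UNIV :: real set)" by simp
    from stable sub sig show ?thesis
    proof (induction rule: sigma_sets_induct_disjoint)
      case (basic A) then show ?case using lt by auto
    next
      case (compl A)
      then have "A \<in> sets borel" by (simp add: borel_Iio)
      have "(\<integral>x. w x * indicator (UNIV - A) x \<partial>unit_meas) = (\<integral>x. w x - w x * indicator A x \<partial>unit_meas)"
        by (intro Bochner_Integration.integral_cong) (auto simp: indicator_def)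
      then show ?case using compl total int[OF \<open>A \<in> sets borel\<close>] w by simp
    next
      case (union A)
      then have A: "range A \<subseteq> sets borel" by (simp add: borel_Iio)
      have m: "{0<..<1} \<inter> A i \<in> sets unit_meas" for i
        using A by (auto simp: unit_meas_def sets_restrict_space)
      have i: "(\<integral>x. w x * indicator C x \<partial>unit_meas) = set_lebesgue_integral unit_meas ({0<..<1} \<inter> C) w" for C
        unfolding set_lebesgue_integral_def
        by (intro Bochner_Integration.integral_cong) (auto simp: space_unit_meas indicator_def)
      have "set_lebesgue_integral unit_meas (\<Union>i. {0<..<1} \<inter> A i) w
          = (\<Sum>i. set_lebesgue_integral unit_meas ({0<..<1} \<inter> A i) w)"
      proof (rule lebesgue_integral_countable_add)
        show "set_integrable unit_meas (\<Union>i. {0<..<1} \<inter> A i) w"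
          unfolding set_integrable_def
          by (intro integrable_mult_indicator w sets.countable_UN) (use m in blast)
      qed (use m union(1) in \<open>auto simp: disjoint_family_on_def\<close>)
      also have "\<dots> = 0" using union i by simp
      finally show ?case by (simp add: i flip: Int_UN_distrib)
    qed auto
  qed
  fix A assume "A \<in> sets unit_meas"
  then obtain B where "B \<in> sets borel" "A = {0<..<1} \<inter> B"
    by (auto simp: unit_meas_def sets_restrict_space)
  then have "set_lebesgue_integral unit_meas A w = (\<integral>x. w x * indicator B x \<partial>unit_meas)"
    unfolding set_lebesgue_integral_def
    by (intro Bochner_Integration.integral_cong) (auto simp: space_unit_meas indicator_def)
  then show "set_lebesgue_integral unit_meas A w = 0" using B[OF \<open>B \<in> sets borel\<close>] by simp
  qed
qed

section \<open>Semi-inner products on function spaces\<close>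

text \<open>Instantiated by the L^2 and by the Sobolev inner product. Definiteness is left out
  because the elements are functions rather than classes; vectors of norm 0 replace the zero
  vector.\<close>

locale semi_inner =
  fixes S :: "('a \<Rightarrow> real) set" and ip :: "('a \<Rightarrow> real) \<Rightarrow> ('a \<Rightarrow> real) \<Rightarrow> real"
  assumes zero_mem: "(\<lambda>_. 0) \<in> S"
    and lincomb_mem: "\<And>u v a b. u \<in> S \<Longrightarrow> v \<in> S \<Longrightarrow> (\<lambda>x. a * u x + b * v x) \<in> S"
    and ip_sym: "\<And>u v. u \<in> S \<Longrightarrow> v \<in> S \<Longrightarrow> ip u v = ip v u"
    and ip_lincomb: "\<And>u v w a b. u \<in> S \<Longrightarrow> v \<in> S \<Longrightarrow> w \<in> S \<Longrightarrow>
      ip (\<lambda>x. a * u x + b * v x) w = a * ip u w + b * ip v w"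
    and ip_nonneg: "\<And>u. u \<in> S \<Longrightarrow> 0 \<le> ip u u"
begin

lemma scale_mem: "u \<in> S \<Longrightarrow> (\<lambda>x. a * u x) \<in> S"
  using lincomb_mem[of u u a 0] by simp

lemma diff_mem: "u \<in> S \<Longrightarrow> v \<in> S \<Longrightarrow> (\<lambda>x. u x - v x) \<in> S"
  using lincomb_mem[of u v 1 "-1"] by simp

lemma add_mem: "u \<in> S \<Longrightarrow> v \<in> S \<Longrightarrow> (\<lambda>x. u x + v x) \<in> S"
  using lincomb_mem[of u v 1 1] by simp

lemma sum_mem:
  assumes "\<And>i. i \<in> I \<Longrightarrow> e i \<in> S"
  shows "(\<lambda>x. \<Sum>i\<in>I. c i * e i x) \<in> S"
  using assms
proof (induction I rule: infinite_finite_induct)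
  case (insert i I)
  have "(\<lambda>x. c i * e i x + 1 * (\<Sum>i\<in>I. c i * e i x)) \<in> S"
    using insert by (intro lincomb_mem) auto
  then show ?case using insert by simp
qed (auto simp: zero_mem)

lemma ip_zero: "v \<in> S \<Longrightarrow> ip (\<lambda>_. 0) v = 0"
  using ip_lincomb[of v v v 0 0] by simp

lemma ip_scale: "u \<in> S \<Longrightarrow> v \<in> S \<Longrightarrow> ip (\<lambda>x. a * u x) v = a * ip u v"
  using ip_lincomb[of u u v a 0] by simp

lemma ip_diff: "u \<in> S \<Longrightarrow> v \<in> S \<Longrightarrow> w \<in> S \<Longrightarrow> ip (\<lambda>x. u x - v x) w = ip u w - ip v w"
  using ip_lincomb[of u v w 1 "-1"] by simp

lemma ip_add: "u \<in> S \<Longrightarrow> v \<in> S \<Longrightarrow> w \<in> S \<Longrightarrow> ip (\<lambda>x. u x + v x) w = ip u w + ip v w"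
  using ip_lincomb[of u v w 1 1] by simp

lemma ip_sum:
  assumes "\<And>i. i \<in> I \<Longrightarrow> e i \<in> S" "w \<in> S"
  shows "ip (\<lambda>x. \<Sum>i\<in>I. c i * e i x) w = (\<Sum>i\<in>I. c i * ip (e i) w)"
  using assms
proof (induction I rule: infinite_finite_induct)
  case (insert i I)
  have "ip (\<lambda>x. c i * e i x + 1 * (\<Sum>i\<in>I. c i * e i x)) w
      = c i * ip (e i) w + 1 * ip (\<lambda>x. \<Sum>i\<in>I. c i * e i x) w"
    using insert by (intro ip_lincomb sum_mem) auto
  then show ?case using insert by simp
qed (auto simp: ip_zero)

lemma ip_sum_right:
  assumes "\<And>i. i \<in> I \<Longrightarrow> e i \<in> S" "w \<in> S"
  shows "ip w (\<lambda>x. \<Sum>i\<in>I. c i * e i x) = (\<Sum>i\<in>I. c i * ip w (e i))"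
proof -
  have "ip w (\<lambda>x. \<Sum>i\<in>I. c i * e i x) = ip (\<lambda>x. \<Sum>i\<in>I. c i * e i x) w"
    by (intro ip_sym assms sum_mem)
  also have "\<dots> = (\<Sum>i\<in>I. c i * ip w (e i))"
    using assms by (auto simp: ip_sum intro!: sum.cong ip_sym)
  finally show ?thesis .
qed

lemma ip_diff_right: "u \<in> S \<Longrightarrow> v \<in> S \<Longrightarrow> w \<in> S \<Longrightarrow> ip w (\<lambda>x. u x - v x) = ip w u - ip w v"
  using ip_diff[of u v w] ip_sym[of w] diff_mem by simp

lemma ip_add_right: "u \<in> S \<Longrightarrow> v \<in> S \<Longrightarrow> w \<in> S \<Longrightarrow> ip w (\<lambda>x. u x + v x) = ip w u + ip w v"
  using ip_add[of u v w] ip_sym[of w] add_mem by simp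

lemma ip_add_self:
  assumes "u \<in> S" "v \<in> S"
  shows "ip (\<lambda>x. u x + v x) (\<lambda>x. u x + v x) = ip u u + 2 * ip u v + ip v v"
  using assms by (simp add: ip_add ip_add_right add_mem ip_sym[of v u])

lemma ip_null:
  assumes "u \<in> S" "v \<in> S" "ip u u = 0"
  shows "ip u v = 0"
proof (rule ccontr)
  assume ne: "ip u v \<noteq> 0"
  \<comment> \<open>Chosen so that 2 a \<open>ip u v\<close> + \<open>ip v v\<close> = -1, which
    contradicts semidefiniteness once the quadratic term in a vanishes.\<close>
  define a where "a = - (ip v v + 1) / (2 * ip u v)"
  have "0 \<le> ip (\<lambda>x. a * u x + v x) (\<lambda>x. a * u x + v x)"
    using assms by (intro ip_nonneg add_mem scale_mem)
  also have "\<dots> = a * (a * ip u u) + 2 * (a * ip u v) + ip v v"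
    using assms by (simp add: ip_add_self scale_mem ip_scale ip_sym[of u "\<lambda>x. a * u x"])
  also have "\<dots> = - 1" using assms ne by (simp add: a_def field_simps)
  finally show False by simp
qed

lemma ip_null_right: "u \<in> S \<Longrightarrow> v \<in> S \<Longrightarrow> ip v v = 0 \<Longrightarrow> ip u v = 0"
  using ip_null[of v u] ip_sym by simp

section \<open>Orthonormal systems, projections and Gram-Schmidt orthogonalisation\<close>

definition orthonormal :: "nat \<Rightarrow> (nat \<Rightarrow> 'a \<Rightarrow> real) \<Rightarrow> bool" where
  "orthonormal m e \<longleftrightarrow> (\<forall>i<m. e i \<in> S) \<and> (\<forall>i<m. \<forall>j<m. ip (e i) (e j) = (if i = j then 1 else 0))"

definition proj :: "nat \<Rightarrow> (nat \<Rightarrow> 'a \<Rightarrow> real) \<Rightarrow> ('a \<Rightarrow> real) \<Rightarrow> 'a \<Rightarrow> real" where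
  "proj m e u x = (\<Sum>k<m. ip u (e k) * e k x)"

definition null :: "('a \<Rightarrow> real) \<Rightarrow> bool" where
  "null u \<longleftrightarrow> u \<in> S \<and> ip u u = 0"

lemma proj_mem: "orthonormal m e \<Longrightarrow> proj m e u \<in> S"
  unfolding proj_def orthonormal_def by (intro sum_mem) auto

lemma ip_proj_basis:
  assumes "orthonormal m e" "u \<in> S" "k < m"
  shows "ip (proj m e u) (e k) = ip u (e k)"
proof -
  have "ip (proj m e u) (e k) = (\<Sum>i<m. ip u (e i) * ip (e i) (e k))"
    using assms unfolding proj_def orthonormal_def by (intro ip_sum) auto
  also have "\<dots> = (\<Sum>i<m. if i = k then ip u (e i) else 0)"
    using assms by (intro sum.cong) (auto simp: orthonormal_def)
  finally show ?thesis using assms by simp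
qed

lemma ip_proj_left:
  assumes "orthonormal m e" "u \<in> S" "w \<in> S"
  shows "ip (proj m e u) w = (\<Sum>k<m. ip u (e k) * ip w (e k))"
  using assms ip_sym[of w] unfolding proj_def orthonormal_def by (subst ip_sum) (auto intro!: sum.cong)

lemma ip_residual_proj:
  assumes "orthonormal m e" "u \<in> S" "w \<in> S"
  shows "ip (\<lambda>x. u x - proj m e u x) (proj m e w) = 0"
proof -
  have "ip (\<lambda>x. u x - proj m e u x) (proj m e w) = (\<Sum>k<m. ip w (e k) * ip (\<lambda>x. u x - proj m e u x) (e k))"
    using assms unfolding proj_def[of m e w, abs_def]
    by (intro ip_sum_right) (auto simp: diff_mem proj_mem orthonormal_def)
  also have "\<dots> = 0"
    using assms by (intro sum.neutral) (auto simp: ip_diff proj_mem ip_proj_basis orthonormal_def)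
  finally show ?thesis .
qed

lemma ip_self_proj:
  assumes "orthonormal m e" "u \<in> S"
  shows "ip u u = ip (\<lambda>x. u x - proj m e u x) (\<lambda>x. u x - proj m e u x) + (\<Sum>k<m. (ip u (e k))\<^sup>2)"
proof -
  let ?r = "\<lambda>x. u x - proj m e u x"
  have r: "?r \<in> S" using assms by (intro diff_mem proj_mem)
  have "ip (\<lambda>x. ?r x + proj m e u x) (\<lambda>x. ?r x + proj m e u x)
      = ip ?r ?r + 2 * ip ?r (proj m e u) + ip (proj m e u) (proj m e u)"
    using assms r by (intro ip_add_self proj_mem)
  moreover have "ip (proj m e u) (proj m e u) = (\<Sum>k<m. (ip u (e k))\<^sup>2)"
    using assms by (subst ip_proj_left) (auto simp: proj_mem ip_proj_basis power2_eq_square intro!: sum.cong)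
  ultimately show ?thesis using ip_residual_proj[OF assms assms(2)] by simp
qed

text \<open>It is enough that u lies in the span up to a null vector: the component of w outside the
  span is then invisible to u.\<close>

lemma parseval:
  assumes "orthonormal m e" "u \<in> S" "w \<in> S" "null (\<lambda>x. u x - proj m e u x)"
  shows "ip u w = (\<Sum>k<m. ip u (e k) * ip w (e k))"
proof -
  have "ip (\<lambda>x. u x - proj m e u x) w = 0"
    using assms(3,4) unfolding null_def by (auto intro: ip_null[OF _ assms(3)])
  then show ?thesis using ip_diff[OF assms(2) proj_mem[OF assms(1)] assms(3)] ip_proj_left[OF assms(1-3)] by simp
qed

text \<open>The v i may be dependent: a residual of norm 0 adds no basis vector, so m can be smaller
  than n. The last conjunct is an equality of functions, not only almost everywhere; it is what
  later places projections inside a given subspace.\<close>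

lemma gram_schmidt:
  fixes n :: nat
  assumes "\<And>i. i < n \<Longrightarrow> v i \<in> S"
  shows "\<exists>m e. orthonormal m e \<and> (\<forall>i<n. null (\<lambda>x. v i x - proj m e (v i) x)) \<and>
           (\<forall>k<m. \<exists>c. e k = (\<lambda>x. \<Sum>i<n. c i * v i x))"
  using assms
proof (induction n)
  case 0
  show ?case by (intro exI[of _ 0]) (auto simp: orthonormal_def)
next
  case (Suc n)
  then obtain m e where e: "orthonormal m e"
    and null: "\<And>i. i < n \<Longrightarrow> null (\<lambda>x. v i x - proj m e (v i) x)"
    and span: "\<And>k. k < m \<Longrightarrow> \<exists>c. e k = (\<lambda>x. \<Sum>i<n. c i * v i x)"
    by auto
  have span': "\<exists>c. e k = (\<lambda>x. \<Sum>i<Suc n. c i * v i x)" if k: "k < m" for k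
  proof -
    obtain c where "e k = (\<lambda>x. \<Sum>i<n. c i * v i x)" using span[OF k] by blast
    then show ?thesis by (intro exI[of _ "c(n := 0)"]) simp
  qed
  have v: "v n \<in> S" using Suc.prems by simp
  define r where "r = (\<lambda>x. v n x - proj m e (v n) x)"
  have r: "r \<in> S" unfolding r_def using v e by (intro diff_mem proj_mem)
  show ?case
  proof (cases "ip r r = 0")
    case True
    then have "null r" using r by (simp add: null_def)
    then have "null (\<lambda>x. v i x - proj m e (v i) x)" if "i < Suc n" for i
      using null[of i] that by (cases "i = n") (simp_all add: r_def)
    then show ?thesis using e span' by blast
  next
    case False
    then have pos: "0 < ip r r" using ip_nonneg[OF r] by simp
    define s where "s = sqrt (ip r r)"
    have s: "0 < s" "s * s = ip r r" using pos by (auto simp: s_def)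
    define e' where "e' = e(m := (\<lambda>x. (1 / s) * r x))"
    have e'm: "e' m \<in> S" unfolding e'_def using r by (simp add: scale_mem del: times_divide_eq_left)
    have rk: "ip r (e k) = 0" if "k < m" for k
      using that e v by (simp add: r_def ip_diff proj_mem ip_proj_basis orthonormal_def)
    have em: "ip (e' m) w = ip r w / s" if "w \<in> S" for w
      unfolding e'_def using ip_scale[OF r that, of "1 / s"] by simp
    have "ip (e' m) (e' m) = 1"
      using em[OF r] em[OF e'm] ip_sym[OF r e'm] s False by simp
    moreover have "ip (e' m) (e k) = 0" "ip (e k) (e' m) = 0" if "k < m" for k
      using em[of "e k"] rk[OF that] ip_sym[OF e'm, of "e k"] e that by (auto simp: orthonormal_def)
    ultimately have e': "orthonormal (Suc m) e'"
      using e e'm unfolding orthonormal_def by (auto simp: less_Suc_eq e'_def)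
    have proj': "proj (Suc m) e' u x = proj m e u x + ip u (e' m) * e' m x" for u x
      by (simp add: proj_def e'_def)
    have null': "null (\<lambda>x. v i x - proj (Suc m) e' (v i) x)" if i: "i < Suc n" for i
    proof (cases "i = n")
      case True
      have "ip (v n) r = ip r r"
      proof -
        have "ip r (proj m e (v n)) = 0"
          unfolding r_def using e v by (rule ip_residual_proj[OF _ _ v])
        moreover have "ip r r = ip r (v n) - ip r (proj m e (v n))"
          using ip_diff_right[OF v proj_mem[OF e] r] by (simp add: r_def)
        ultimately show ?thesis using ip_sym[OF v r] by simp
      qed
      then have "ip (v n) (e' m) = s"
        using em[OF v] ip_sym[OF v e'm] ip_sym[OF v r] s
        by (metis nonzero_mult_div_cancel_left less_irrefl)
      then have "(\<lambda>x. v i x - proj (Suc m) e' (v i) x) = (\<lambda>_. 0)"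
        using s True unfolding proj' by (auto simp: e'_def r_def)
      then show ?thesis by (simp add: null_def zero_mem ip_zero)
    next
      case False
      then have ni: "null (\<lambda>x. v i x - proj m e (v i) x)" using null i by simp
      have vi: "v i \<in> S" using Suc.prems i by simp
      have "ip (v i) r = 0"
      proof -
        have "ip (\<lambda>x. v i x - proj m e (v i) x) r = 0"
          using ni ip_null[OF _ r] by (simp add: null_def)
        moreover have "ip (proj m e (v i)) r = 0"
          using ip_residual_proj[OF e v vi] ip_sym[OF r proj_mem[OF e]] by (simp add: r_def)
        ultimately show ?thesis using ip_diff[OF vi proj_mem[OF e] r] by simp
      qed
      then have "ip (v i) (e' m) = 0"
        using em[OF vi] ip_sym[OF vi e'm] ip_sym[OF vi r] by simp
      then show ?thesis using ni by (simp add: proj')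
    qed
    have "\<exists>c. e' k = (\<lambda>x. \<Sum>i<Suc n. c i * v i x)" if k: "k < Suc m" for k
    proof (cases "k = m")
      case True
      have "\<forall>k. \<exists>c. k < m \<longrightarrow> e k = (\<lambda>x. \<Sum>i<n. c i * v i x)" using span by blast
      then obtain c where c: "\<And>k. k < m \<Longrightarrow> e k = (\<lambda>x. \<Sum>i<n. c k i * v i x)" by metis
      \<comment> \<open>Coefficients of the normalised residual (v n - proj) / s, after each e k is
        expanded in the earlier v i.\<close>
      define c' where "c' = (\<lambda>i. if i = n then 1 / s else - (1 / s) * (\<Sum>k<m. ip (v n) (e k) * c k i))"
      have "e' m x = (\<Sum>i<Suc n. c' i * v i x)" for x
      proof -
        have "proj m e (v n) x = (\<Sum>k<m. \<Sum>i<n. ip (v n) (e k) * c k i * v i x)"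
          unfolding proj_def by (intro sum.cong) (auto simp: c sum_distrib_left mult.assoc)
        also have "\<dots> = (\<Sum>i<n. (\<Sum>k<m. ip (v n) (e k) * c k i) * v i x)"
          by (subst sum.swap) (simp add: sum_distrib_right)
        also have "- (1 / s) * \<dots> = (\<Sum>i<n. c' i * v i x)"
          unfolding sum_distrib_left by (intro sum.cong) (auto simp: c'_def)
        finally have "(\<Sum>i<n. c' i * v i x) = - (1 / s) * proj m e (v n) x" by simp
        moreover have "c' n = 1 / s" by (simp add: c'_def)
        ultimately show ?thesis by (simp add: e'_def r_def diff_divide_distrib)
      qed
      then show ?thesis using True by blast
    qed (use span' k in \<open>auto simp: e'_def\<close>)
    then show ?thesis using e' null' by blast
  qed
qed

end

section \<open>Orthogonal diagonalisation\<close>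

text \<open>The (i, j) entry of q A q^T for the leading n by n blocks. With A the Gram matrix of a
  basis it is the Gram matrix of the combinations given by the rows of q.\<close>

definition row_form :: "nat \<Rightarrow> (nat \<Rightarrow> nat \<Rightarrow> real) \<Rightarrow> (nat \<Rightarrow> nat \<Rightarrow> real) \<Rightarrow> nat \<Rightarrow> nat \<Rightarrow> real" where
  "row_form n A q i j = (\<Sum>k<n. \<Sum>l<n. q i k * q j l * A k l)"

lemma row_form_lincomb:
  assumes "\<And>a k. k < n \<Longrightarrow> q' a k = \<alpha> a * q a k + \<beta> a * q (p a) k"
  shows "row_form n A q' a b = \<alpha> a * \<alpha> b * row_form n A q a b + \<alpha> a * \<beta> b * row_form n A q a (p b)
    + \<beta> a * \<alpha> b * row_form n A q (p a) b + \<beta> a * \<beta> b * row_form n A q (p a) (p b)"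
  unfolding row_form_def sum_distrib_left sum.distrib[symmetric]
  by (intro sum.cong refl) (simp add: assms algebra_simps)

lemma row_form_id: "row_form n (\<lambda>k l. of_bool (k = l)) q i j = (\<Sum>k<n. q i k * q j k)"
  unfolding row_form_def by (intro sum.cong) (auto simp: of_bool_def if_distrib cong: if_cong)

text \<open>Both relations are recorded instead of deriving one from the other. The one for rows
  makes a rotated basis orthonormal, the one for columns leaves the projection onto the span
  unchanged.\<close>

definition orthogonal_mat :: "nat \<Rightarrow> (nat \<Rightarrow> nat \<Rightarrow> real) \<Rightarrow> bool" where
  "orthogonal_mat n q \<longleftrightarrow> (\<forall>i<n. \<forall>j<n. (\<Sum>k<n. q i k * q j k) = of_bool (i = j)) \<and>
     (\<forall>i<n. \<forall>j<n. (\<Sum>k<n. q k i * q k j) = of_bool (i = j))"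

lemma orthogonal_abs_le_1:
  assumes "orthogonal_mat n q" "i < n" "j < n"
  shows "\<bar>q i j\<bar> \<le> 1"
proof -
  have "(q i j)\<^sup>2 \<le> (\<Sum>k<n. (q i k)\<^sup>2)" using assms by (intro member_le_sum) auto
  also have "\<dots> = 1" using assms by (simp add: orthogonal_mat_def power2_eq_square)
  finally show ?thesis by (simp add: abs_square_le_1)
qed

text \<open>The Givens rotation acting on rows i and j of q.\<close>

definition rot :: "nat \<Rightarrow> nat \<Rightarrow> real \<Rightarrow> real \<Rightarrow> (nat \<Rightarrow> nat \<Rightarrow> real) \<Rightarrow> nat \<Rightarrow> nat \<Rightarrow> real" where
  "rot i j c s q a k = (if a = i then c * q i k + s * q j k else if a = j then c * q j k - s * q i k else q a k)"

text \<open>Every new row a is a combination of row a and one partner row p a, so bilinearity covers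
  all positions of a and b with a single formula.\<close>

lemma row_form_rot:
  assumes "i \<noteq> j"
  shows "row_form n A (rot i j c s q) a b =
    (let \<alpha> = \<lambda>a. if a = i \<or> a = j then c else 1;
         \<beta> = \<lambda>a. if a = i then s else if a = j then - s else 0;
         p = \<lambda>a. if a = i then j else if a = j then i else a
     in \<alpha> a * \<alpha> b * row_form n A q a b + \<alpha> a * \<beta> b * row_form n A q a (p b)
      + \<beta> a * \<alpha> b * row_form n A q (p a) b + \<beta> a * \<beta> b * row_form n A q (p a) (p b))"
  unfolding Let_def by (rule row_form_lincomb) (use assms in \<open>auto simp: rot_def\<close>)

text \<open>Row products are \<open>row_form\<close> for the identity matrix, so the rotation
  formula applies to them as well. For the column products only the terms of rows i and j change, by
  a multiple of \<open>c\<^sup>2 + s\<^sup>2 - 1\<close>.\<close>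

lemma orthogonal_rot:
  assumes q: "orthogonal_mat n q" and ij: "i < n" "j < n" "i \<noteq> j" and cs: "c\<^sup>2 + s\<^sup>2 = 1"
  shows "orthogonal_mat n (rot i j c s q)"
  unfolding orthogonal_mat_def
proof (intro conjI allI impI)
  fix a b assume ab: "a < n" "b < n"
  have R: "row_form n (\<lambda>k l. of_bool (k = l)) q a b = of_bool (a = b)" if "a < n" "b < n" for a b
    using q that by (simp add: row_form_id orthogonal_mat_def)
  have cs': "c * c + s * s = 1" using cs by (simp add: power2_eq_square)
  show "(\<Sum>k<n. rot i j c s q a k * rot i j c s q b k) = of_bool (a = b)"
    unfolding row_form_id[symmetric] row_form_rot[OF ij(3)] Let_def
    using R ab ij cs' by (auto simp: add.commute)
  have "(\<Sum>k<n. rot i j c s q k a * rot i j c s q k b - q k a * q k b)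
      = (\<Sum>k\<in>{i, j}. rot i j c s q k a * rot i j c s q k b - q k a * q k b)"
    using ij by (intro sum.mono_neutral_right) (auto simp: rot_def)
  also have "\<dots> = (c * c + s * s - 1) * (q i a * q i b + q j a * q j b)"
    using ij by (simp add: rot_def algebra_simps)
  finally have "(\<Sum>k<n. rot i j c s q k a * rot i j c s q k b) = (\<Sum>k<n. q k a * q k b)"
    using cs' by (simp add: sum_subtractf)
  then show "(\<Sum>k<n. rot i j c s q k a * rot i j c s q k b) = of_bool (a = b)"
    using q ab by (simp add: orthogonal_mat_def)
qed

lemma continuous_on_row_form:
  "continuous_on UNIV (\<lambda>q :: nat \<times> nat \<Rightarrow> real. row_form n A (curry q) i j)"
  unfolding row_form_def curry_def by (intro continuous_intros continuous_on_product_coordinates)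

text \<open>Orthogonal matrices form a closed subset of a product of intervals [-1, 1], which is
  compact by Tychonoff, and the weighted trace is continuous for the product topology.\<close>

lemma exists_orthogonal_maximiser:
  "\<exists>q. orthogonal_mat n q \<and> (\<forall>q'. orthogonal_mat n q' \<longrightarrow>
     (\<Sum>i<n. w i * row_form n A q' i i) \<le> (\<Sum>i<n. w i * row_form n A q i i))"
proof -
  define X where "X = PiE UNIV (\<lambda>_ :: nat \<times> nat. {-1..1 :: real}) \<inter> {q. orthogonal_mat n (curry q)}"
  define \<Phi> where "\<Phi> q = (\<Sum>i<n. w i * row_form n A (curry q) i i)" for q
  have "compact (PiE UNIV (\<lambda>_ :: nat \<times> nat. {-1..1 :: real}))"
    using compactin_PiE[of "\<lambda>_ :: nat \<times> nat. euclideanreal" UNIV "\<lambda>_. {-1..1}"]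
    by (simp add: euclidean_product_topology)
  moreover have "closed {q. orthogonal_mat n (curry q)}"
  proof -
    have "{q. orthogonal_mat n (curry q)} =
        (\<Inter>i\<in>{..<n}. \<Inter>j\<in>{..<n}. {q. (\<Sum>k<n. q (i, k) * q (j, k)) = of_bool (i = j)}) \<inter>
        (\<Inter>i\<in>{..<n}. \<Inter>j\<in>{..<n}. {q. (\<Sum>k<n. q (k, i) * q (k, j)) = of_bool (i = j)})"
      by (auto simp: orthogonal_mat_def)
    also have "closed \<dots>"
      by (intro closed_Int closed_INT ballI closed_Collect_eq continuous_intros continuous_on_product_coordinates)
    finally show ?thesis .
  qed
  ultimately have "compact X" unfolding X_def by (rule compact_Int_closed)
  \<comment> \<open>Entries outside the n by n block are unconstrained. Setting them to 0 moves any
    orthogonal matrix into X and leaves the weighted trace unchanged.\<close>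
  define ext where "ext q = (\<lambda>(i, j). if i < n \<and> j < n then q i j else 0 :: real)" for q :: "nat \<Rightarrow> nat \<Rightarrow> real"
  have ext_orth: "ext q \<in> X" if "orthogonal_mat n q" for q
    using orthogonal_abs_le_1[OF that] that by (auto simp: X_def ext_def orthogonal_mat_def abs_le_iff)
  have ext_\<Phi>: "\<Phi> (ext q) = (\<Sum>i<n. w i * row_form n A q i i)" for q
    by (simp add: \<Phi>_def ext_def row_form_def)
  have "orthogonal_mat n (\<lambda>i j. of_bool (i = j))"
  proof -
    have 1: "(\<Sum>k<n. of_bool (i = k) * of_bool (j = k)) = (of_bool (i = j) :: real)" if "i < n" for i j
    proof -
      have "(\<Sum>k<n. of_bool (i = k) * of_bool (j = k)) = (\<Sum>k<n. if k = i then of_bool (i = j) else 0 :: real)"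
        by (rule sum.cong[OF refl]) auto
      then show ?thesis using that by simp
    qed
    have 2: "(\<Sum>k<n. of_bool (k = i) * of_bool (k = j)) = (of_bool (i = j) :: real)" if "i < n" for i j
    proof -
      have "(\<Sum>k<n. of_bool (k = i) * of_bool (k = j)) = (\<Sum>k<n. if k = i then of_bool (i = j) else 0 :: real)"
        by (rule sum.cong[OF refl]) auto
      then show ?thesis using that by simp
    qed
    show ?thesis unfolding orthogonal_mat_def using 1 2 by blast
  qed
  then have "X \<noteq> {}" using ext_orth by blast
  moreover have "continuous_on X \<Phi>"
    unfolding \<Phi>_def by (intro continuous_intros continuous_on_subset[OF continuous_on_row_form]) auto
  ultimately obtain q where "q \<in> X" "\<And>q'. q' \<in> X \<Longrightarrow> \<Phi> q' \<le> \<Phi> q"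
    using continuous_attains_sup[OF \<open>compact X\<close>] by blast
  then show ?thesis
  proof (intro exI conjI allI impI)
    show "orthogonal_mat n (curry q)" using \<open>q \<in> X\<close> by (simp add: X_def)
    fix q' assume "orthogonal_mat n q'"
    then have "\<Phi> (ext q') \<le> \<Phi> q"
      by (intro \<open>\<And>q'. q' \<in> X \<Longrightarrow> \<Phi> q' \<le> \<Phi> q\<close> ext_orth)
    then show "(\<Sum>i<n. w i * row_form n A q' i i) \<le> (\<Sum>i<n. w i * row_form n A (curry q) i i)"
      unfolding ext_\<Phi> by (simp add: \<Phi>_def)
  qed
qed

lemma linear_eq_0_if_le_quadratic:
  assumes "\<And>x :: real. 2 * x * b + x\<^sup>2 * d \<le> 0"
  shows "b = 0"
proof (rule ccontr)
  assume b: "b \<noteq> 0"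
  \<comment> \<open>At x = t b the expression is t b^2 (2 + t d), and this t makes t \<bar>d\<bar>
    at most 1, hence the expression positive.\<close>
  define t where "t = 1 / (1 + \<bar>d\<bar>)"
  have t: "0 < t" "t * \<bar>d\<bar> \<le> 1" by (auto simp: t_def field_simps)
  have "2 * (t * b) * b + (t * b)\<^sup>2 * d = t * b\<^sup>2 * (2 + t * d)"
    by (simp add: power2_eq_square algebra_simps)
  moreover have "2 + t * d > 0"
    using t by (smt (verit, best) abs_mult_pos abs_le_iff mult_minus_right)
  ultimately show False using assms[of "t * b"] b t by (smt (verit) mult_pos_pos zero_less_power2)
qed

text \<open>At a maximiser of the weighted trace with decreasing weights no rotation of two rows increases the
  weighted trace, which forces the off-diagonal entries to vanish and the diagonal to be sorted.\<close>

lemma orthogonal_diagonalisation: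
  assumes sym: "\<And>i j. i < n \<Longrightarrow> j < n \<Longrightarrow> A i j = A j i"
  shows "\<exists>q. orthogonal_mat n q \<and> (\<forall>i<n. \<forall>j<n. i \<noteq> j \<longrightarrow> row_form n A q i j = 0) \<and>
    (\<forall>i j. i \<le> j \<longrightarrow> j < n \<longrightarrow> row_form n A q j j \<le> row_form n A q i i)"
proof -
  define w where "w i = - real i" for i
  obtain q where q: "orthogonal_mat n q"
    and max: "\<And>q'. orthogonal_mat n q' \<Longrightarrow>
      (\<Sum>i<n. w i * row_form n A q' i i) \<le> (\<Sum>i<n. w i * row_form n A q i i)"
    using exists_orthogonal_maximiser[of n w A] by blast
  let ?B = "row_form n A q"
  have B_sym: "?B i j = ?B j i" for i j
    unfolding row_form_def
    by (subst sum.swap) (auto intro!: sum.cong simp: sym)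
  \<comment> \<open>A rotation raises the i-th diagonal entry by this quantity and lowers the j-th
    by the same amount. As the weight of i exceeds that of j, maximality forbids a positive
    value.\<close>
  have rot: "2 * (c * s) * ?B i j + s\<^sup>2 * (?B j j - ?B i i) \<le> 0"
    if ij: "i < j" "j < n" and cs: "c\<^sup>2 + s\<^sup>2 = 1" for i j c s
  proof -
    let ?q = "rot i j c s q"
    let ?d = "2 * (c * s) * ?B i j + s\<^sup>2 * (?B j j - ?B i i)"
    have c: "c * c = 1 - s * s" using cs by (simp add: power2_eq_square)
    have "(\<Sum>k<n. w k * row_form n A ?q k k) - (\<Sum>k<n. w k * ?B k k)
        = (\<Sum>k<n. w k * (row_form n A ?q k k - ?B k k))"
      by (simp add: sum_subtractf right_diff_distrib)
    also have "\<dots> = (\<Sum>k\<in>{i, j}. w k * (row_form n A ?q k k - ?B k k))"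
      using ij by (intro sum.mono_neutral_right) (auto simp: row_form_rot Let_def)
    also have "\<dots> = w i * ?d - w j * ?d + (c * c + s * s - 1) * (w i * ?B i i + w j * ?B j j)"
      using ij B_sym[of j i] by (simp add: row_form_rot Let_def power2_eq_square algebra_simps)
    also have "\<dots> = w i * ?d - w j * ?d" by (simp add: c)
    also have "\<dots> = (real j - real i) * ?d" by (simp add: w_def algebra_simps)
    finally have "(real j - real i) * ?d \<le> 0"
      using max[OF orthogonal_rot[OF q _ _ _ cs, of i j]] ij by simp
    then show ?thesis using ij by (simp add: mult_le_0_iff)
  qed
  have sorted: "?B j j \<le> ?B i i" if "i < j" "j < n" for i j
    \<comment> \<open>The quarter turn swaps the two rows up to sign.\<close>
    using rot[OF that, of 0 1] by simp
  have diag: "?B i j = 0" if ij: "i < j" "j < n" for i j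
  proof (rule linear_eq_0_if_le_quadratic)
    fix x :: real
    have pos: "0 < 1 + x\<^sup>2" by (simp add: add_pos_nonneg)
    \<comment> \<open>The rotation by the angle with tangent x. Clearing the denominator 1 + x^2
      leaves a quadratic in x without constant term, so its linear coefficient must vanish.\<close>
    have "(1 / sqrt (1 + x\<^sup>2))\<^sup>2 + (x / sqrt (1 + x\<^sup>2))\<^sup>2 = 1"
      using pos by (simp add: power_divide flip: add_divide_distrib)
    from rot[OF ij this] have "(2 * x * ?B i j + x\<^sup>2 * (?B j j - ?B i i)) / (1 + x\<^sup>2) \<le> 0"
      using pos by (simp add: power_divide add_divide_distrib flip: power2_eq_square)
    then show "2 * x * ?B i j + x\<^sup>2 * (?B j j - ?B i i) \<le> 0"
      using pos by (simp add: divide_le_0_iff)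
  qed
  have "?B i j = 0" if "i < n" "j < n" "i \<noteq> j" for i j
    using that diag[of i j] diag[of j i] B_sym[of i j] by (cases "i < j") auto
  moreover have "?B j j \<le> ?B i i" if "i \<le> j" "j < n" for i j
    using sorted that by (cases "i = j") auto
  ultimately show ?thesis using q by blast
qed

section \<open>Lebesgue and Sobolev spaces\<close>

definition L2_inner :: "'a measure \<Rightarrow> ('a \<Rightarrow> real) \<Rightarrow> ('a \<Rightarrow> real) \<Rightarrow> real" where
  "L2_inner M u v = (\<integral>x. u x * v x \<partial>M)"

lemma L2_integrable_mult:
  assumes "u \<in> L2 M" "v \<in> L2 M"
  shows "integrable M (\<lambda>x. u x * v x)"
proof (rule Bochner_Integration.integrable_bound)
  show "integrable M (\<lambda>x. (u x)\<^sup>2 + (v x)\<^sup>2)" using assms by (simp add: L2_def)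
  show "(\<lambda>x. u x * v x) \<in> borel_measurable M" using assms by (auto simp: L2_def)
  show "AE x in M. norm (u x * v x) \<le> norm ((u x)\<^sup>2 + (v x)\<^sup>2)"
  proof (rule AE_I2)
    fix x
    have "2 * \<bar>u x * v x\<bar> \<le> (u x)\<^sup>2 + (v x)\<^sup>2"
      using sum_squares_bound[of "\<bar>u x\<bar>" "\<bar>v x\<bar>"] by (simp add: abs_mult)
    then show "norm (u x * v x) \<le> norm ((u x)\<^sup>2 + (v x)\<^sup>2)" by simp
  qed
qed

lemma L2_lincomb:
  assumes "u \<in> L2 M" "v \<in> L2 M"
  shows "(\<lambda>x. a * u x + b * v x) \<in> L2 M"
proof -
  have "integrable M (\<lambda>x. a\<^sup>2 * (u x * u x) + 2 * a * b * (u x * v x) + b\<^sup>2 * (v x * v x))"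
    using assms by (intro Bochner_Integration.integrable_add integrable_mult_right L2_integrable_mult)
  then have "integrable M (\<lambda>x. (a * u x + b * v x)\<^sup>2)"
    by (simp add: power2_eq_square algebra_simps)
  then show ?thesis using assms by (auto simp: L2_def)
qed

interpretation L2: semi_inner "L2 M" "L2_inner M" for M :: "'a measure"
proof
  fix u v w :: "'a \<Rightarrow> real" and a b :: real
  assume u: "u \<in> L2 M" and v: "v \<in> L2 M"
  show "(\<lambda>x. a * u x + b * v x) \<in> L2 M" using u v by (rule L2_lincomb)
  show "L2_inner M u v = L2_inner M v u" by (simp add: L2_inner_def mult.commute)
  assume w: "w \<in> L2 M"
  have "L2_inner M (\<lambda>x. a * u x + b * v x) w = (\<integral>x. a * (u x * w x) + b * (v x * w x) \<partial>M)"
    by (simp add: L2_inner_def algebra_simps)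
  also have "\<dots> = a * L2_inner M u w + b * L2_inner M v w"
    using u v w by (simp add: L2_inner_def L2_integrable_mult)
  finally show "L2_inner M (\<lambda>x. a * u x + b * v x) w = a * L2_inner M u w + b * L2_inner M v w" .
qed (auto simp: L2_def L2_inner_def)

lemma L2_norm_sq: "(L2_norm M u)\<^sup>2 = L2_inner M u u"
  by (simp add: L2_norm_def L2_inner_def power2_eq_square)

lemma L2_norm_nonneg [simp]: "0 \<le> L2_norm M u"
  by (simp add: L2_norm_def)

lemma L2_null_iff: "L2.null M u \<longleftrightarrow> u \<in> L2 M \<and> (AE x in M. u x = 0)"
proof -
  have "L2_inner M u u = 0 \<longleftrightarrow> (AE x in M. u x = 0)" if "u \<in> L2 M"
    using that L2_integrable_mult[OF that that] unfolding L2_inner_def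
    by (subst integral_nonneg_eq_0_iff_AE) auto
  then show ?thesis by (auto simp: L2.null_def)
qed

lemma L2_norm_cong_AE:
  assumes "u \<in> L2 M" "v \<in> L2 M" "AE x in M. u x = v x"
  shows "L2_norm M u = L2_norm M v"
proof -
  have "(\<integral>x. (u x)\<^sup>2 \<partial>M) = (\<integral>x. (v x)\<^sup>2 \<partial>M)"
    using assms by (intro integral_cong_AE) (auto simp: L2_def)
  then show ?thesis by (simp add: L2_norm_def)
qed

text \<open>Expansion of the nonnegative square norm of u - v. The factor 2 is harmless because the
  constants in the final bound are free.\<close>

lemma L2_norm_add_sq_le:
  assumes "u \<in> L2 M" "v \<in> L2 M"
  shows "(L2_norm M (\<lambda>x. u x + v x))\<^sup>2 \<le> 2 * (L2_norm M u)\<^sup>2 + 2 * (L2_norm M v)\<^sup>2"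
proof -
  have "0 \<le> L2_inner M (\<lambda>x. u x - v x) (\<lambda>x. u x - v x)"
    using assms by (intro L2.ip_nonneg L2.diff_mem)
  also have "\<dots> = L2_inner M u u - 2 * L2_inner M u v + L2_inner M v v"
    using assms L2.ip_sym[OF assms] by (simp add: L2.ip_diff L2.ip_diff_right L2.diff_mem)
  finally show ?thesis using L2.ip_add_self[OF assms] by (simp add: L2_norm_sq)
qed

lemma L2_integrable:
  assumes "finite_measure M" "u \<in> L2 M"
  shows "integrable M u"
proof -
  interpret finite_measure M by fact
  have "(\<lambda>_. 1) \<in> L2 M" by (simp add: L2_def)
  from L2_integrable_mult[OF assms(2) this] show ?thesis by simp
qed

lemma finite_unit_meas: "finite_measure unit_meas"
  using prob_space_unit_meas by (rule prob_space.finite_measure)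

section \<open>Weak derivatives and their uniqueness\<close>

lemma L2_mult_test_integrable:
  assumes "u \<in> L2 unit_meas" "test_function \<phi>"
  shows "integrable unit_meas (\<lambda>x. u x * (deriv ^^ k) \<phi> x)"
proof -
  have "continuous_on {0..1} ((deriv ^^ k) \<phi>)"
    using assms(2) by (auto simp: test_function_def
        intro!: continuous_at_imp_continuous_on differentiable_imp_continuous_within)
  then have "bounded ((deriv ^^ k) \<phi> ` {0..1})"
    by (intro compact_imp_bounded compact_continuous_image) auto
  then obtain K where K: "\<And>x. x \<in> {0..1} \<Longrightarrow> \<bar>(deriv ^^ k) \<phi> x\<bar> \<le> K"
    unfolding bounded_iff by (metis imageI real_norm_def)
  show ?thesis
  proof (rule Bochner_Integration.integrable_bound)
    show "integrable unit_meas (\<lambda>x. K * u x)"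
      using L2_integrable[OF finite_unit_meas assms(1)] by simp
    show "(\<lambda>x. u x * (deriv ^^ k) \<phi> x) \<in> borel_measurable unit_meas"
      using assms borel_measurable_test_function by (auto simp: L2_def)
    show "AE x in unit_meas. norm (u x * (deriv ^^ k) \<phi> x) \<le> norm (K * u x)"
    proof (rule AE_I2)
      fix x assume "x \<in> space unit_meas"
      then have "\<bar>(deriv ^^ k) \<phi> x\<bar> \<le> \<bar>K\<bar>" using K[of x] by (auto simp: space_unit_meas)
      then have "\<bar>(deriv ^^ k) \<phi> x\<bar> * \<bar>u x\<bar> \<le> \<bar>K\<bar> * \<bar>u x\<bar>" by (intro mult_right_mono) auto
      then show "norm (u x * (deriv ^^ k) \<phi> x) \<le> norm (K * u x)"
        by (simp add: abs_mult mult.commute)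
    qed
  qed
qed

lemma weak_deriv_unique:
  assumes "has_weak_deriv k u w" "has_weak_deriv k u w'"
  shows "AE x in unit_meas. w x = w' x"
proof -
  have w: "w \<in> L2 unit_meas" "w' \<in> L2 unit_meas" using assms by (auto simp: has_weak_deriv_def)
  have "AE x in unit_meas. w x - w' x = 0"
  proof (rule AE_eq_0_if_test_function)
    show "integrable unit_meas (\<lambda>x. w x - w' x)"
      by (intro L2_integrable finite_unit_meas L2.diff_mem w)
    fix \<phi> assume \<phi>: "test_function \<phi>"
    have i: "integrable unit_meas (\<lambda>x. w x * \<phi> x)" "integrable unit_meas (\<lambda>x. w' x * \<phi> x)"
      using L2_mult_test_integrable[OF w(1) \<phi>, of 0] L2_mult_test_integrable[OF w(2) \<phi>, of 0] by auto
    have "(\<integral>x. u x * (deriv ^^ k) \<phi> x \<partial>unit_meas) = (-1) ^ k * (\<integral>x. w x * \<phi> x \<partial>unit_meas)"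
      "(\<integral>x. u x * (deriv ^^ k) \<phi> x \<partial>unit_meas) = (-1) ^ k * (\<integral>x. w' x * \<phi> x \<partial>unit_meas)"
      using assms \<phi> unfolding has_weak_deriv_def by blast+
    then have "(\<integral>x. w x * \<phi> x \<partial>unit_meas) = (\<integral>x. w' x * \<phi> x \<partial>unit_meas)" by simp
    then show "(\<integral>x. (w x - w' x) * \<phi> x \<partial>unit_meas) = 0"
      using i by (simp add: left_diff_distrib)
  qed
  then show ?thesis by simp
qed

lemma has_weak_deriv_lincomb:
  assumes u: "has_weak_deriv k u u'" and v: "has_weak_deriv k v v'"
  shows "has_weak_deriv k (\<lambda>x. a * u x + b * v x) (\<lambda>x. a * u' x + b * v' x)"
  unfolding has_weak_deriv_def
proof (intro conjI allI impI)
  have L: "u \<in> L2 unit_meas" "v \<in> L2 unit_meas" "u' \<in> L2 unit_meas" "v' \<in> L2 unit_meas"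
    using assms by (auto simp: has_weak_deriv_def)
  then show "(\<lambda>x. a * u x + b * v x) \<in> L2 unit_meas" "(\<lambda>x. a * u' x + b * v' x) \<in> L2 unit_meas"
    by (auto intro: L2_lincomb)
  fix \<phi> assume \<phi>: "test_function \<phi>"
  note int = L2_mult_test_integrable[OF _ \<phi>] L2_mult_test_integrable[OF _ \<phi>, of _ 0, simplified]
  have "(\<integral>x. (a * u x + b * v x) * (deriv ^^ k) \<phi> x \<partial>unit_meas)
      = a * (\<integral>x. u x * (deriv ^^ k) \<phi> x \<partial>unit_meas) + b * (\<integral>x. v x * (deriv ^^ k) \<phi> x \<partial>unit_meas)"
    using L int by (simp add: distrib_right mult.assoc)
  also have "\<dots> = (-1) ^ k * (a * (\<integral>x. u' x * \<phi> x \<partial>unit_meas) + b * (\<integral>x. v' x * \<phi> x \<partial>unit_meas))"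
    using u v \<phi> by (simp add: has_weak_deriv_def algebra_simps)
  also have "\<dots> = (-1) ^ k * (\<integral>x. (a * u' x + b * v' x) * \<phi> x \<partial>unit_meas)"
    using L int by (simp add: distrib_right mult.assoc)
  finally show "(\<integral>x. (a * u x + b * v x) * (deriv ^^ k) \<phi> x \<partial>unit_meas)
      = (-1) ^ k * (\<integral>x. (a * u' x + b * v' x) * \<phi> x \<partial>unit_meas)" .
qed

lemma has_weak_deriv_weak_deriv: "has_weak_deriv k u w \<Longrightarrow> has_weak_deriv k u (weak_deriv k u)"
  unfolding weak_deriv_def using someI[of "has_weak_deriv k u" w] by simp

lemma weak_deriv_lincomb:
  assumes "has_weak_deriv k u u'" "has_weak_deriv k v v'"
  shows "AE x in unit_meas. weak_deriv k (\<lambda>x. a * u x + b * v x) x = a * weak_deriv k u x + b * weak_deriv k v x"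
  using has_weak_deriv_lincomb[OF assms[THEN has_weak_deriv_weak_deriv]]
  by (intro weak_deriv_unique) (auto intro: has_weak_deriv_weak_deriv)

text \<open>Even at order 0 the chosen derivative is some representative, equal to u only almost
  everywhere.\<close>

lemma weak_deriv_0:
  assumes "u \<in> L2 unit_meas"
  shows "AE x in unit_meas. weak_deriv 0 u x = u x"
proof -
  have "has_weak_deriv 0 u u" using assms by (simp add: has_weak_deriv_def)
  then show ?thesis by (intro weak_deriv_unique) (auto intro: has_weak_deriv_weak_deriv)
qed

text \<open>A null set N of the line gives null strips N x (0,1) and (0,1) x N. This carries
  almost-everywhere identities between derivatives into the double integral of the Gagliardo
  form.\<close>

lemma AE_unit_component:
  assumes "AE x in unit_meas. P x"
  shows "AE z in unit_meas \<Otimes>\<^sub>M unit_meas. P (fst z)" "AE z in unit_meas \<Otimes>\<^sub>M unit_meas. P (snd z)"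
proof -
  interpret prob_space unit_meas by (rule prob_space_unit_meas)
  interpret P: pair_prob_space unit_meas unit_meas ..
  obtain N where N: "N \<in> null_sets unit_meas" "{x \<in> space unit_meas. \<not> P x} \<subseteq> N"
    using assms by (auto elim!: AE_E)
  have "N \<times> space unit_meas \<in> null_sets (unit_meas \<Otimes>\<^sub>M unit_meas)"
       "space unit_meas \<times> N \<in> null_sets (unit_meas \<Otimes>\<^sub>M unit_meas)"
    using N by (auto simp: null_sets_def emeasure_pair_measure_Times)
  moreover have "{z \<in> space (unit_meas \<Otimes>\<^sub>M unit_meas). \<not> P (fst z)} \<subseteq> N \<times> space unit_meas"
    "{z \<in> space (unit_meas \<Otimes>\<^sub>M unit_meas). \<not> P (snd z)} \<subseteq> space unit_meas \<times> N"
    using N(2) by (auto simp: space_pair_measure)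
  ultimately show "AE z in unit_meas \<Otimes>\<^sub>M unit_meas. P (fst z)" "AE z in unit_meas \<Otimes>\<^sub>M unit_meas. P (snd z)"
    by (auto intro: AE_I')
qed

section \<open>The Gagliardo form and the Sobolev inner product\<close>

lemma gagliardo_lincomb:
  "gagliardo \<sigma> (\<lambda>x. a * u x + b * v x) w z = a * gagliardo \<sigma> u w z + b * gagliardo \<sigma> v w z"
  by (cases z) (simp add: gagliardo_def algebra_simps add_divide_distrib diff_divide_distrib)

lemma gagliardo_commute: "gagliardo \<sigma> u v = gagliardo \<sigma> v u"
  by (simp add: gagliardo_def mult.commute)

lemma gagliardo_measurable:
  assumes "u \<in> borel_measurable unit_meas" "v \<in> borel_measurable unit_meas"
  shows "gagliardo \<sigma> u v \<in> borel_measurable (unit_meas \<Otimes>\<^sub>M unit_meas)"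
proof -
  have [measurable]: "(\<lambda>x. x) \<in> borel_measurable unit_meas"
    by (rule measurable_unit_meas) simp
  note assms[measurable]
  show ?thesis unfolding gagliardo_def case_prod_beta by measurable
qed

lemma gagliardo_cong_AE:
  assumes "AE x in unit_meas. u x = u' x"
  shows "AE z in unit_meas \<Otimes>\<^sub>M unit_meas. gagliardo \<sigma> u v z = gagliardo \<sigma> u' v z"
  using AE_unit_component[OF assms] by eventually_elim (auto simp: gagliardo_def)

text \<open>The pointwise bound 2 \<bar>ab\<bar> \<le> a^2 + b^2 survives division by the kernel.
  Mixed terms have to be integrable before the form can be expanded bilinearly.\<close>

lemma gagliardo_integrable:
  assumes "u \<in> borel_measurable unit_meas" "v \<in> borel_measurable unit_meas"
    and "integrable (unit_meas \<Otimes>\<^sub>M unit_meas) (gagliardo \<sigma> u u)"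
    and "integrable (unit_meas \<Otimes>\<^sub>M unit_meas) (gagliardo \<sigma> v v)"
  shows "integrable (unit_meas \<Otimes>\<^sub>M unit_meas) (gagliardo \<sigma> u v)"
proof (rule Bochner_Integration.integrable_bound)
  show "integrable (unit_meas \<Otimes>\<^sub>M unit_meas) (\<lambda>z. gagliardo \<sigma> u u z + gagliardo \<sigma> v v z)"
    using assms by simp
  show "gagliardo \<sigma> u v \<in> borel_measurable (unit_meas \<Otimes>\<^sub>M unit_meas)"
    using assms by (intro gagliardo_measurable)
  have "\<bar>gagliardo \<sigma> u v z\<bar> \<le> gagliardo \<sigma> u u z + gagliardo \<sigma> v v z" for z
  proof -
    obtain x y where z: "z = (x, y)" by force
    have "2 * \<bar>(u x - u y) * (v x - v y)\<bar> \<le> (u x - u y)\<^sup>2 + (v x - v y)\<^sup>2"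
      using sum_squares_bound[of "\<bar>u x - u y\<bar>" "\<bar>v x - v y\<bar>"] by (simp add: abs_mult)
    then have "\<bar>(u x - u y) * (v x - v y)\<bar> / \<bar>x - y\<bar> powr (1 + 2 * \<sigma>)
        \<le> ((u x - u y)\<^sup>2 + (v x - v y)\<^sup>2) / \<bar>x - y\<bar> powr (1 + 2 * \<sigma>)"
      by (intro divide_right_mono) auto
    then show ?thesis by (simp add: z gagliardo_def power2_eq_square add_divide_distrib abs_divide)
  qed
  then show "AE z in unit_meas \<Otimes>\<^sub>M unit_meas.
      norm (gagliardo \<sigma> u v z) \<le> norm (gagliardo \<sigma> u u z + gagliardo \<sigma> v v z)"
    by (intro AE_I2) (auto intro: order_trans[OF _ abs_ge_self])
qed

lemma Hs_L2: "u \<in> Hs s \<Longrightarrow> u \<in> L2 unit_meas"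
  by (simp add: Hs_def)

lemma Hs_weak_deriv:
  assumes "u \<in> Hs s" "j \<le> nat \<lfloor>s\<rfloor>"
  shows "has_weak_deriv j u (weak_deriv j u)" "weak_deriv j u \<in> L2 unit_meas"
proof -
  show "has_weak_deriv j u (weak_deriv j u)"
    using assms by (auto simp: Hs_def intro: has_weak_deriv_weak_deriv)
  then show "weak_deriv j u \<in> L2 unit_meas" by (simp add: has_weak_deriv_def)
qed

lemma Hs_gagliardo_integrable:
  assumes "u \<in> Hs s" "v \<in> Hs s" "frac s \<noteq> 0"
  shows "integrable (unit_meas \<Otimes>\<^sub>M unit_meas)
    (gagliardo (frac s) (weak_deriv (nat \<lfloor>s\<rfloor>) u) (weak_deriv (nat \<lfloor>s\<rfloor>) v))"
proof (rule gagliardo_integrable)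
  have "0 < frac s" using assms(3) frac_ge_0[of s] by linarith
  then show "integrable (unit_meas \<Otimes>\<^sub>M unit_meas)
      (gagliardo (frac s) (weak_deriv (nat \<lfloor>s\<rfloor>) u) (weak_deriv (nat \<lfloor>s\<rfloor>) u))"
    "integrable (unit_meas \<Otimes>\<^sub>M unit_meas)
      (gagliardo (frac s) (weak_deriv (nat \<lfloor>s\<rfloor>) v) (weak_deriv (nat \<lfloor>s\<rfloor>) v))"
    using assms by (simp_all add: Hs_def)
  show "weak_deriv (nat \<lfloor>s\<rfloor>) u \<in> borel_measurable unit_meas"
    "weak_deriv (nat \<lfloor>s\<rfloor>) v \<in> borel_measurable unit_meas"
    using Hs_weak_deriv(2)[OF assms(1), of "nat \<lfloor>s\<rfloor>"] Hs_weak_deriv(2)[OF assms(2), of "nat \<lfloor>s\<rfloor>"]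
    by (simp_all add: L2_def)
qed

lemma Hs_lincomb:
  assumes u: "u \<in> Hs s" and v: "v \<in> Hs s"
  shows "(\<lambda>x. a * u x + b * v x) \<in> Hs s"
  unfolding Hs_def
proof (intro CollectI conjI allI impI)
  show "(\<lambda>x. a * u x + b * v x) \<in> L2 unit_meas" using u v by (intro L2_lincomb Hs_L2)
  show "\<exists>w. has_weak_deriv j (\<lambda>x. a * u x + b * v x) w" if "j \<le> nat \<lfloor>s\<rfloor>" for j
    using has_weak_deriv_lincomb[OF Hs_weak_deriv(1)[OF u that] Hs_weak_deriv(1)[OF v that]] by blast
  assume s: "0 < frac s"
  let ?k = "nat \<lfloor>s\<rfloor>" and ?P = "unit_meas \<Otimes>\<^sub>M unit_meas"
  let ?G = "gagliardo (frac s)" and ?w = "weak_deriv (nat \<lfloor>s\<rfloor>) (\<lambda>x. a * u x + b * v x)"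
  let ?u = "weak_deriv ?k u" and ?v = "weak_deriv ?k v"
  have AE: "AE x in unit_meas. ?w x = a * ?u x + b * ?v x"
    using weak_deriv_lincomb Hs_weak_deriv(1) u v by blast
  have w: "has_weak_deriv ?k (\<lambda>x. a * u x + b * v x) ?w"
    using has_weak_deriv_lincomb[OF Hs_weak_deriv(1)[OF u] Hs_weak_deriv(1)[OF v]]
    by (auto intro: has_weak_deriv_weak_deriv)
  have "integrable ?P (\<lambda>z. a * (a * ?G ?u ?u z + b * ?G ?v ?u z) + b * (a * ?G ?u ?v z + b * ?G ?v ?v z))"
    using Hs_gagliardo_integrable[OF _ _ less_imp_neq[OF s, symmetric]] u v by simp
  moreover have "AE z in ?P. a * (a * ?G ?u ?u z + b * ?G ?v ?u z) + b * (a * ?G ?u ?v z + b * ?G ?v ?v z) = ?G ?w ?w z"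
    using gagliardo_cong_AE[OF AE, of "frac s" ?w] gagliardo_cong_AE[OF AE, of "frac s" ?u]
      gagliardo_cong_AE[OF AE, of "frac s" ?v]
    by eventually_elim (simp add: gagliardo_lincomb gagliardo_commute[of _ ?u ?w] gagliardo_commute[of _ ?v ?w])
  moreover have "?G ?w ?w \<in> borel_measurable ?P"
    using w by (intro gagliardo_measurable) (auto simp: has_weak_deriv_def L2_def)
  ultimately show "integrable ?P (?G ?w ?w)" by (intro integrable_cong_AE_imp[of ?P _ "?G ?w ?w"])
qed

lemma Hs_inner_lincomb:
  assumes u: "u \<in> Hs s" and v: "v \<in> Hs s" and w: "w \<in> Hs s"
  shows "Hs_inner s (\<lambda>x. a * u x + b * v x) w = a * Hs_inner s u w + b * Hs_inner s v w"
proof -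
  let ?k = "nat \<lfloor>s\<rfloor>" and ?P = "unit_meas \<Otimes>\<^sub>M unit_meas" and ?c = "\<lambda>x. a * u x + b * v x"
  have c: "?c \<in> Hs s" using u v by (rule Hs_lincomb)
  have AE: "AE x in unit_meas. weak_deriv j ?c x = a * weak_deriv j u x + b * weak_deriv j v x"
    if "j \<le> ?k" for j
    using weak_deriv_lincomb Hs_weak_deriv(1) u v that by blast
  have 1: "(\<integral>x. weak_deriv j ?c x * weak_deriv j w x \<partial>unit_meas)
      = a * (\<integral>x. weak_deriv j u x * weak_deriv j w x \<partial>unit_meas) + b * (\<integral>x. weak_deriv j v x * weak_deriv j w x \<partial>unit_meas)"
    if j: "j \<le> ?k" for j
  proof -
    note L = Hs_weak_deriv(2)[OF _ j]
    have "(\<integral>x. weak_deriv j ?c x * weak_deriv j w x \<partial>unit_meas)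
        = L2_inner unit_meas (\<lambda>x. a * weak_deriv j u x + b * weak_deriv j v x) (weak_deriv j w)"
      unfolding L2_inner_def
      using AE[OF j] L[OF c] L[OF u] L[OF v] L[OF w]
      by (intro integral_cong_AE) (auto simp: L2_def elim: AE_mp)
    also have "\<dots> = a * L2_inner unit_meas (weak_deriv j u) (weak_deriv j w)
        + b * L2_inner unit_meas (weak_deriv j v) (weak_deriv j w)"
      by (intro L2.ip_lincomb L u v w)
    finally show ?thesis by (simp add: L2_inner_def)
  qed
  have 2: "(\<integral>z. gagliardo (frac s) (weak_deriv ?k ?c) (weak_deriv ?k w) z \<partial>?P)
      = a * (\<integral>z. gagliardo (frac s) (weak_deriv ?k u) (weak_deriv ?k w) z \<partial>?P)
      + b * (\<integral>z. gagliardo (frac s) (weak_deriv ?k v) (weak_deriv ?k w) z \<partial>?P)" if s: "frac s \<noteq> 0"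
  proof -
    note I = Hs_gagliardo_integrable[OF _ _ s]
    have "(\<integral>z. gagliardo (frac s) (weak_deriv ?k ?c) (weak_deriv ?k w) z \<partial>?P)
        = (\<integral>z. a * gagliardo (frac s) (weak_deriv ?k u) (weak_deriv ?k w) z
             + b * gagliardo (frac s) (weak_deriv ?k v) (weak_deriv ?k w) z \<partial>?P)"
      using gagliardo_cong_AE[OF AE[of ?k], of "frac s" "weak_deriv ?k w"]
        borel_measurable_integrable[OF I[OF c w]] borel_measurable_integrable[OF I[OF u w]]
        borel_measurable_integrable[OF I[OF v w]]
      by (intro integral_cong_AE) (auto simp: gagliardo_lincomb)
    then show ?thesis using I u v w by simp
  qed
  have "(\<Sum>j\<le>?k. \<integral>x. weak_deriv j ?c x * weak_deriv j w x \<partial>unit_meas)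
     = a * (\<Sum>j\<le>?k. \<integral>x. weak_deriv j u x * weak_deriv j w x \<partial>unit_meas)
     + b * (\<Sum>j\<le>?k. \<integral>x. weak_deriv j v x * weak_deriv j w x \<partial>unit_meas)"
    by (simp add: 1 sum.distrib sum_distrib_left)
  then show ?thesis using 2 by (simp add: Hs_inner_def algebra_simps)
qed

text \<open>The summand of order 0 is already the L^2 inner product and the others are nonnegative.
  So the embedding into L^2 has norm at most 1.\<close>

lemma L2_inner_le_Hs_inner:
  assumes "u \<in> Hs s"
  shows "L2_inner unit_meas u u \<le> Hs_inner s u u"
proof -
  have "L2_inner unit_meas u u = L2_inner unit_meas (weak_deriv 0 u) (weak_deriv 0 u)"
    using weak_deriv_0[OF Hs_L2[OF assms]] Hs_L2[OF assms] Hs_weak_deriv(2)[OF assms, of 0]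
    unfolding L2_inner_def by (intro integral_cong_AE) (auto simp: L2_def elim: AE_mp)
  also have "\<dots> \<le> (\<Sum>j\<le>nat \<lfloor>s\<rfloor>. \<integral>x. weak_deriv j u x * weak_deriv j u x \<partial>unit_meas)"
    unfolding L2_inner_def by (intro member_le_sum[of 0]) auto
  also have "\<dots> \<le> Hs_inner s u u"
    by (auto simp: Hs_inner_def gagliardo_def intro!: Bochner_Integration.integral_nonneg)
  finally show ?thesis .
qed

interpretation Hs: semi_inner "Hs s" "Hs_inner s" for s
proof
  fix u v w :: "real \<Rightarrow> real" and a b :: real
  have d0: "(deriv ^^ k) (\<lambda>_. 0) = (\<lambda>_. 0 :: real)" for k
    by (induction k) auto
  have w0: "has_weak_deriv k (\<lambda>_. 0) (\<lambda>_. 0)" for k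
    by (simp add: has_weak_deriv_def L2.zero_mem)
  have AE: "AE x in unit_meas. weak_deriv k (\<lambda>_. 0) x = 0" for k
    using w0 by (intro weak_deriv_unique) (auto intro: has_weak_deriv_weak_deriv)
  have "weak_deriv k (\<lambda>_. 0) \<in> L2 unit_meas" for k
    using has_weak_deriv_weak_deriv[OF w0, of k] by (simp add: has_weak_deriv_def)
  then have "integrable (unit_meas \<Otimes>\<^sub>M unit_meas) (gagliardo \<sigma> (weak_deriv k (\<lambda>_. 0)) (weak_deriv k (\<lambda>_. 0)))" for \<sigma> k
    using AE_unit_component[OF AE[of k]]
    by (subst integrable_cong_AE[where g = "\<lambda>_. 0"])
      (auto simp: gagliardo_def L2_def intro!: gagliardo_measurable[unfolded gagliardo_def])
  then show "(\<lambda>_. 0) \<in> Hs s" using w0 by (auto simp: Hs_def L2.zero_mem)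
  show "Hs_inner s u v = Hs_inner s v u"
    by (simp add: Hs_inner_def mult.commute gagliardo_commute)
  assume u: "u \<in> Hs s"
  show "0 \<le> Hs_inner s u u"
    using L2_inner_le_Hs_inner[OF u] L2.ip_nonneg[OF Hs_L2[OF u]] by simp
  assume v: "v \<in> Hs s"
  show "(\<lambda>x. a * u x + b * v x) \<in> Hs s" using u v by (rule Hs_lincomb)
  assume w: "w \<in> Hs s"
  show "Hs_inner s (\<lambda>x. a * u x + b * v x) w = a * Hs_inner s u w + b * Hs_inner s v w"
    using u v w by (rule Hs_inner_lincomb)
qed

lemma Hs_null_AE:
  assumes "Hs.null s u"
  shows "AE x in unit_meas. u x = 0"
proof -
  have u: "u \<in> Hs s" "Hs_inner s u u = 0" using assms by (auto simp: Hs.null_def)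
  then have "L2.null unit_meas u"
    using L2_inner_le_Hs_inner[OF u(1)] L2.ip_nonneg[OF Hs_L2[OF u(1)]] Hs_L2[OF u(1)]
    by (simp add: L2.null_def)
  then show ?thesis by (simp add: L2_null_iff)
qed

section \<open>Singular values of the Sobolev embedding\<close>

text \<open>Gaussian elimination: a pivot p of the last equation is eliminated from the others,
  which costs one unknown and one equation.\<close>

lemma underdetermined_solution:
  fixes a :: "nat \<Rightarrow> 'i \<Rightarrow> real"
  assumes "finite I" "k < card I"
  shows "\<exists>x. (\<exists>i\<in>I. x i \<noteq> 0) \<and> (\<forall>j<k. (\<Sum>i\<in>I. a j i * x i) = 0)"
  using assms
proof (induction k arbitrary: I a)
  case 0
  then have "I \<noteq> {}" by auto
  then show ?case by (intro exI[of _ "\<lambda>_. 1"]) auto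
next
  case (Suc k)
  show ?case
  proof (cases "\<forall>i\<in>I. a k i = 0")
    case True
    obtain x where "\<exists>i\<in>I. x i \<noteq> 0" "\<forall>j<k. (\<Sum>i\<in>I. a j i * x i) = 0"
      using Suc.IH[of I a] Suc.prems by auto
    then show ?thesis using True by (intro exI[of _ x]) (auto simp: less_Suc_eq)
  next
    case False
    then obtain p where p: "p \<in> I" "a k p \<noteq> 0" by blast
    define a' where "a' j i = a j i - a j p * a k i / a k p" for j i
    obtain x where x: "\<exists>i\<in>I - {p}. x i \<noteq> 0" "\<And>j. j < k \<Longrightarrow> (\<Sum>i\<in>I - {p}. a' j i * x i) = 0"
    proof -
      have "k < card (I - {p})" using Suc.prems p by simp
      then show thesis using Suc.IH[of "I - {p}" a'] Suc.prems that by blast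
    qed
    \<comment> \<open>The value at the pivot is the one that solves the last equation.\<close>
    define y where "y = x(p := - (\<Sum>i\<in>I - {p}. a k i * x i) / a k p)"
    have y: "(\<Sum>i\<in>I. a j i * y i) = (\<Sum>i\<in>I - {p}. a' j i * x i)" for j
    proof -
      have "(\<Sum>i\<in>I. a j i * y i) = a j p * y p + (\<Sum>i\<in>I - {p}. a j i * y i)"
        using p Suc.prems by (intro sum.remove) auto
      also have "(\<Sum>i\<in>I - {p}. a j i * y i) = (\<Sum>i\<in>I - {p}. a j i * x i)"
        by (intro sum.cong) (auto simp: y_def)
      also have "a j p * y p = (\<Sum>i\<in>I - {p}. - (a j p * a k i / a k p) * x i)"
        by (simp add: y_def sum_distrib_left sum_divide_distrib sum_negf mult_ac)
      finally show ?thesis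
        by (simp add: a'_def sum.distrib[symmetric] algebra_simps)
    qed
    have "a' k i = 0" for i using p by (simp add: a'_def)
    then have "\<forall>j<Suc k. (\<Sum>i\<in>I. a j i * y i) = 0"
      using x(2) by (auto simp: y less_Suc_eq)
    moreover have "\<exists>i\<in>I. y i \<noteq> 0" using x(1) by (auto simp: y_def)
    ultimately show ?thesis by blast
  qed
qed

context semi_inner
begin

lemma ip_lincombs:
  assumes "\<And>k. k < m \<Longrightarrow> e k \<in> S"
  shows "ip (\<lambda>x. \<Sum>k<m. q i k * e k x) (\<lambda>x. \<Sum>k<m. q j k * e k x) = row_form m (\<lambda>k l. ip (e k) (e l)) q i j"
proof -
  have mem: "e k \<in> S" if "k \<in> {..<m}" for k using assms that by simp
  have "ip (\<lambda>x. \<Sum>k<m. q i k * e k x) (\<lambda>x. \<Sum>k<m. q j k * e k x)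
      = (\<Sum>k<m. q i k * ip (e k) (\<lambda>x. \<Sum>k<m. q j k * e k x))"
    by (intro ip_sum sum_mem mem)
  also have "\<dots> = (\<Sum>k<m. q i k * (\<Sum>l<m. q j l * ip (e k) (e l)))"
    by (intro sum.cong refl arg_cong2[of _ _ _ _ "(*)"] ip_sum_right mem)
  also have "\<dots> = row_form m (\<lambda>k l. ip (e k) (e l)) q i j"
    unfolding row_form_def sum_distrib_left mult.assoc ..
  finally show ?thesis .
qed

text \<open>Rotation keeps the span, so the projection is the same function. Hence the null
  residuals supplied by Gram-Schmidt survive the diagonalisation.\<close>

lemma orthonormal_rotate:
  assumes e: "orthonormal m e" and q: "orthogonal_mat m q"
  defines "e' \<equiv> \<lambda>i x. \<Sum>k<m. q i k * e k x"
  shows "orthonormal m e'" "u \<in> S \<Longrightarrow> proj m e' u = proj m e u"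
proof -
  have mem: "\<And>k. k < m \<Longrightarrow> e k \<in> S" using e by (simp add: orthonormal_def)
  have "ip (e' i) (e' j) = (if i = j then 1 else 0)" if "i < m" "j < m" for i j
  proof -
    have "ip (e' i) (e' j) = row_form m (\<lambda>k l. ip (e k) (e l)) q i j"
      unfolding e'_def by (rule ip_lincombs[OF mem])
    also have "\<dots> = row_form m (\<lambda>k l. of_bool (k = l)) q i j"
      using e unfolding row_form_def by (intro sum.cong) (auto simp: orthonormal_def)
    finally show ?thesis using q that by (simp add: row_form_id orthogonal_mat_def)
  qed
  then show "orthonormal m e'" using mem by (auto simp: orthonormal_def e'_def intro!: sum_mem)
  assume u: "u \<in> S"
  show "proj m e' u = proj m e u"
  proof
    fix x
    have "proj m e' u x = (\<Sum>i<m. (\<Sum>k<m. q i k * ip u (e k)) * (\<Sum>l<m. q i l * e l x))"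
      unfolding proj_def e'_def using mem u by (intro sum.cong refl arg_cong2[of _ _ _ _ "(*)"] ip_sum_right) auto
    also have "\<dots> = (\<Sum>i<m. \<Sum>k<m. \<Sum>l<m. (q i k * q i l) * (ip u (e k) * e l x))"
      unfolding sum_product by (intro sum.cong) (auto simp: mult_ac)
    also have "\<dots> = (\<Sum>k<m. \<Sum>l<m. \<Sum>i<m. (q i k * q i l) * (ip u (e k) * e l x))"
      by (subst sum.swap) (intro sum.cong refl sum.swap)
    also have "\<dots> = (\<Sum>k<m. \<Sum>l<m. of_bool (k = l) * (ip u (e k) * e l x))"
      using q by (auto simp: orthogonal_mat_def simp flip: sum_distrib_right intro!: sum.cong)
    also have "\<dots> = (\<Sum>k<m. ip u (e k) * e k x)"
      by (intro sum.cong) (auto simp: of_bool_def if_distrib if_distribR cong: if_cong)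
    finally show "proj m e' u x = proj m e u x" by (simp add: proj_def)
  qed
qed

end

text \<open>A basis as provided by the singular value decomposition of the embedding of a finite-dimensional
  subspace of \<open>H\<^sup>s\<close> into \<open>L\<^sup>2\<close>, the singular values being ordered decreasingly.\<close>

definition singular_basis :: "real \<Rightarrow> nat \<Rightarrow> (nat \<Rightarrow> real \<Rightarrow> real) \<Rightarrow> bool" where
  "singular_basis s m e \<longleftrightarrow> Hs.orthonormal s m e \<and>
     (\<forall>i<m. \<forall>j<m. i \<noteq> j \<longrightarrow> L2_inner unit_meas (e i) (e j) = 0) \<and>
     (\<forall>i j. i \<le> j \<longrightarrow> j < m \<longrightarrow> L2_inner unit_meas (e j) (e j) \<le> L2_inner unit_meas (e i) (e i))"

text \<open>The rows of q are eigenvectors of the L^2 Gram matrix of an H^s-orthonormal basis; the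
  rotated basis stays orthonormal in H^s and becomes orthogonal in L^2.\<close>

lemma exists_singular_basis:
  fixes n :: nat
  assumes "\<And>i. i < n \<Longrightarrow> v i \<in> Hs s"
  shows "\<exists>m e. singular_basis s m e \<and> (\<forall>i<n. Hs.null s (\<lambda>x. v i x - Hs.proj s m e (v i) x))"
proof -
  obtain m e where e: "Hs.orthonormal s m e"
    and null: "\<And>i. i < n \<Longrightarrow> Hs.null s (\<lambda>x. v i x - Hs.proj s m e (v i) x)"
    using Hs.gram_schmidt[where v = v and n = n, OF assms] by blast
  define A where "A k l = L2_inner unit_meas (e k) (e l)" for k l
  have mem: "e k \<in> L2 unit_meas" if "k < m" for k
    using e that Hs_L2 by (auto simp: Hs.orthonormal_def)
  obtain q where q: "orthogonal_mat m q"
    and diag: "\<And>i j. i < m \<Longrightarrow> j < m \<Longrightarrow> i \<noteq> j \<Longrightarrow> row_form m A q i j = 0"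
    and sorted: "\<And>i j. i \<le> j \<Longrightarrow> j < m \<Longrightarrow> row_form m A q j j \<le> row_form m A q i i"
    using orthogonal_diagonalisation[of m A] L2.ip_sym[OF mem mem] by (auto simp: A_def)
  define e' where "e' = (\<lambda>i x. \<Sum>k<m. q i k * e k x)"
  have "L2_inner unit_meas (e' i) (e' j) = row_form m A q i j" for i j
    unfolding e'_def A_def by (rule L2.ip_lincombs[OF mem])
  then have "singular_basis s m e'"
    using Hs.orthonormal_rotate(1)[OF e q] diag sorted by (simp add: singular_basis_def e'_def)
  moreover have "Hs.proj s m e' (v i) = Hs.proj s m e (v i)" if "i < n" for i
    unfolding e'_def using assms[OF that] by (rule Hs.orthonormal_rotate(2)[OF e q])
  ultimately show ?thesis using null by (intro exI[of _ m] exI[of _ e']) simp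
qed

lemma Hs_norm_lincomb_sq:
  assumes "Hs.orthonormal s m e"
  shows "Hs_inner s (\<lambda>t. \<Sum>k<m. x k * e k t) (\<lambda>t. \<Sum>k<m. x k * e k t) = (\<Sum>k<m. (x k)\<^sup>2)"
proof -
  have mem: "\<And>k. k < m \<Longrightarrow> e k \<in> Hs s" using assms by (simp add: Hs.orthonormal_def)
  have "Hs_inner s (\<lambda>t. \<Sum>k<m. x k * e k t) (\<lambda>t. \<Sum>k<m. x k * e k t)
      = row_form m (\<lambda>k l. Hs_inner s (e k) (e l)) (\<lambda>_. x) 0 0"
    \<comment> \<open>A single quadratic form is read off as the (0, 0) entry for the matrix all of
      whose rows are x.\<close>
    by (rule Hs.ip_lincombs[OF mem, of m _ "\<lambda>_. x" 0 0])
  also have "\<dots> = row_form m (\<lambda>k l. of_bool (k = l)) (\<lambda>_. x) 0 0"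
    using assms unfolding row_form_def by (intro sum.cong) (auto simp: Hs.orthonormal_def)
  finally show ?thesis by (simp add: row_form_id power2_eq_square)
qed

section \<open>Orthogonal projection onto finite-dimensional subspaces of L^2\<close>

lemma L2_subspace_basis:
  assumes "L2_subspace_of_dim M W n"
  obtains b where "\<And>i. i < n \<Longrightarrow> b i \<in> L2 M"
    and "\<And>c. (\<lambda>x. \<Sum>i<n. c i * b i x) \<in> W"
    and "\<And>v. v \<in> W \<Longrightarrow> v \<in> L2 M \<and> (\<exists>c. AE x in M. v x = (\<Sum>i<n. c i * b i x))"
proof -
  obtain b where b: "\<And>i. i < n \<Longrightarrow> b i \<in> L2 M"
    and W: "W = {v \<in> L2 M. \<exists>c :: nat \<Rightarrow> real. AE x in M. v x = (\<Sum>i<n. c i * b i x)}"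
    using assms unfolding L2_subspace_of_dim_def by blast
  have "(\<lambda>x. \<Sum>i<n. c i * b i x) \<in> W" for c
    unfolding W using b by (auto intro!: L2.sum_mem exI[of _ c])
  then show ?thesis by (intro that[of b] b) (auto simp: W)
qed

lemma L2_inner_span_eq_0:
  assumes "\<And>i. i < n \<Longrightarrow> b i \<in> L2 M" "v \<in> L2 M" "AE x in M. v x = (\<Sum>i<n. c i * b i x)"
    and "u \<in> L2 M" "\<And>i. i < n \<Longrightarrow> L2_inner M u (b i) = 0"
  shows "L2_inner M u v = 0"
proof -
  have sum: "(\<lambda>x. \<Sum>i<n. c i * b i x) \<in> L2 M" using assms(1) by (intro L2.sum_mem) auto
  have "L2_inner M u v = L2_inner M u (\<lambda>x. \<Sum>i<n. c i * b i x)"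
    using assms sum unfolding L2_inner_def by (intro integral_cong_AE) (auto simp: L2_def elim: AE_mp)
  also have "\<dots> = (\<Sum>i<n. c i * L2_inner M u (b i))"
    using assms by (intro L2.ip_sum_right) auto
  finally show ?thesis using assms by simp
qed

text \<open>Pythagoras for u - v = r + z v. It serves twice: for r the residual of a projection onto
  W, and for r = u when u itself is orthogonal to W.\<close>

lemma L2_norm_le_best_error:
  assumes W: "W \<noteq> {}" and r: "r \<in> L2 M"
    and orth: "\<And>v. v \<in> W \<Longrightarrow> z v \<in> L2 M \<and> (\<forall>x. u x - v x = r x + z v x) \<and> L2_inner M r (z v) = 0"
  shows "L2_norm M r \<le> best_error M u W"
  unfolding best_error_def
proof (rule cINF_greatest[OF W])
  fix v assume "v \<in> W"
  from orth[OF this] have z: "z v \<in> L2 M" "(\<lambda>x. u x - v x) = (\<lambda>x. r x + z v x)" "L2_inner M r (z v) = 0"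
    by auto
  have "L2_inner M (\<lambda>x. r x + z v x) (\<lambda>x. r x + z v x) = L2_inner M r r + L2_inner M (z v) (z v)"
    using z L2.ip_add_self[OF r z(1)] by simp
  then have "(L2_norm M r)\<^sup>2 \<le> (L2_norm M (\<lambda>x. u x - v x))\<^sup>2"
    unfolding L2_norm_sq z(2) using L2.ip_nonneg[OF z(1)] by simp
  then show "L2_norm M r \<le> L2_norm M (\<lambda>x. u x - v x)"
    by (rule power2_le_imp_le) simp
qed

text \<open>The orthonormal system consists of exact combinations of a basis of W, so projections
  are elements of W and not merely almost everywhere equal to such elements. The residual is
  orthogonal to W and therefore attains the best error.\<close>

lemma L2_projection:
  assumes "L2_subspace_of_dim M W n"
  shows "\<exists>m b. L2.orthonormal M m b \<and>
    (\<forall>u\<in>L2 M. L2.proj M m b u \<in> W \<and> L2_norm M (\<lambda>x. u x - L2.proj M m b u x) \<le> best_error M u W)"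
proof -
  from assms obtain b where b: "\<And>i. i < n \<Longrightarrow> b i \<in> L2 M"
    and W1: "\<And>c. (\<lambda>x. \<Sum>i<n. c i * b i x) \<in> W"
    and W2: "\<And>v. v \<in> W \<Longrightarrow> v \<in> L2 M \<and> (\<exists>c. AE x in M. v x = (\<Sum>i<n. c i * b i x))"
    by (rule L2_subspace_basis) blast
  obtain m e where e: "L2.orthonormal M m e"
    and null: "\<And>i. i < n \<Longrightarrow> L2.null M (\<lambda>x. b i x - L2.proj M m e (b i) x)"
    and span: "\<And>k. k < m \<Longrightarrow> \<exists>c. e k = (\<lambda>x. \<Sum>i<n. c i * b i x)"
    using L2.gram_schmidt[where v = b and n = n, OF b] by blast
  have "\<forall>k. \<exists>c. k < m \<longrightarrow> e k = (\<lambda>x. \<Sum>i<n. c i * b i x)" using span by blast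
  then obtain c where c: "\<And>k. k < m \<Longrightarrow> e k = (\<lambda>x. \<Sum>i<n. c k i * b i x)" by metis
  show ?thesis
  proof (intro exI conjI ballI)
    show "L2.orthonormal M m e" by fact
    fix u assume u: "u \<in> L2 M"
    have "L2.proj M m e u = (\<lambda>x. \<Sum>i<n. (\<Sum>k<m. L2_inner M u (e k) * c k i) * b i x)"
    proof
      fix x
      have "L2.proj M m e u x = (\<Sum>k<m. \<Sum>i<n. L2_inner M u (e k) * c k i * b i x)"
        unfolding L2.proj_def by (intro sum.cong) (auto simp: sum_distrib_left mult.assoc fun_cong[OF c])
      then show "L2.proj M m e u x = (\<Sum>i<n. (\<Sum>k<m. L2_inner M u (e k) * c k i) * b i x)"
        by (subst (asm) sum.swap) (simp add: sum_distrib_right)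
    qed
    then show PW: "L2.proj M m e u \<in> W" using W1 by simp
    let ?r = "\<lambda>x. u x - L2.proj M m e u x"
    have P: "L2.proj M m e w \<in> L2 M" for w by (rule L2.proj_mem[OF e])
    have r: "?r \<in> L2 M" using u by (intro L2.diff_mem P)
    have rb: "L2_inner M ?r (b i) = 0" if i: "i < n" for i
    proof -
      have "L2_inner M ?r (\<lambda>x. b i x - L2.proj M m e (b i) x) = 0"
        using null[OF i] L2.ip_null_right[OF r] by (simp add: L2.null_def)
      moreover have "L2_inner M ?r (L2.proj M m e (b i)) = 0"
        by (rule L2.ip_residual_proj[OF e u b[OF i]])
      ultimately show ?thesis using L2.ip_diff_right[OF b[OF i] P r] by simp
    qed
    show "L2_norm M ?r \<le> best_error M u W"
    proof (rule L2_norm_le_best_error[where z = "\<lambda>v x. L2.proj M m e u x - v x"])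
      show "W \<noteq> {}" using PW by blast
      fix v assume "v \<in> W"
      from W2[OF this] obtain d where v: "v \<in> L2 M" "AE x in M. v x = (\<Sum>i<n. d i * b i x)" by blast
      have "L2_inner M ?r v = 0" by (rule L2_inner_span_eq_0[OF b v r rb])
      then have "L2_inner M ?r (\<lambda>x. L2.proj M m e u x - v x) = 0"
        using L2.ip_diff_right[OF P v(1) r] L2.ip_residual_proj[OF e u u] by simp
      then show "(\<lambda>x. L2.proj M m e u x - v x) \<in> L2 M \<and>
          (\<forall>x. u x - v x = ?r x + (L2.proj M m e u x - v x)) \<and>
          L2_inner M ?r (\<lambda>x. L2.proj M m e u x - v x) = 0"
        using L2.diff_mem[OF P v(1)] by simp
    qed (rule r)
  qed
qed

lemma Hs_norm_sq: "u \<in> Hs s \<Longrightarrow> (Hs_norm s u)\<^sup>2 = Hs_inner s u u"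
  by (simp add: Hs_norm_def Hs.ip_nonneg)

text \<open>Some nonzero combination of \<open>e 0, \<dots>, e k\<close> is \<open>L\<^sup>2\<close>-orthogonal to the \<open>k\<close>-dimensional space \<open>W\<close>.\<close>

lemma singular_value_le:
  assumes e: "singular_basis s m e" and k: "k < m"
    and W: "L2_subspace_of_dim unit_meas W k"
    and err: "\<And>u. u \<in> Hs s \<Longrightarrow> best_error unit_meas u W \<le> \<delta> * Hs_norm s u"
  shows "L2_inner unit_meas (e k) (e k) \<le> \<delta>\<^sup>2"
proof -
  let ?L = "L2_inner unit_meas"
  from W obtain b where b: "\<And>i. i < k \<Longrightarrow> b i \<in> L2 unit_meas"
    and W1: "\<And>c. (\<lambda>x. \<Sum>i<k. c i * b i x) \<in> W"
    and W2: "\<And>v. v \<in> W \<Longrightarrow> v \<in> L2 unit_meas \<and> (\<exists>c. AE x in unit_meas. v x = (\<Sum>i<k. c i * b i x))"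
    by (rule L2_subspace_basis) blast
  have orth: "Hs.orthonormal s (Suc k) e"
    using e k by (auto simp: singular_basis_def Hs.orthonormal_def)
  have eH: "e i \<in> Hs s" if "i < Suc k" for i using orth that by (simp add: Hs.orthonormal_def)
  have eL: "e i \<in> L2 unit_meas" if "i < Suc k" for i using eH[OF that] by (rule Hs_L2)
  obtain x where x: "\<exists>i\<in>{..<Suc k}. x i \<noteq> 0" "\<And>j. j < k \<Longrightarrow> (\<Sum>i<Suc k. ?L (e i) (b j) * x i) = 0"
    using underdetermined_solution[of "{..<Suc k}" k "\<lambda>j i. ?L (e i) (b j)"] by auto
  define u where "u = (\<lambda>t. \<Sum>i<Suc k. x i * e i t)"
  define X where "X = (\<Sum>i<Suc k. (x i)\<^sup>2)"
  obtain i where "i < Suc k" "x i \<noteq> 0" using x(1) by blast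
  then have X: "0 < X" unfolding X_def by (intro sum_pos2[of _ i]) auto
  have uH: "u \<in> Hs s" unfolding u_def using eH by (intro Hs.sum_mem) auto
  have uL: "u \<in> L2 unit_meas" using uH by (rule Hs_L2)
  have ub: "?L u (b j) = 0" if "j < k" for j
    unfolding u_def using eL b[OF that] x(2)[OF that] by (subst L2.ip_sum) (auto simp: mult.commute)
  have "L2_norm unit_meas u \<le> best_error unit_meas u W"
  proof (rule L2_norm_le_best_error[where z = "\<lambda>v x. - 1 * v x"])
    show "W \<noteq> {}" using W1 by blast
    fix v assume "v \<in> W"
    from W2[OF this] obtain d where v: "v \<in> L2 unit_meas" "AE x in unit_meas. v x = (\<Sum>i<k. d i * b i x)" by blast
    have "?L u v = 0" by (rule L2_inner_span_eq_0[OF b v uL ub])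
    then show "(\<lambda>x. - 1 * v x) \<in> L2 unit_meas \<and> (\<forall>x. u x - v x = u x + - 1 * v x) \<and> ?L u (\<lambda>x. - 1 * v x) = 0"
      using L2.scale_mem[OF v(1), of "-1"] L2.ip_sym[OF uL L2.scale_mem[OF v(1), of "-1"]]
        L2.ip_scale[OF v(1) uL, of "-1"] L2.ip_sym[OF uL v(1)] by simp
  qed (rule uL)
  also have "\<dots> \<le> \<delta> * Hs_norm s u" by (rule err[OF uH])
  finally have "(L2_norm unit_meas u)\<^sup>2 \<le> (\<delta> * Hs_norm s u)\<^sup>2" by (intro power_mono) auto
  also have "\<dots> = \<delta>\<^sup>2 * X"
    using Hs_norm_sq[OF uH] Hs_norm_lincomb_sq[OF orth, of x] by (simp add: power_mult_distrib X_def u_def)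
  finally have le: "?L u u \<le> \<delta>\<^sup>2 * X" by (simp add: L2_norm_sq)
  have "?L u u = (\<Sum>i<Suc k. x i * (\<Sum>j<Suc k. x j * ?L (e i) (e j)))"
  proof -
    have eL': "e i \<in> L2 unit_meas" if "i \<in> {..<Suc k}" for i using eL that by simp
    have "?L u u = (\<Sum>i<Suc k. x i * ?L (e i) u)"
      using L2.ip_sum[where c = x and I = "{..<Suc k}" and e = e, OF eL' uL] unfolding u_def[symmetric] .
    also have "\<dots> = (\<Sum>i<Suc k. x i * (\<Sum>j<Suc k. x j * ?L (e i) (e j)))"
      unfolding u_def by (intro sum.cong refl arg_cong2[of _ _ _ _ "(*)"] L2.ip_sum_right eL')
    finally show ?thesis .
  qed
  also have "\<dots> = (\<Sum>i<Suc k. x i * (x i * ?L (e i) (e i)))"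
  proof (intro sum.cong refl arg_cong2[of _ _ _ _ "(*)"])
    fix i assume i: "i \<in> {..<Suc k}"
    have "(\<Sum>j<Suc k. x j * ?L (e i) (e j)) = (\<Sum>j<Suc k. if j = i then x j * ?L (e i) (e j) else 0)"
      using e i k by (intro sum.cong) (auto simp: singular_basis_def)
    then show "(\<Sum>j<Suc k. x j * ?L (e i) (e j)) = x i * ?L (e i) (e i)" using i by simp
  qed
  also have "\<dots> = (\<Sum>i<Suc k. (x i)\<^sup>2 * ?L (e i) (e i))"
    by (simp add: power2_eq_square mult.assoc)
  \<comment> \<open>The min-max argument: since the values decrease, the L^2 form on the span of e
    0, ..., e k is at least its k-th value times the H^s form.\<close>
  also have "\<dots> \<ge> (\<Sum>i<Suc k. (x i)\<^sup>2 * ?L (e k) (e k))"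
    using e k by (intro sum_mono mult_left_mono) (auto simp: singular_basis_def)
  finally have "X * ?L (e k) (e k) \<le> \<delta>\<^sup>2 * X"
    using le unfolding X_def sum_distrib_right by linarith
  then show ?thesis using X by (simp add: mult.commute)
qed

section \<open>Tensor products of frames\<close>

interpretation unit: product_prob_space "\<lambda>_ :: nat. unit_meas" UNIV
  by (simp add: product_prob_space_def product_prob_space_axioms_def product_sigma_finite_def
      prob_space_unit_meas prob_space_imp_sigma_finite)

lemma prob_space_cube: "prob_space (cube_meas S)"
  unfolding cube_meas_def by (intro prob_space_PiM prob_space_unit_meas)

lemma measurable_cube_component:
  assumes "\<nu> \<in> S" "u \<in> borel_measurable unit_meas"
  shows "(\<lambda>x. u (x \<nu>)) \<in> borel_measurable (cube_meas S)"
  unfolding cube_meas_def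
  using measurable_compose[OF measurable_component_singleton[OF assms(1), of "\<lambda>_. unit_meas"] assms(2)] by simp

lemma prod_L2_cube:
  assumes "finite S" "\<And>\<nu>. \<nu> \<in> S \<Longrightarrow> u \<nu> \<in> L2 unit_meas"
  shows "(\<lambda>x. \<Prod>\<nu>\<in>S. u \<nu> (x \<nu>)) \<in> L2 (cube_meas S)"
proof -
  have "(\<lambda>x. \<Prod>\<nu>\<in>S. u \<nu> (x \<nu>)) \<in> borel_measurable (cube_meas S)"
    using assms by (intro borel_measurable_prod measurable_cube_component) (auto simp: L2_def)
  moreover have "integrable (cube_meas S) (\<lambda>x. \<Prod>\<nu>\<in>S. (u \<nu> (x \<nu>))\<^sup>2)"
    unfolding cube_meas_def using assms by (intro unit.product_integrable_prod) (auto simp: L2_def)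
  ultimately show ?thesis by (simp add: L2_def prod_power_distrib)
qed

lemma L2_inner_prod_cube:
  assumes "finite S" "\<And>\<nu>. \<nu> \<in> S \<Longrightarrow> u \<nu> \<in> L2 unit_meas" "\<And>\<nu>. \<nu> \<in> S \<Longrightarrow> w \<nu> \<in> L2 unit_meas"
  shows "L2_inner (cube_meas S) (\<lambda>x. \<Prod>\<nu>\<in>S. u \<nu> (x \<nu>)) (\<lambda>x. \<Prod>\<nu>\<in>S. w \<nu> (x \<nu>))
    = (\<Prod>\<nu>\<in>S. L2_inner unit_meas (u \<nu>) (w \<nu>))"
  unfolding L2_inner_def cube_meas_def prod.distrib[symmetric]
  using assms by (intro unit.product_integral_prod) (auto intro: L2_integrable_mult)

section \<open>Multi-indices and expansions in tensor products\<close>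

definition indices :: "nat set \<Rightarrow> nat \<Rightarrow> (nat \<Rightarrow> nat) set" where
  "indices S m = PiE S (\<lambda>_. {..<m})"

lemma finite_indices [simp]: "finite S \<Longrightarrow> finite (indices S m)"
  unfolding indices_def by (intro finite_PiE) auto

lemma indices_less: "k \<in> indices S m \<Longrightarrow> \<nu> \<in> S \<Longrightarrow> k \<nu> < m"
  by (auto simp: indices_def)

definition tensor_sum ::
  "nat set \<Rightarrow> nat \<Rightarrow> ((nat \<Rightarrow> nat) \<Rightarrow> real) \<Rightarrow> (nat \<Rightarrow> nat \<Rightarrow> real \<Rightarrow> real) \<Rightarrow> (nat \<Rightarrow> real) \<Rightarrow> real" where
  "tensor_sum S m c h x = (\<Sum>k\<in>indices S m. c k * (\<Prod>\<nu>\<in>S. h \<nu> (k \<nu>) (x \<nu>)))"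

lemma tensor_sum_L2:
  assumes "finite S" "\<And>\<nu> k. \<nu> \<in> S \<Longrightarrow> k < m \<Longrightarrow> h \<nu> k \<in> L2 unit_meas"
  shows "tensor_sum S m c h \<in> L2 (cube_meas S)"
  unfolding tensor_sum_def[abs_def]
  using assms by (intro L2.sum_mem prod_L2_cube) (auto simp: indices_less)

lemma tensor_sum_inner:
  assumes "finite S" "\<And>\<nu> k. \<nu> \<in> S \<Longrightarrow> k < m \<Longrightarrow> h \<nu> k \<in> L2 unit_meas"
    and "\<And>\<nu> k. \<nu> \<in> S \<Longrightarrow> k < m \<Longrightarrow> h' \<nu> k \<in> L2 unit_meas"
  shows "L2_inner (cube_meas S) (tensor_sum S m c h) (tensor_sum S m c' h')
    = (\<Sum>k\<in>indices S m. \<Sum>l\<in>indices S m. c k * c' l * (\<Prod>\<nu>\<in>S. L2_inner unit_meas (h \<nu> (k \<nu>)) (h' \<nu> (l \<nu>))))"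
proof -
  let ?p = "\<lambda>k x. \<Prod>\<nu>\<in>S. h \<nu> (k \<nu>) (x \<nu>)" and ?p' = "\<lambda>k x. \<Prod>\<nu>\<in>S. h' \<nu> (k \<nu>) (x \<nu>)"
  have p: "?p k \<in> L2 (cube_meas S)" "?p' k \<in> L2 (cube_meas S)" if "k \<in> indices S m" for k
    using assms that by (auto intro!: prod_L2_cube simp: indices_less)
  have "L2_inner (cube_meas S) (tensor_sum S m c h) (tensor_sum S m c' h')
      = (\<Sum>k\<in>indices S m. c k * L2_inner (cube_meas S) (?p k) (tensor_sum S m c' h'))"
    unfolding tensor_sum_def[abs_def] by (intro L2.ip_sum L2.sum_mem p)
  also have "\<dots> = (\<Sum>k\<in>indices S m. c k * (\<Sum>l\<in>indices S m. c' l * L2_inner (cube_meas S) (?p k) (?p' l)))"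
    unfolding tensor_sum_def[abs_def] by (intro sum.cong refl arg_cong2[of _ _ _ _ "(*)"] L2.ip_sum_right p)
  also have "\<dots> = (\<Sum>k\<in>indices S m. \<Sum>l\<in>indices S m. c k * c' l * (\<Prod>\<nu>\<in>S. L2_inner unit_meas (h \<nu> (k \<nu>)) (h' \<nu> (l \<nu>))))"
    unfolding sum_distrib_left mult.assoc
    using assms by (intro sum.cong refl arg_cong2[of _ _ _ _ "(*)"] L2_inner_prod_cube) (auto simp: indices_less)
  finally show ?thesis .
qed

text \<open>Only the upper frame bound, also called Bessel bound: \<kappa> dominates the largest
  eigenvalue of the Gram matrix, that is, the squared norm of the map sending x to the sum of the x
  k h k.\<close>

definition frame :: "nat \<Rightarrow> (nat \<Rightarrow> real \<Rightarrow> real) \<Rightarrow> real \<Rightarrow> bool" where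
  "frame m h \<kappa> \<longleftrightarrow> 0 \<le> \<kappa> \<and> (\<forall>k<m. h k \<in> L2 unit_meas) \<and>
     (\<forall>x. L2_inner unit_meas (\<lambda>t. \<Sum>k<m. x k * h k t) (\<lambda>t. \<Sum>k<m. x k * h k t) \<le> \<kappa> * (\<Sum>k<m. (x k)\<^sup>2))"

lemma sum_indices_insert:
  assumes "finite S" "j \<notin> S"
  shows "(\<Sum>k\<in>indices (insert j S) m. f k) = (\<Sum>a<m. \<Sum>k\<in>indices S m. f (k(j := a)))"
proof -
  have "(\<Sum>k\<in>indices (insert j S) m. f k) = (\<Sum>(a, k)\<in>{..<m} \<times> indices S m. f (k(j := a)))"
    unfolding indices_def PiE_insert_eq
    by (subst sum.reindex[OF inj_combinator[OF assms(2)]]) (auto intro: sum.cong)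
  then show ?thesis by (simp add: sum.cartesian_product)
qed

text \<open>The induction integrates the bound for the factor \<open>j\<close> over the remaining variables.\<close>

lemma tensor_sum_bound:
  assumes "finite S" "\<And>\<nu>. \<nu> \<in> S \<Longrightarrow> frame m (h \<nu>) (\<kappa> \<nu>)"
  shows "L2_inner (cube_meas S) (tensor_sum S m c h) (tensor_sum S m c h)
    \<le> (\<Prod>\<nu>\<in>S. \<kappa> \<nu>) * (\<Sum>k\<in>indices S m. (c k)\<^sup>2)"
  using assms
proof (induction S arbitrary: c rule: finite_induct)
  case empty
  interpret prob_space "cube_meas {}" by (rule prob_space_cube)
  show ?case
    by (simp add: L2_inner_def tensor_sum_def indices_def power2_eq_square prob_space)
next
  case (insert j S)
  let ?L = "L2_inner unit_meas" and ?C = "cube_meas S"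
  have hL: "h \<nu> k \<in> L2 unit_meas" if "\<nu> \<in> insert j S" "k < m" for \<nu> k
    using insert.prems that by (auto simp: frame_def)
  have fr: "frame m (h j) (\<kappa> j)" using insert.prems by simp
  \<comment> \<open>With the index of factor j split off, the sum is the sum over a of h j a (in the
    variable j) times G a (in the other variables).\<close>
  define G where "G a = tensor_sum S m (\<lambda>k. c (k(j := a))) h" for a
  have G: "G a \<in> L2 ?C" for a
    unfolding G_def using insert.hyps hL by (intro tensor_sum_L2) auto
  have jS: "(\<Prod>\<nu>\<in>insert j S. ?L (h \<nu> ((k(j := a)) \<nu>)) (h \<nu> ((l(j := b)) \<nu>)))
      = ?L (h j a) (h j b) * (\<Prod>\<nu>\<in>S. ?L (h \<nu> (k \<nu>)) (h \<nu> (l \<nu>)))" for k l a b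
    using insert.hyps by (simp, intro disjI2 prod.cong) auto
  have "L2_inner (cube_meas (insert j S)) (tensor_sum (insert j S) m c h) (tensor_sum (insert j S) m c h)
      = (\<Sum>a<m. \<Sum>k\<in>indices S m. \<Sum>b<m. \<Sum>l\<in>indices S m. c (k(j := a)) * c (l(j := b)) *
          (?L (h j a) (h j b) * (\<Prod>\<nu>\<in>S. ?L (h \<nu> (k \<nu>)) (h \<nu> (l \<nu>)))))"
    using hL insert.hyps(1)
    by (subst tensor_sum_inner) (simp_all only: finite_insert sum_indices_insert[OF insert.hyps] jS)
  also have "\<dots> = (\<Sum>a<m. \<Sum>b<m. ?L (h j a) (h j b) *
      (\<Sum>k\<in>indices S m. \<Sum>l\<in>indices S m. c (k(j := a)) * c (l(j := b)) * (\<Prod>\<nu>\<in>S. ?L (h \<nu> (k \<nu>)) (h \<nu> (l \<nu>)))))"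
    by (intro sum.cong refl, subst sum.swap, intro sum.cong refl) (simp add: sum_distrib_left mult_ac)
  also have "\<dots> = (\<Sum>a<m. \<Sum>b<m. ?L (h j a) (h j b) * L2_inner ?C (G a) (G b))"
    unfolding G_def using insert.hyps hL by (intro sum.cong refl arg_cong2[of _ _ _ _ "(*)"] tensor_sum_inner[symmetric]) auto
  also have "\<dots> = (\<integral>x. (\<Sum>a<m. \<Sum>b<m. ?L (h j a) (h j b) * (G a x * G b x)) \<partial>?C)"
    unfolding L2_inner_def[of ?C] using L2_integrable_mult[OF G G]
    by (subst Bochner_Integration.integral_sum;
        (intro Bochner_Integration.integrable_sum integrable_mult_right)?;
        simp add: Bochner_Integration.integral_sum)
  also have "\<dots> \<le> (\<integral>x. \<kappa> j * (\<Sum>a<m. G a x * G a x) \<partial>?C)"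
  proof (rule integral_mono)
    show "integrable ?C (\<lambda>x. \<Sum>a<m. \<Sum>b<m. ?L (h j a) (h j b) * (G a x * G b x))"
      using L2_integrable_mult[OF G G] by (intro Bochner_Integration.integrable_sum integrable_mult_right)
    show "integrable ?C (\<lambda>x. \<kappa> j * (\<Sum>a<m. G a x * G a x))"
      using L2_integrable_mult[OF G G] by (intro Bochner_Integration.integrable_sum integrable_mult_right)
    fix x
    have "(\<Sum>a<m. \<Sum>b<m. ?L (h j a) (h j b) * (G a x * G b x))
        = row_form m (\<lambda>a b. ?L (h j a) (h j b)) (\<lambda>_ a. G a x) 0 0"
      by (simp add: row_form_def mult.commute)
    \<comment> \<open>For fixed x the numbers G a x are just a coefficient vector, to which the
      bound for the factor j applies.\<close>
    also have "\<dots> = ?L (\<lambda>t. \<Sum>k<m. G k x * h j k t) (\<lambda>t. \<Sum>k<m. G k x * h j k t)"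
      using hL by (intro L2.ip_lincombs[symmetric]) auto
    also have "\<dots> \<le> \<kappa> j * (\<Sum>a<m. G a x * G a x)"
      using fr[unfolded frame_def power2_eq_square, THEN conjunct2, THEN conjunct2, THEN spec, of "\<lambda>a. G a x"] .
    finally show "(\<Sum>a<m. \<Sum>b<m. ?L (h j a) (h j b) * (G a x * G b x)) \<le> \<kappa> j * (\<Sum>a<m. G a x * G a x)" .
  qed
  also have "\<dots> = \<kappa> j * (\<Sum>a<m. L2_inner ?C (G a) (G a))"
    unfolding L2_inner_def using L2_integrable_mult[OF G G] by (simp add: Bochner_Integration.integral_sum)
  also have "\<dots> \<le> \<kappa> j * (\<Sum>a<m. (\<Prod>\<nu>\<in>S. \<kappa> \<nu>) * (\<Sum>k\<in>indices S m. (c (k(j := a)))\<^sup>2))"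
    unfolding G_def using insert fr by (intro mult_left_mono sum_mono insert.IH) (auto simp: frame_def)
  also have "\<dots> = (\<Prod>\<nu>\<in>insert j S. \<kappa> \<nu>) * (\<Sum>k\<in>indices (insert j S) m. (c k)\<^sup>2)"
    using insert.hyps by (simp add: sum_indices_insert sum_distrib_left mult.assoc)
  finally show ?case .
qed

text \<open>Passes from the product of the a \<nu> to that of the b \<nu> by exchanging one factor
  at a time.\<close>

lemma prod_diff_telescope:
  fixes a b :: "nat \<Rightarrow> real"
  shows "(\<Prod>\<nu>=1..d. a \<nu>) - (\<Prod>\<nu>=1..d. b \<nu>)
    = (\<Sum>j=1..d. \<Prod>\<nu>=1..d. if \<nu> < j then b \<nu> else if \<nu> = j then a \<nu> - b \<nu> else a \<nu>)"
proof (induction d)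
  case (Suc d)
  let ?f = "\<lambda>j \<nu>. if \<nu> < j then b \<nu> else if \<nu> = j then a \<nu> - b \<nu> else a \<nu>"
  have "(\<Sum>j=1..Suc d. \<Prod>\<nu>=1..Suc d. ?f j \<nu>)
      = (\<Sum>j=1..d. (\<Prod>\<nu>=1..d. ?f j \<nu>) * a (Suc d)) + (\<Prod>\<nu>=1..d. ?f (Suc d) \<nu>) * (a (Suc d) - b (Suc d))"
    by (simp add: sum.cl_ivl_Suc prod.cl_ivl_Suc)
  also have "(\<Prod>\<nu>=1..d. ?f (Suc d) \<nu>) = (\<Prod>\<nu>=1..d. b \<nu>)" by (intro prod.cong) auto
  also have "(\<Sum>j=1..d. (\<Prod>\<nu>=1..d. ?f j \<nu>) * a (Suc d))
      = ((\<Prod>\<nu>=1..d. a \<nu>) - (\<Prod>\<nu>=1..d. b \<nu>)) * a (Suc d)"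
    unfolding sum_distrib_right[symmetric] Suc.IH ..
  finally show ?case by (simp add: prod.cl_ivl_Suc algebra_simps)
qed auto

lemma L2_norm_sum_sq_le:
  assumes "finite J" "\<And>j. j \<in> J \<Longrightarrow> f j \<in> L2 M"
  shows "(L2_norm M (\<lambda>x. \<Sum>j\<in>J. f j x))\<^sup>2 \<le> real (card J) * (\<Sum>j\<in>J. (L2_norm M (f j))\<^sup>2)"
proof -
  have sq: "integrable M (\<lambda>x. (u x)\<^sup>2)" if "u \<in> L2 M" for u using that by (simp add: L2_def)
  have mem: "(\<lambda>x. \<Sum>j\<in>J. f j x) \<in> L2 M"
    using L2.sum_mem[of J f M "\<lambda>_. 1"] assms by simp
  have "(L2_norm M (\<lambda>x. \<Sum>j\<in>J. f j x))\<^sup>2 = (\<integral>x. (\<Sum>j\<in>J. f j x)\<^sup>2 \<partial>M)"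
    by (simp add: L2_norm_def)
  also have "\<dots> \<le> (\<integral>x. real (card J) * (\<Sum>j\<in>J. (f j x)\<^sup>2) \<partial>M)"
    using assms mem sum_squared_le_sum_of_squares[of "\<lambda>j. f j _" J]
    by (intro integral_mono sq integrable_mult_right Bochner_Integration.integrable_sum)
      (auto simp: mult.commute)
  also have "\<dots> = real (card J) * (\<Sum>j\<in>J. (L2_norm M (f j))\<^sup>2)"
    using assms sq by (simp add: Bochner_Integration.integral_sum L2_norm_def)
  finally show ?thesis .
qed

text \<open>Exchanging one direction at a time gives d terms, each with bound \<kappa> in one
  direction and 1 in the others. One factor d comes from Cauchy-Schwarz for a sum of d terms, the
  other from adding up their bounds.\<close>

lemma tensor_sum_replace_bound:
  assumes e: "\<And>\<nu>. \<nu> \<in> {1..d} \<Longrightarrow> frame m (e \<nu>) 1" and p: "\<And>\<nu>. \<nu> \<in> {1..d} \<Longrightarrow> frame m (p \<nu>) 1"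
    and diff: "\<And>\<nu>. \<nu> \<in> {1..d} \<Longrightarrow> frame m (\<lambda>k t. e \<nu> k t - p \<nu> k t) \<kappa>"
  shows "(L2_norm (cube_meas {1..d}) (\<lambda>x. tensor_sum {1..d} m c e x - tensor_sum {1..d} m c p x))\<^sup>2
    \<le> (real d)\<^sup>2 * \<kappa> * (\<Sum>k\<in>indices {1..d} m. (c k)\<^sup>2)"
proof -
  define h where "h j \<nu> k t = (if \<nu> < j then p \<nu> k t else if \<nu> = j then e \<nu> k t - p \<nu> k t else e \<nu> k t)"
    for j \<nu> :: nat and k t
  have h: "h j \<nu> = (if \<nu> < j then p \<nu> else if \<nu> = j then (\<lambda>k t. e \<nu> k t - p \<nu> k t) else e \<nu>)" for j \<nu>
    by (auto simp: h_def fun_eq_iff)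
  have fr: "frame m (h j \<nu>) (if \<nu> = j then \<kappa> else 1)" if "\<nu> \<in> {1..d}" for j \<nu>
    using e[OF that] p[OF that] diff[OF that] by (auto simp: h)
  have "(\<lambda>x. tensor_sum {1..d} m c e x - tensor_sum {1..d} m c p x)
      = (\<lambda>x. \<Sum>j=1..d. tensor_sum {1..d} m c (h j) x)"
  proof
    fix x
    have "tensor_sum {1..d} m c e x - tensor_sum {1..d} m c p x
        = (\<Sum>k\<in>indices {1..d} m. c k * ((\<Prod>\<nu>=1..d. e \<nu> (k \<nu>) (x \<nu>)) - (\<Prod>\<nu>=1..d. p \<nu> (k \<nu>) (x \<nu>))))"
      by (simp add: tensor_sum_def sum_subtractf right_diff_distrib)
    also have "\<dots> = (\<Sum>k\<in>indices {1..d} m. \<Sum>j=1..d. c k * (\<Prod>\<nu>=1..d. h j \<nu> (k \<nu>) (x \<nu>)))"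
      unfolding prod_diff_telescope h_def by (simp add: sum_distrib_left)
    also have "\<dots> = (\<Sum>j=1..d. tensor_sum {1..d} m c (h j) x)"
      by (subst sum.swap) (simp add: tensor_sum_def)
    finally show "tensor_sum {1..d} m c e x - tensor_sum {1..d} m c p x = (\<Sum>j=1..d. tensor_sum {1..d} m c (h j) x)" .
  qed
  moreover have "tensor_sum {1..d} m c (h j) \<in> L2 (cube_meas {1..d})" for j
    using fr by (intro tensor_sum_L2) (auto simp: frame_def)
  ultimately have "(L2_norm (cube_meas {1..d}) (\<lambda>x. tensor_sum {1..d} m c e x - tensor_sum {1..d} m c p x))\<^sup>2
      \<le> real (card {1..d}) * (\<Sum>j=1..d. (L2_norm (cube_meas {1..d}) (tensor_sum {1..d} m c (h j)))\<^sup>2)"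
    using L2_norm_sum_sq_le[of "{1..d}" "\<lambda>j. tensor_sum {1..d} m c (h j)" "cube_meas {1..d}"] by simp
  also have "\<dots> \<le> real (card {1..d}) * (\<Sum>j=1..d. \<kappa> * (\<Sum>k\<in>indices {1..d} m. (c k)\<^sup>2))"
  proof (intro mult_left_mono sum_mono)
    fix j assume j: "j \<in> {1..d}"
    have "(L2_norm (cube_meas {1..d}) (tensor_sum {1..d} m c (h j)))\<^sup>2
        \<le> (\<Prod>\<nu>\<in>{1..d}. if \<nu> = j then \<kappa> else 1) * (\<Sum>k\<in>indices {1..d} m. (c k)\<^sup>2)"
      unfolding L2_norm_sq using fr by (intro tensor_sum_bound) auto
    also have "(\<Prod>\<nu>\<in>{1..d}. if \<nu> = j then \<kappa> else 1) = \<kappa>" using j by (simp add: prod.delta)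
    finally show "(L2_norm (cube_meas {1..d}) (tensor_sum {1..d} m c (h j)))\<^sup>2 \<le> \<kappa> * (\<Sum>k\<in>indices {1..d} m. (c k)\<^sup>2)" .
  qed simp
  finally show ?thesis by (simp add: power2_eq_square mult.assoc)
qed

section \<open>Hyperbolic crosses and ranks\<close>

lemma sum_inverse_le_ln:
  assumes "1 \<le> y"
  shows "(\<Sum>t\<in>{t. t < m \<and> real (t + 1) \<le> y}. 1 / real (t + 1)) \<le> 1 + ln y"
proof -
  have harm: "(\<Sum>t<n. 1 / real (t + 1)) \<le> 1 + ln (real n)" if "0 < n" for n
    using that
  proof (induction n rule: nat_induct_non_zero)
    case (Suc n)
    \<comment> \<open>From ln z \<le> z - 1 at z = n / (n + 1).\<close>
    have "1 / (real n + 1) \<le> ln ((real n + 1) / real n)"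
    proof -
      have "ln (real n / (real n + 1)) \<le> real n / (real n + 1) - 1"
        using Suc by (intro ln_le_minus_one) auto
      also have "\<dots> = - (1 / (real n + 1))" by (simp add: field_simps)
      finally show ?thesis using Suc by (simp add: ln_div)
    qed
    then show ?case using Suc by (simp add: ln_div add.commute)
  qed auto
  define n where "n = nat \<lfloor>y\<rfloor>"
  have n: "0 < n" "real n \<le> y" using assms by (auto simp: n_def)
  have "{t. t < m \<and> real (t + 1) \<le> y} \<subseteq> {..<n}"
    using assms by (auto simp: n_def nat_less_iff le_nat_floor less_eq_Suc_le)
  then have "(\<Sum>t\<in>{t. t < m \<and> real (t + 1) \<le> y}. 1 / real (t + 1)) \<le> (\<Sum>t<n. 1 / real (t + 1))"
    by (intro sum_mono2) auto
  also have "\<dots> \<le> 1 + ln (real n)" by (rule harm) fact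
  also have "\<dots> \<le> 1 + ln y" using n by simp
  finally show ?thesis .
qed

text \<open>Indices start at 0, which is why the factors are k \<nu> + 1.\<close>

definition hyperbolic :: "nat set \<Rightarrow> nat \<Rightarrow> real \<Rightarrow> (nat \<Rightarrow> nat) set" where
  "hyperbolic S m y = {k \<in> indices S m. (\<Prod>\<nu>\<in>S. real (k \<nu> + 1)) \<le> y}"

lemma finite_hyperbolic [simp]: "finite S \<Longrightarrow> finite (hyperbolic S m y)"
  by (simp add: hyperbolic_def)

lemma one_le_prod_Suc: "1 \<le> (\<Prod>\<nu>\<in>S. real (k \<nu> + 1))"
  by (intro prod_ge_1) auto

text \<open>Fixing the value t in direction j leaves a cross in one direction less with y / (t + 1)
  in place of y. Summing over t produces a harmonic sum, hence one logarithm per direction beyond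
  the first. The bound does not involve m.\<close>

lemma card_hyperbolic_le:
  assumes "finite S" "S \<noteq> {}" "1 \<le> y"
  shows "real (card (hyperbolic S m y)) \<le> y * (1 + ln y) ^ (card S - 1)"
  using assms
proof (induction S arbitrary: y rule: finite_ne_induct)
  case (singleton j)
  let ?T = "{t. t < m \<and> real (t + 1) \<le> y}"
  have "hyperbolic {j} m y \<subseteq> (\<lambda>t. (\<lambda>_. undefined)(j := t)) ` ?T"
    by (auto simp: hyperbolic_def indices_def PiE_insert_eq)
  then have "card (hyperbolic {j} m y) \<le> card ?T" by (intro surj_card_le) auto
  also have "?T \<subseteq> {..<nat \<lfloor>y\<rfloor>}" using singleton by (auto simp: le_nat_floor less_eq_Suc_le)
  then have "card ?T \<le> nat \<lfloor>y\<rfloor>" using card_mono[of "{..<nat \<lfloor>y\<rfloor>}" ?T] by simp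
  finally show ?case using singleton by (simp add: le_nat_iff) linarith
next
  case (insert j S)
  let ?T = "{t. t < m \<and> real (t + 1) \<le> y}"
  have prod: "(\<Prod>\<nu>\<in>insert j S. real ((k(j := t)) \<nu> + 1)) = real (t + 1) * (\<Prod>\<nu>\<in>S. real (k \<nu> + 1))" for k t
    using insert.hyps by (simp, intro disjI2 prod.cong) auto
  have "hyperbolic (insert j S) m y
      \<subseteq> (\<lambda>(t, k). k(j := t)) ` (SIGMA t:?T. hyperbolic S m (y / real (t + 1)))"
  proof
    fix k assume k: "k \<in> hyperbolic (insert j S) m y"
    then obtain t k' where k': "t < m" "k' \<in> indices S m" "k = k'(j := t)"
      by (auto simp: hyperbolic_def indices_def PiE_insert_eq)
    have le: "real (t + 1) * (\<Prod>\<nu>\<in>S. real (k' \<nu> + 1)) \<le> y"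
      using k prod[of k' t] by (simp add: k'(3) hyperbolic_def)
    have "real (t + 1) * 1 \<le> real (t + 1) * (\<Prod>\<nu>\<in>S. real (k' \<nu> + 1))"
      by (intro mult_left_mono one_le_prod_Suc) auto
    then have "real (t + 1) \<le> y" using order_trans[OF _ le] by simp
    then have "t \<in> ?T" using k' by simp
    moreover have "k' \<in> hyperbolic S m (y / real (t + 1))"
      using le k' by (simp add: hyperbolic_def pos_le_divide_eq mult.commute del: of_nat_add)
    ultimately show "k \<in> (\<lambda>(t, k). k(j := t)) ` (SIGMA t:?T. hyperbolic S m (y / real (t + 1)))"
      using k'(3) by (intro image_eqI[of _ _ "(t, k')"]) auto
  qed
  then have "card (hyperbolic (insert j S) m y) \<le> card (SIGMA t:?T. hyperbolic S m (y / real (t + 1)))"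
    using insert.hyps by (intro surj_card_le) auto
  then have "real (card (hyperbolic (insert j S) m y)) \<le> (\<Sum>t\<in>?T. real (card (hyperbolic S m (y / real (t + 1)))))"
    using insert.hyps by (simp add: card_SigmaI flip: of_nat_sum)
  also have "\<dots> \<le> (\<Sum>t\<in>?T. y * (1 + ln y) ^ (card S - 1) * (1 / real (t + 1)))"
  proof (intro sum_mono)
    fix t assume t: "t \<in> ?T"
    then have "real (card (hyperbolic S m (y / real (t + 1))))
        \<le> y / real (t + 1) * (1 + ln (y / real (t + 1))) ^ (card S - 1)"
      by (intro insert.IH) (auto simp: field_simps)
    also have "\<dots> \<le> y / real (t + 1) * (1 + ln y) ^ (card S - 1)"
    proof -
      have "1 \<le> y / real (t + 1)" "y / real (t + 1) \<le> y"
        using t insert.prems by (auto simp: field_simps)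
      then have "0 \<le> ln (y / real (t + 1))" "ln (y / real (t + 1)) \<le> ln y"
        using insert.prems by (auto intro: ln_ge_zero ln_mono)
      then show ?thesis using insert.prems by (intro mult_left_mono power_mono) auto
    qed
    finally show "real (card (hyperbolic S m (y / real (t + 1)))) \<le> y * (1 + ln y) ^ (card S - 1) * (1 / real (t + 1))"
      by simp
  qed
  also have "\<dots> = y * (1 + ln y) ^ (card S - 1) * (\<Sum>t\<in>?T. 1 / real (t + 1))"
    by (simp add: sum_distrib_left)
  also have "\<dots> \<le> y * (1 + ln y) ^ (card S - 1) * (1 + ln y)"
    using insert.prems by (intro mult_left_mono sum_inverse_le_ln) auto
  also have "\<dots> = y * (1 + ln y) ^ (card (insert j S) - 1)"
    using insert.hyps by (cases "card S") auto
  finally show ?case .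
qed

section \<open>Ranks of tensor sums supported on a hyperbolic cross\<close>

lemma alpha_rank_le_card:
  fixes u :: "'i \<Rightarrow> (nat \<Rightarrow> real) \<Rightarrow> real"
  assumes "finite J"
    and "\<And>i. i \<in> J \<Longrightarrow> u i \<in> L2 (cube_meas \<alpha>)" "\<And>i. i \<in> J \<Longrightarrow> w i \<in> L2 (cube_meas ({1..d} - \<alpha>))"
    and v: "AE x in cube_meas {1..d}. v x = (\<Sum>i\<in>J. u i (restrict x \<alpha>) * w i (restrict x ({1..d} - \<alpha>)))"
  shows "alpha_rank d \<alpha> v \<le> enat (card J)"
proof -
  obtain f where f: "bij_betw f {0..<card J} J" using ex_bij_betw_nat_finite[OF assms(1)] by blast
  have fJ: "f i \<in> J" if "i < card J" for i using f that by (auto simp: bij_betw_def)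
  have "(\<Sum>i\<in>J. u i (restrict x \<alpha>) * w i (restrict x ({1..d} - \<alpha>)))
      = (\<Sum>i<card J. u (f i) (restrict x \<alpha>) * w (f i) (restrict x ({1..d} - \<alpha>)))" for x
    using sum.reindex_bij_betw[OF f, of "\<lambda>i. u i (restrict x \<alpha>) * w i (restrict x ({1..d} - \<alpha>))"]
    by (simp add: lessThan_atLeast0)
  then show ?thesis
    unfolding alpha_rank_def using assms fJ
    by (intro Inf_lower CollectI exI[of _ "card J"] exI[of _ "\<lambda>i. u (f i)"] exI[of _ "\<lambda>i. w (f i)"]) auto
qed

lemma sum_indices_merge:
  assumes "\<alpha> \<inter> \<beta> = {}"
  shows "(\<Sum>k\<in>indices (\<alpha> \<union> \<beta>) m. f k) = (\<Sum>a\<in>indices \<alpha> m. \<Sum>b\<in>indices \<beta> m. f (merge \<alpha> \<beta> (a, b)))"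
proof -
  have "(\<Sum>k\<in>indices (\<alpha> \<union> \<beta>) m. f k) = (\<Sum>p\<in>indices \<alpha> m \<times> indices \<beta> m. f (merge \<alpha> \<beta> p))"
    using assms
    by (intro sum.reindex_bij_witness[where j = "\<lambda>k. (restrict k \<alpha>, restrict k \<beta>)" and i = "merge \<alpha> \<beta>"])
      (auto simp: indices_def merge_def PiE_iff extensional_def fun_eq_iff split: if_splits intro!: arg_cong[of _ _ f])
  then show ?thesis by (simp add: sum.cartesian_product)
qed

text \<open>If \<open>\<Prod>(k \<nu> + 1) \<le> y\<^sup>2\<close> then one of the partial products over \<open>\<alpha>\<close> and its complement is at most \<open>y\<close>.\<close>

lemma alpha_rank_hyperbolic:
  assumes \<alpha>: "\<alpha> \<subseteq> {1..d}" and y: "0 \<le> y"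
    and h: "\<And>\<nu> k. \<nu> \<in> {1..d} \<Longrightarrow> k < m \<Longrightarrow> h \<nu> k \<in> L2 unit_meas"
    and c: "\<And>k. k \<in> indices {1..d} m \<Longrightarrow> k \<notin> hyperbolic {1..d} m (y\<^sup>2) \<Longrightarrow> c k = 0"
  shows "alpha_rank d \<alpha> (tensor_sum {1..d} m c h)
    \<le> enat (card (hyperbolic \<alpha> m y) + card (hyperbolic ({1..d} - \<alpha>) m y))"
proof -
  define \<beta> where "\<beta> = {1..d} - \<alpha>"
  have D: "{1..d} = \<alpha> \<union> \<beta>" and disj: "\<alpha> \<inter> \<beta> = {}" using \<alpha> by (auto simp: \<beta>_def)
  have fin: "finite \<alpha>" "finite \<beta>" using \<alpha> by (auto simp: \<beta>_def intro: finite_subset)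
  let ?A = "hyperbolic \<alpha> m y" and ?B = "hyperbolic \<beta> m y"
  define p where "p S k x = (\<Prod>\<nu>\<in>S. h \<nu> (k \<nu>) (x \<nu>))" for S k and x :: "nat \<Rightarrow> real"
  define C where "C a b = c (merge \<alpha> \<beta> (a, b))" for a b
  \<comment> \<open>The coefficients form a matrix C with rows a and columns b. A row in
    \<open>?A\<close> is taken whole, as one product; in every other row only columns in
    \<open>?B\<close> survive, so the rest is one product per such column.\<close>
  define u where "u i = (case i of Inl a \<Rightarrow> p \<alpha> a | Inr b \<Rightarrow> (\<lambda>x. \<Sum>a\<in>indices \<alpha> m - ?A. C a b * p \<alpha> a x))" for i
  define w where "w i = (case i of Inl a \<Rightarrow> (\<lambda>x. \<Sum>b\<in>indices \<beta> m. C a b * p \<beta> b x) | Inr b \<Rightarrow> p \<beta> b)" for i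
  have pL: "p S k \<in> L2 (cube_meas S)" if "S = \<alpha> \<or> S = \<beta>" "k \<in> indices S m" for S k
    unfolding p_def[abs_def] using that fin D h by (intro prod_L2_cube) (auto simp: indices_less)
  have C0: "C a b = 0" if "a \<in> indices \<alpha> m" "b \<in> indices \<beta> m" "a \<notin> ?A" "b \<notin> ?B" for a b
  proof -
    let ?k = "merge \<alpha> \<beta> (a, b)"
    have k: "?k \<in> indices {1..d} m"
      using that disj unfolding D by (auto simp: indices_def merge_def PiE_iff extensional_def)
    have "(\<Prod>\<nu>\<in>{1..d}. real (?k \<nu> + 1)) = (\<Prod>\<nu>\<in>\<alpha>. real (?k \<nu> + 1)) * (\<Prod>\<nu>\<in>\<beta>. real (?k \<nu> + 1))"
      unfolding D using fin disj by (intro prod.union_disjoint)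
    also have "\<dots> = (\<Prod>\<nu>\<in>\<alpha>. real (a \<nu> + 1)) * (\<Prod>\<nu>\<in>\<beta>. real (b \<nu> + 1))"
      using disj by (intro arg_cong2[of _ _ _ _ "(*)"] prod.cong) (auto simp: merge_def)
    \<comment> \<open>Outside both crosses each partial product exceeds y, so the index lies outside
      the large cross.\<close>
    also have "\<dots> > y * y"
      using that y by (intro mult_strict_mono) (auto simp: hyperbolic_def intro!: order.strict_trans1[OF y])
    finally have "?k \<notin> hyperbolic {1..d} m (y\<^sup>2)"
      by (auto simp: hyperbolic_def power2_eq_square)
    then show ?thesis unfolding C_def using c k by blast
  qed
  have "tensor_sum {1..d} m c h x = (\<Sum>i\<in>?A <+> ?B. u i (restrict x \<alpha>) * w i (restrict x \<beta>))" for x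
  proof -
    have pr: "p S k (restrict x S) = p S k x" for S k by (simp add: p_def)
    have "tensor_sum {1..d} m c h x = (\<Sum>a\<in>indices \<alpha> m. \<Sum>b\<in>indices \<beta> m. C a b * (p \<alpha> a x * p \<beta> b x))"
    proof -
      have "(\<Prod>\<nu>\<in>\<alpha> \<union> \<beta>. h \<nu> (merge \<alpha> \<beta> (a, b) \<nu>) (x \<nu>)) = p \<alpha> a x * p \<beta> b x" for a b
        unfolding p_def prod.union_disjoint[OF fin disj]
        using disj by (intro arg_cong2[of _ _ _ _ "(*)"] prod.cong) (auto simp: merge_def)
      then show ?thesis unfolding tensor_sum_def D sum_indices_merge[OF disj] C_def by simp
    qed
    also have "\<dots> = (\<Sum>a\<in>?A. \<Sum>b\<in>indices \<beta> m. C a b * (p \<alpha> a x * p \<beta> b x))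
        + (\<Sum>a\<in>indices \<alpha> m - ?A. \<Sum>b\<in>indices \<beta> m. C a b * (p \<alpha> a x * p \<beta> b x))"
      using fin by (subst add.commute, intro sum.subset_diff) (auto simp: hyperbolic_def)
    also have "(\<Sum>a\<in>indices \<alpha> m - ?A. \<Sum>b\<in>indices \<beta> m. C a b * (p \<alpha> a x * p \<beta> b x))
        = (\<Sum>a\<in>indices \<alpha> m - ?A. \<Sum>b\<in>?B. C a b * (p \<alpha> a x * p \<beta> b x))"
      using fin C0 by (intro sum.cong refl sum.mono_neutral_right) (auto simp: hyperbolic_def)
    also have "\<dots> = (\<Sum>b\<in>?B. \<Sum>a\<in>indices \<alpha> m - ?A. C a b * (p \<alpha> a x * p \<beta> b x))"
      by (rule sum.swap)
    finally show ?thesis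
      using fin by (simp add: sum.Plus u_def w_def pr sum_distrib_left sum_distrib_right mult_ac)
  qed
  moreover have "u i \<in> L2 (cube_meas \<alpha>)" "w i \<in> L2 (cube_meas \<beta>)" if "i \<in> ?A <+> ?B" for i
    using that by (auto simp: u_def w_def hyperbolic_def intro!: L2.sum_mem pL)
  ultimately have "alpha_rank d \<alpha> (tensor_sum {1..d} m c h) \<le> enat (card (?A <+> ?B))"
    using fin unfolding \<beta>_def by (intro alpha_rank_le_card[where u = u and w = w]) auto
  then show ?thesis using fin by (simp add: card_Plus \<beta>_def)
qed

section \<open>Approximation of algebraic tensors\<close>

lemma sum_list_sum_swap:
  fixes g :: "'b \<Rightarrow> 'a \<Rightarrow> real"
  shows "(\<Sum>u\<leftarrow>F. \<Sum>k\<in>A. g u k) = (\<Sum>k\<in>A. \<Sum>u\<leftarrow>F. g u k)"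
  by (induction F) (simp_all add: sum.distrib)

lemma prod_sum_indices:
  fixes g :: "nat \<Rightarrow> nat \<Rightarrow> real"
  assumes "finite S"
  shows "(\<Prod>\<nu>\<in>S. \<Sum>k<m. g \<nu> k) = (\<Sum>k\<in>indices S m. \<Prod>\<nu>\<in>S. g \<nu> (k \<nu>))"
  unfolding indices_def using assms by (intro prod_sum_PiE) auto

definition tensor_coeff :: "nat \<Rightarrow> real \<Rightarrow> (nat \<Rightarrow> real \<Rightarrow> real) \<Rightarrow> tensor \<Rightarrow> (nat \<Rightarrow> nat) \<Rightarrow> real" where
  "tensor_coeff d s e F k = (\<Sum>u\<leftarrow>F. \<Prod>\<nu>=1..d. Hs_inner s (u \<nu>) (e (k \<nu>)))"

definition spanned :: "nat \<Rightarrow> real \<Rightarrow> nat \<Rightarrow> (nat \<Rightarrow> real \<Rightarrow> real) \<Rightarrow> tensor \<Rightarrow> bool" where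
  "spanned d s m e F \<longleftrightarrow> F \<in> tensors_over d (\<lambda>_. Hs s) \<and>
     (\<forall>u\<in>set F. \<forall>\<nu>\<in>{1..d}. Hs.null s (\<lambda>x. u \<nu> x - Hs.proj s m e (u \<nu>) x))"

text \<open>The factors from all directions are put into one space, so a single basis and a single m
  serve every direction.\<close>

lemma exists_basis_spanning:
  assumes "F \<in> tensors_over d (\<lambda>_. Hs s)"
  shows "\<exists>m e. singular_basis s m e \<and> spanned d s m e F"
proof -
  define V where "V = (\<lambda>(u, \<nu>). u \<nu>) ` (set F \<times> {1..d})"
  have "finite V" by (simp add: V_def)
  then obtain vs where vs: "set vs = V" using finite_list by blast
  have "vs ! i \<in> Hs s" if "i < length vs" for i
    using that nth_mem[OF that] assms unfolding vs V_def by (auto simp: tensors_over_def)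
  then obtain m e where me: "singular_basis s m e"
    and null: "\<And>i. i < length vs \<Longrightarrow> Hs.null s (\<lambda>x. (vs ! i) x - Hs.proj s m e (vs ! i) x)"
    using exists_singular_basis[of "length vs" "\<lambda>i. vs ! i" s] by blast
  have "Hs.null s (\<lambda>x. v x - Hs.proj s m e v x)" if "v \<in> V" for v
    using that null unfolding vs[symmetric] in_set_conv_nth by blast
  then have "spanned d s m e F" using assms by (auto simp: spanned_def V_def)
  then show ?thesis using me by blast
qed

lemma tensor_fun_eq_tensor_sum:
  assumes "spanned d s m e F"
  shows "AE x in cube_meas {1..d}. tensor_fun d F x = tensor_sum {1..d} m (tensor_coeff d s e F) (\<lambda>_. e) x"
proof -
  have "AE x in cube_meas {1..d}. u \<nu> (x \<nu>) - Hs.proj s m e (u \<nu>) (x \<nu>) = 0"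
    if "u \<in> set F" "\<nu> \<in> {1..d}" for u \<nu>
    unfolding cube_meas_def
  proof (rule AE_PiM_component)
    show "AE t in unit_meas. u \<nu> t - Hs.proj s m e (u \<nu>) t = 0"
      using assms that by (intro Hs_null_AE[of s]) (auto simp: spanned_def)
  qed (use that prob_space_unit_meas in auto)
  then have "AE x in cube_meas {1..d}. \<forall>u\<in>set F. \<forall>\<nu>\<in>{1..d}. u \<nu> (x \<nu>) - Hs.proj s m e (u \<nu>) (x \<nu>) = 0"
    by (intro AE_finite_allI) auto
  then show ?thesis
  proof eventually_elim
    case (elim x)
    have "tensor_fun d F x = (\<Sum>u\<leftarrow>F. \<Prod>\<nu>=1..d. \<Sum>k<m. Hs_inner s (u \<nu>) (e k) * e k (x \<nu>))"
      unfolding tensor_fun_def using elim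
      by (intro arg_cong[of _ _ sum_list] map_cong prod.cong) (auto simp: Hs.proj_def)
    also have "\<dots> = (\<Sum>u\<leftarrow>F. \<Sum>k\<in>indices {1..d} m. (\<Prod>\<nu>=1..d. Hs_inner s (u \<nu>) (e (k \<nu>))) * (\<Prod>\<nu>=1..d. e (k \<nu>) (x \<nu>)))"
      by (simp add: prod_sum_indices prod.distrib)
    also have "\<dots> = tensor_sum {1..d} m (tensor_coeff d s e F) (\<lambda>_. e) x"
      by (simp add: sum_list_sum_swap tensor_sum_def tensor_coeff_def sum_list_mult_const)
    finally show ?case .
  qed
qed

text \<open>Parseval in each direction, multiplied out. Taking coefficients is thus an isometry into
  a Euclidean space, from which semidefiniteness and the triangle inequality of the mixed norm are
  inherited.\<close>

lemma mix_inner_eq: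
  assumes e: "Hs.orthonormal s m e" and F: "spanned d s m e F" and G: "spanned d s m e G"
  shows "mix_inner d s F G = (\<Sum>k\<in>indices {1..d} m. tensor_coeff d s e F k * tensor_coeff d s e G k)"
proof -
  have "mix_inner d s F G = (\<Sum>u\<leftarrow>F. \<Sum>w\<leftarrow>G. \<Prod>\<nu>=1..d. \<Sum>k<m. Hs_inner s (u \<nu>) (e k) * Hs_inner s (w \<nu>) (e k))"
    unfolding mix_inner_def using F G
    by (intro arg_cong[of _ _ sum_list] map_cong prod.cong refl Hs.parseval[OF e])
      (auto simp: spanned_def tensors_over_def)
  also have "\<dots> = (\<Sum>u\<leftarrow>F. \<Sum>w\<leftarrow>G. \<Sum>k\<in>indices {1..d} m.
      (\<Prod>\<nu>=1..d. Hs_inner s (u \<nu>) (e (k \<nu>))) * (\<Prod>\<nu>=1..d. Hs_inner s (w \<nu>) (e (k \<nu>))))"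
    by (simp add: prod_sum_indices prod.distrib)
  also have "\<dots> = (\<Sum>k\<in>indices {1..d} m. tensor_coeff d s e F k * tensor_coeff d s e G k)"
    by (simp add: sum_list_sum_swap tensor_coeff_def sum_list_mult_const sum_list_const_mult)
  finally show ?thesis .
qed

lemma spanned_append: "spanned d s m e (F @ G) \<longleftrightarrow> spanned d s m e F \<and> spanned d s m e G"
  by (auto simp: spanned_def tensors_over_def)

definition mix_norm :: "nat \<Rightarrow> real \<Rightarrow> tensor \<Rightarrow> real" where
  "mix_norm d s F = sqrt (mix_inner d s F F)"

lemma mix_norm_triangle:
  assumes "F \<in> tensors_over d (\<lambda>_. Hs s)" "G \<in> tensors_over d (\<lambda>_. Hs s)"
  shows "\<bar>mix_norm d s F - mix_norm d s G\<bar> \<le> mix_dist d s F G"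
proof -
  have "F @ G \<in> tensors_over d (\<lambda>_. Hs s)" using assms by (auto simp: tensors_over_def)
  \<comment> \<open>Concatenating the two lists forces a common basis for F and G.\<close>
  then obtain m e where e: "Hs.orthonormal s m e" and FG: "spanned d s m e F" "spanned d s m e G"
    using exists_basis_spanning by (metis spanned_append singular_basis_def)
  let ?I = "indices {1..d} m" and ?f = "tensor_coeff d s e F" and ?g = "tensor_coeff d s e G"
  have "mix_inner d s F F - 2 * mix_inner d s F G + mix_inner d s G G = (\<Sum>k\<in>?I. (?f k - ?g k)\<^sup>2)"
    by (simp add: mix_inner_eq[OF e] FG power2_eq_square algebra_simps sum.distrib sum_subtractf sum_distrib_left)
  then have dist: "mix_dist d s F G = L2_set (\<lambda>k. ?f k - ?g k) ?I"
    by (simp add: mix_dist_def L2_set_def)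
  have norm: "mix_norm d s F = L2_set ?f ?I" "mix_norm d s G = L2_set ?g ?I"
    by (simp_all add: mix_norm_def mix_inner_eq[OF e] FG L2_set_def power2_eq_square)
  have "L2_set ?f ?I \<le> L2_set (\<lambda>k. ?f k - ?g k) ?I + L2_set ?g ?I"
    using L2_set_triangle_ineq[of "\<lambda>k. ?f k - ?g k" ?g ?I] by simp
  moreover have "L2_set ?g ?I \<le> L2_set (\<lambda>k. ?f k - ?g k) ?I + L2_set ?f ?I"
    using L2_set_triangle_ineq[of "\<lambda>k. ?g k - ?f k" ?f ?I] by (simp add: L2_set_def power2_commute)
  ultimately show ?thesis unfolding dist norm by linarith
qed

section \<open>Frame bounds for the basis, its projections and their residuals\<close>

lemma frame_basis:
  assumes "Hs.orthonormal s m e"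
  shows "frame m e 1"
proof -
  have e: "e k \<in> Hs s" if "k < m" for k using assms that by (simp add: Hs.orthonormal_def)
  have "L2_inner unit_meas (\<lambda>t. \<Sum>k<m. x k * e k t) (\<lambda>t. \<Sum>k<m. x k * e k t) \<le> (\<Sum>k<m. (x k)\<^sup>2)" for x
    unfolding Hs_norm_lincomb_sq[OF assms, symmetric]
    using e by (intro L2_inner_le_Hs_inner Hs.sum_mem) auto
  then show ?thesis using e by (auto simp: frame_def intro: Hs_L2)
qed

text \<open>A map A from H^s to L^2 with squared norm at most \<kappa> sends an H^s-orthonormal
  system to a frame with bound \<kappa>. It is used with A the projection onto an approximation
  space and with A the map to the residual.\<close>

lemma frame_image:
  assumes e: "Hs.orthonormal s m e" and h: "\<And>k. k < m \<Longrightarrow> h k \<in> L2 unit_meas"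
    and A: "\<And>x. (\<lambda>t. \<Sum>k<m. x k * h k t) = A (\<lambda>t. \<Sum>k<m. x k * e k t)"
    and bound: "\<And>u. u \<in> Hs s \<Longrightarrow> L2_inner unit_meas (A u) (A u) \<le> \<kappa> * Hs_inner s u u" and "0 \<le> \<kappa>"
  shows "frame m h \<kappa>"
  unfolding frame_def
proof (intro conjI allI impI)
  fix x
  have "(\<lambda>t. \<Sum>k<m. x k * e k t) \<in> Hs s" using e by (intro Hs.sum_mem) (auto simp: Hs.orthonormal_def)
  from bound[OF this] show "L2_inner unit_meas (\<lambda>t. \<Sum>k<m. x k * h k t) (\<lambda>t. \<Sum>k<m. x k * h k t)
      \<le> \<kappa> * (\<Sum>k<m. (x k)\<^sup>2)"
    unfolding A Hs_norm_lincomb_sq[OF e] .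
qed (use assms in auto)

lemma L2_proj_sum:
  assumes b: "L2.orthonormal M n b" and e: "\<And>k. k < m \<Longrightarrow> e k \<in> L2 M"
  shows "(\<Sum>k<m. x k * L2.proj M n b (e k) t) = L2.proj M n b (\<lambda>t. \<Sum>k<m. x k * e k t) t"
proof -
  have "L2.proj M n b (\<lambda>t. \<Sum>k<m. x k * e k t) t = (\<Sum>i<n. (\<Sum>k<m. x k * L2_inner M (e k) (b i)) * b i t)"
    unfolding L2.proj_def using b e
    by (intro sum.cong refl arg_cong2[of _ _ _ _ "(*)"] L2.ip_sum) (auto simp: L2.orthonormal_def)
  also have "\<dots> = (\<Sum>k<m. x k * L2.proj M n b (e k) t)"
    unfolding L2.proj_def sum_distrib_left sum_distrib_right by (subst sum.swap) (simp add: mult_ac)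
  finally show ?thesis by simp
qed

lemma frame_projection:
  assumes e: "Hs.orthonormal s m e" and b: "L2.orthonormal unit_meas n b"
  shows "frame m (\<lambda>k. L2.proj unit_meas n b (e k)) 1"
proof (rule frame_image[OF e, where A = "L2.proj unit_meas n b"])
  have eL: "e k \<in> L2 unit_meas" if "k < m" for k
    using e that Hs_L2 by (auto simp: Hs.orthonormal_def)
  show "(\<lambda>t. \<Sum>k<m. x k * L2.proj unit_meas n b (e k) t) = L2.proj unit_meas n b (\<lambda>t. \<Sum>k<m. x k * e k t)" for x
    by (intro ext L2_proj_sum[OF b eL])
  fix u assume u: "u \<in> Hs s"
  let ?P = "L2.proj unit_meas n b u"
  have uL: "u \<in> L2 unit_meas" using u by (rule Hs_L2)
  have P: "?P \<in> L2 unit_meas" by (rule L2.proj_mem[OF b])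
  have "L2_inner unit_meas ?P ?P = (\<Sum>k<n. (L2_inner unit_meas u (b k))\<^sup>2)"
    unfolding L2.ip_proj_left[OF b uL P] using L2.ip_proj_basis[OF b uL] L2.ip_sym[OF P]
    by (intro sum.cong) (auto simp: power2_eq_square)
  also have "\<dots> \<le> L2_inner unit_meas u u"
    using L2.ip_self_proj[OF b uL] L2.ip_nonneg[OF L2.diff_mem[OF uL P]] by simp
  also have "\<dots> \<le> Hs_inner s u u" by (rule L2_inner_le_Hs_inner[OF u])
  finally show "L2_inner unit_meas ?P ?P \<le> 1 * Hs_inner s u u" by simp
qed (use L2.proj_mem[OF b] in auto)

lemma frame_residual:
  assumes e: "Hs.orthonormal s m e" and b: "L2.orthonormal unit_meas n b"
    and err: "\<And>u. u \<in> Hs s \<Longrightarrow> L2_norm unit_meas (\<lambda>t. u t - L2.proj unit_meas n b u t) \<le> \<delta> * Hs_norm s u"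
  shows "frame m (\<lambda>k t. e k t - L2.proj unit_meas n b (e k) t) (\<delta>\<^sup>2)"
proof (rule frame_image[OF e, where A = "\<lambda>u t. u t - L2.proj unit_meas n b u t"])
  have eL: "e k \<in> L2 unit_meas" if "k < m" for k
    using e that Hs_L2 by (auto simp: Hs.orthonormal_def)
  show "(\<lambda>t. e k t - L2.proj unit_meas n b (e k) t) \<in> L2 unit_meas" if "k < m" for k
    using eL[OF that] by (intro L2.diff_mem L2.proj_mem[OF b])
  show "(\<lambda>t. \<Sum>k<m. x k * (e k t - L2.proj unit_meas n b (e k) t))
      = (\<lambda>t. (\<Sum>k<m. x k * e k t) - L2.proj unit_meas n b (\<lambda>t. \<Sum>k<m. x k * e k t) t)" for x
    using L2_proj_sum[where m = m and e = e, OF b eL] by (auto simp: right_diff_distrib sum_subtractf)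
  fix u assume u: "u \<in> Hs s"
  have "(L2_norm unit_meas (\<lambda>t. u t - L2.proj unit_meas n b u t))\<^sup>2 \<le> (\<delta> * Hs_norm s u)\<^sup>2"
    using err[OF u] by (intro power_mono) auto
  then show "L2_inner unit_meas (\<lambda>t. u t - L2.proj unit_meas n b u t) (\<lambda>t. u t - L2.proj unit_meas n b u t)
      \<le> \<delta>\<^sup>2 * Hs_inner s u u"
    by (simp add: L2_norm_sq power_mult_distrib Hs_norm_sq[OF u])
qed auto

lemma tensor_fun_L2:
  assumes "\<And>u \<nu>. u \<in> set F \<Longrightarrow> \<nu> \<in> {1..d} \<Longrightarrow> u \<nu> \<in> L2 unit_meas"
  shows "tensor_fun d F \<in> L2 (cube_meas {1..d})"
proof -
  have "(\<lambda>x. \<Sum>u\<leftarrow>F. \<Prod>\<nu>=1..d. u \<nu> (x \<nu>)) \<in> L2 (cube_meas {1..d})"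
    using assms
  proof (induction F)
    case (Cons u F)
    have "(\<lambda>x. \<Prod>\<nu>=1..d. u \<nu> (x \<nu>)) \<in> L2 (cube_meas {1..d})"
      using Cons.prems by (intro prod_L2_cube) auto
    then show ?case using Cons by (auto intro: L2.add_mem)
  qed (simp add: L2.zero_mem)
  then show ?thesis by (simp add: tensor_fun_def[abs_def])
qed

lemma tensor_fun_Hs_L2:
  "F \<in> tensors_over d (\<lambda>_. Hs s) \<Longrightarrow> tensor_fun d F \<in> L2 (cube_meas {1..d})"
  by (rule tensor_fun_L2) (auto simp: tensors_over_def intro!: Hs_L2[of _ s])

lemma mix_norm_sq:
  assumes "Hs.orthonormal s m e" "spanned d s m e F"
  shows "(mix_norm d s F)\<^sup>2 = (\<Sum>k\<in>indices {1..d} m. (tensor_coeff d s e F k)\<^sup>2)" "0 \<le> mix_norm d s F"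
  using assms by (simp_all add: mix_norm_def mix_inner_eq sum_nonneg power2_eq_square)

lemma tensor_sum_basis_L2:
  assumes "Hs.orthonormal s m e"
  shows "tensor_sum {1..d} m c (\<lambda>_. e) \<in> L2 (cube_meas {1..d})"
  using frame_basis[OF assms] by (intro tensor_sum_L2) (auto simp: frame_def)

lemma L2_norm_tensor_fun_le:
  assumes F: "F \<in> tensors_over d (\<lambda>_. Hs s)"
  shows "L2_norm (cube_meas {1..d}) (tensor_fun d F) \<le> mix_norm d s F"
proof -
  obtain m e where e: "Hs.orthonormal s m e" and sp: "spanned d s m e F"
    using exists_basis_spanning[OF F] by (auto simp: singular_basis_def)
  let ?t = "tensor_sum {1..d} m (tensor_coeff d s e F) (\<lambda>_. e)"
  have "L2_norm (cube_meas {1..d}) (tensor_fun d F) = L2_norm (cube_meas {1..d}) ?t"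
    by (intro L2_norm_cong_AE tensor_fun_Hs_L2[OF F] tensor_sum_basis_L2[OF e] tensor_fun_eq_tensor_sum[OF sp])
  moreover have "(L2_norm (cube_meas {1..d}) ?t)\<^sup>2 \<le> (\<Prod>\<nu>\<in>{1..d}. 1) * (\<Sum>k\<in>indices {1..d} m. (tensor_coeff d s e F k)\<^sup>2)"
    unfolding L2_norm_sq by (intro tensor_sum_bound frame_basis[OF e]) auto
  then have "L2_norm (cube_meas {1..d}) ?t \<le> mix_norm d s F"
    using power2_le_imp_le[OF _ mix_norm_sq(2)[OF e sp]] mix_norm_sq(1)[OF e sp] by simp
  ultimately show ?thesis by simp
qed

section \<open>Decay of the singular values and the truncation error\<close>

lemma L2_inner_basis_le_1:
  assumes "Hs.orthonormal s m e" "k < m"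
  shows "L2_inner unit_meas (e k) (e k) \<le> 1"
  using assms L2_inner_le_Hs_inner[of "e k" s] by (simp add: Hs.orthonormal_def)

text \<open>The assumption on the spaces starts at dimension 1, so k = 0 is covered by the norm of
  the embedding, whence the maximum with 1 in B. For k \<ge> 1, passing from k to k + 1 \<le> 2 k
  costs the factor \<open>2 powr s\<close>. The singular values belong to the basis, so the spaces
  of direction 1 suffice.\<close>

lemma singular_value_bound:
  assumes U: "approx_spaces d s M U" and d: "1 \<le> d" and s: "0 < s"
    and e: "singular_basis s m e" and k: "k < m"
  defines "B \<equiv> max 1 (\<bar>M\<bar> * 2 powr s)"
  shows "L2_inner unit_meas (e k) (e k) \<le> (B * real (k + 1) powr - s)\<^sup>2"
proof (cases "k = 0")
  case True
  have "1 \<le> B\<^sup>2" by (simp add: B_def)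
  then show ?thesis using L2_inner_basis_le_1[of s m e 0] e k True by (simp add: singular_basis_def)
next
  case False
  then have k1: "1 \<le> k" by simp
  have "L2_inner unit_meas (e k) (e k) \<le> (M * real k powr - s)\<^sup>2"
    using U d k1 by (intro singular_value_le[OF e k, of "U 1 k"]) (auto simp: approx_spaces_def)
  also have "\<dots> \<le> (B * real (k + 1) powr - s)\<^sup>2"
  proof -
    have "real (k + 1) powr s \<le> (2 * real k) powr s" using k1 s by (intro powr_mono2) auto
    then have "real k powr - s \<le> 2 powr s * real (k + 1) powr - s"
      using k1 by (simp add: powr_minus powr_mult field_simps)
    then have "\<bar>M\<bar> * real k powr - s \<le> \<bar>M\<bar> * (2 powr s * real (k + 1) powr - s)"
      by (intro mult_left_mono) auto
    also have "\<dots> \<le> B * real (k + 1) powr - s"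
      unfolding mult.assoc[symmetric] B_def by (intro mult_right_mono) auto
    finally have "\<bar>M * real k powr - s\<bar> \<le> \<bar>B * real (k + 1) powr - s\<bar>"
      by (simp add: abs_mult B_def)
    then show ?thesis by (simp add: abs_le_square_iff)
  qed
  finally show ?thesis .
qed

text \<open>Products of the e k are orthogonal in L^2 too, so the squared norm is a weighted sum of
  squared coefficients. The error is governed by the largest neglected weight and not by the sum of
  the weights; this is why no logarithm enters here.\<close>

lemma hyperbolic_truncation_error:
  assumes e: "singular_basis s m e" and s: "0 < s" and y: "0 < y" and B: "0 \<le> B"
    and sv: "\<And>k. k < m \<Longrightarrow> L2_inner unit_meas (e k) (e k) \<le> (B * real (k + 1) powr - s)\<^sup>2"
    and c: "\<And>k. k \<in> hyperbolic {1..d} m y \<Longrightarrow> c k = 0"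
  shows "(L2_norm (cube_meas {1..d}) (tensor_sum {1..d} m c (\<lambda>_. e)))\<^sup>2
    \<le> (B ^ d * y powr - s)\<^sup>2 * (\<Sum>k\<in>indices {1..d} m. (c k)\<^sup>2)"
proof -
  let ?L = "L2_inner unit_meas" and ?I = "indices {1..d} m"
  have eL: "e k \<in> L2 unit_meas" if "k < m" for k
    using e that Hs_L2 by (auto simp: singular_basis_def Hs.orthonormal_def)
  have "(L2_norm (cube_meas {1..d}) (tensor_sum {1..d} m c (\<lambda>_. e)))\<^sup>2
      = (\<Sum>k\<in>?I. \<Sum>l\<in>?I. c k * c l * (\<Prod>\<nu>=1..d. ?L (e (k \<nu>)) (e (l \<nu>))))"
    unfolding L2_norm_sq by (intro tensor_sum_inner eL) auto
  also have "\<dots> = (\<Sum>k\<in>?I. \<Sum>l\<in>?I. if l = k then (c k)\<^sup>2 * (\<Prod>\<nu>=1..d. ?L (e (k \<nu>)) (e (k \<nu>))) else 0)"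
  proof (intro sum.cong refl)
    fix k l assume kl: "k \<in> ?I" "l \<in> ?I"
    show "c k * c l * (\<Prod>\<nu>=1..d. ?L (e (k \<nu>)) (e (l \<nu>)))
      = (if l = k then (c k)\<^sup>2 * (\<Prod>\<nu>=1..d. ?L (e (k \<nu>)) (e (k \<nu>))) else 0)"
    proof (cases "l = k")
      case False
      then obtain \<nu> where \<nu>: "\<nu> \<in> {1..d}" "k \<nu> \<noteq> l \<nu>"
        using kl unfolding indices_def by (metis PiE_ext)
      then have "?L (e (k \<nu>)) (e (l \<nu>)) = 0"
        using e kl by (auto simp: singular_basis_def indices_less)
      then have "(\<Prod>\<nu>=1..d. ?L (e (k \<nu>)) (e (l \<nu>))) = 0" using \<nu> by (intro prod_zero) auto
      then show ?thesis using False by simp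
    qed (simp add: power2_eq_square)
  qed
  also have "\<dots> = (\<Sum>k\<in>?I. (c k)\<^sup>2 * (\<Prod>\<nu>=1..d. ?L (e (k \<nu>)) (e (k \<nu>))))"
    by (simp add: sum.delta)
  also have "\<dots> \<le> (\<Sum>k\<in>?I. (B ^ d * y powr - s)\<^sup>2 * (c k)\<^sup>2)"
  proof (intro sum_mono)
    fix k assume k: "k \<in> ?I"
    show "(c k)\<^sup>2 * (\<Prod>\<nu>=1..d. ?L (e (k \<nu>)) (e (k \<nu>))) \<le> (B ^ d * y powr - s)\<^sup>2 * (c k)\<^sup>2"
    proof (cases "k \<in> hyperbolic {1..d} m y")
      case False
      define P where "P = (\<Prod>\<nu>=1..d. real (k \<nu> + 1))"
      have P: "y < P" using False k by (simp add: hyperbolic_def P_def)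
      have "(\<Prod>\<nu>=1..d. ?L (e (k \<nu>)) (e (k \<nu>))) \<le> (\<Prod>\<nu>=1..d. (B * real (k \<nu> + 1) powr - s)\<^sup>2)"
        using k by (intro prod_mono conjI L2.ip_nonneg eL sv) (auto simp: indices_less)
      also have "\<dots> = (B ^ d * P powr - s)\<^sup>2"
      proof -
        have "P powr - s = (\<Prod>\<nu>=1..d. real (k \<nu> + 1) powr - s)"
          unfolding P_def by (rule prod_powr_distrib)
        then show ?thesis by (simp add: prod.distrib flip: prod_power_distrib)
      qed
      also have "\<dots> \<le> (B ^ d * y powr - s)\<^sup>2"
        using P y s B by (intro power_mono mult_left_mono powr_mono2') auto
      finally have "(\<Prod>\<nu>=1..d. ?L (e (k \<nu>)) (e (k \<nu>))) \<le> (B ^ d * y powr - s)\<^sup>2" .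
      from mult_left_mono[OF this, of "(c k)\<^sup>2"] show ?thesis by (simp add: mult.commute)
    qed (use c in simp)
  qed
  finally show ?thesis by (simp add: sum_distrib_left)
qed

text \<open>The rank bound only sees which coefficients vanish, so it is unaffected when each e k is
  replaced by its projection p \<nu> k. The error splits into truncation and replacement.\<close>

lemma approximant:
  assumes U: "approx_spaces d s M U" and d: "2 \<le> d" and s: "0 < s" and y: "1 \<le> y" and n: "1 \<le> n"
    and F: "F \<in> tensors_over d (\<lambda>_. Hs s)"
  defines "B \<equiv> max 1 (\<bar>M\<bar> * 2 powr s)"
  shows "\<exists>v\<in>tensor_space d (\<lambda>\<nu>. U \<nu> n).
    (\<forall>\<alpha>. \<alpha> \<noteq> {} \<longrightarrow> \<alpha> \<subset> {1..d} \<longrightarrow> alpha_rank d \<alpha> v \<le> enat (nat \<lfloor>2 * y * (1 + ln y) ^ (d - 2)\<rfloor>)) \<and>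
    (L2_norm (cube_meas {1..d}) (\<lambda>x. tensor_fun d F x - v x))\<^sup>2
      \<le> 2 * ((B ^ d * (y\<^sup>2) powr - s)\<^sup>2 + (real d * M * real n powr - s)\<^sup>2) * (mix_norm d s F)\<^sup>2"
proof -
  let ?D = "{1..d}" and ?C = "cube_meas {1..d}" and ?U = unit_meas
  obtain m e where sb: "singular_basis s m e" and sp: "spanned d s m e F"
    using exists_basis_spanning[OF F] by blast
  then have e: "Hs.orthonormal s m e" by (simp add: singular_basis_def)
  have eL: "e k \<in> L2 ?U" if "k < m" for k
    using e that Hs_L2 by (auto simp: Hs.orthonormal_def)
  define Q where "Q \<nu> q b \<longleftrightarrow> L2.orthonormal ?U q b \<and> (\<forall>u\<in>L2 ?U. L2.proj ?U q b u \<in> U \<nu> n \<and>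
      L2_norm ?U (\<lambda>x. u x - L2.proj ?U q b u x) \<le> best_error ?U u (U \<nu> n))" for \<nu> q b
  have "\<forall>\<nu>\<in>?D. \<exists>q b. Q \<nu> q b"
    unfolding Q_def using U n by (intro ballI L2_projection) (auto simp: approx_spaces_def)
  from bchoice[OF this] obtain q where "\<forall>\<nu>\<in>?D. \<exists>b. Q \<nu> (q \<nu>) b" by blast
  from bchoice[OF this] obtain b where Q: "\<And>\<nu>. \<nu> \<in> ?D \<Longrightarrow> Q \<nu> (q \<nu>) (b \<nu>)" by blast
  have b: "L2.orthonormal ?U (q \<nu>) (b \<nu>)" if "\<nu> \<in> ?D" for \<nu>
    using Q[OF that] by (simp add: Q_def)
  have bU: "L2.proj ?U (q \<nu>) (b \<nu>) u \<in> U \<nu> n"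
    and berr: "L2_norm ?U (\<lambda>x. u x - L2.proj ?U (q \<nu>) (b \<nu>) u x) \<le> best_error ?U u (U \<nu> n)"
    if "\<nu> \<in> ?D" "u \<in> L2 ?U" for \<nu> u
    using Q[OF that(1)] that(2) by (simp_all add: Q_def)
  define p where "p \<nu> k = L2.proj ?U (q \<nu>) (b \<nu>) (e k)" for \<nu> k
  define c where "c = tensor_coeff d s e F"
  define c' where "c' k = (if k \<in> hyperbolic ?D m (y\<^sup>2) then c k else 0)" for k
  define v where "v = tensor_sum ?D m c' p"
  let ?t = "\<lambda>c. tensor_sum ?D m c (\<lambda>_. e)"
  have pL: "p \<nu> k \<in> L2 ?U" if "\<nu> \<in> ?D" for \<nu> k
    unfolding p_def using b[OF that] by (rule L2.proj_mem)
  have tL: "?t c \<in> L2 ?C" for c by (rule tensor_sum_basis_L2[OF e])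
  have vL: "v \<in> L2 ?C" unfolding v_def using pL by (intro tensor_sum_L2) auto

  have "v \<in> tensor_space d (\<lambda>\<nu>. U \<nu> n)"
  proof -
    obtain ks where ks: "set ks = indices ?D m" "distinct ks"
      using finite_distinct_list[OF finite_indices[of ?D m]] by auto
    \<comment> \<open>Elementary tensors carry no scalar, so the coefficient is absorbed into the
      factor of direction 1.\<close>
    define G :: tensor where "G = map (\<lambda>k \<nu> t. if \<nu> = 1 then c' k * p \<nu> (k \<nu>) t else p \<nu> (k \<nu>) t) ks"
    have "tensor_fun d G x = v x" for x
    proof -
      have one: "(\<Prod>\<nu>=1..d. if \<nu> = 1 then c' k * p \<nu> (k \<nu>) (x \<nu>) else p \<nu> (k \<nu>) (x \<nu>))
          = c' k * (\<Prod>\<nu>=1..d. p \<nu> (k \<nu>) (x \<nu>))" for k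
      proof -
        have "(\<Prod>\<nu>=1..d. if \<nu> = 1 then c' k * p \<nu> (k \<nu>) (x \<nu>) else p \<nu> (k \<nu>) (x \<nu>))
            = (\<Prod>\<nu>=1..d. (if \<nu> = 1 then c' k else 1) * p \<nu> (k \<nu>) (x \<nu>))"
          by (intro prod.cong) auto
        then show ?thesis using d by (simp add: prod.distrib prod.delta)
      qed
      have "tensor_fun d G x = (\<Sum>k\<leftarrow>ks. c' k * (\<Prod>\<nu>=1..d. p \<nu> (k \<nu>) (x \<nu>)))"
        unfolding tensor_fun_def G_def map_map o_def one ..
      also have "\<dots> = v x"
        unfolding v_def tensor_sum_def ks(1)[symmetric] by (rule sum_list_distinct_conv_sum_set[OF ks(2)])
      finally show ?thesis .
    qed
    moreover have "G \<in> tensors_over d (\<lambda>\<nu>. U \<nu> n)"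
    proof -
      \<comment> \<open>A multiple of a projection is the projection of the multiple, hence again in
        the space.\<close>
      have "(\<lambda>t. a * p \<nu> (k \<nu>) t) \<in> U \<nu> n" if k: "k \<in> indices ?D m" and \<nu>: "\<nu> \<in> ?D" for a k \<nu>
      proof -
        have eL': "e (k \<nu>) \<in> L2 ?U" using eL indices_less[OF k \<nu>] by simp
        have "L2.proj ?U (q \<nu>) (b \<nu>) (\<lambda>t. a * e (k \<nu>) t) = (\<lambda>t. a * p \<nu> (k \<nu>) t)"
          using b[OF \<nu>] eL' unfolding p_def L2.proj_def
          by (auto simp: L2.ip_scale L2.orthonormal_def sum_distrib_left mult.assoc)
        then show ?thesis using bU[OF \<nu> L2.scale_mem[OF eL', of a]] by simp
      qed
      from this[where a = "c' _"] this[where a = 1]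
      have "(\<lambda>t. if \<nu> = 1 then c' k * p \<nu> (k \<nu>) t else p \<nu> (k \<nu>) t) \<in> U \<nu> n"
        if "k \<in> indices ?D m" "\<nu> \<in> ?D" for k \<nu>
        using that by (cases "\<nu> = 1") auto
      then show ?thesis using ks(1) by (auto simp: tensors_over_def G_def)
    qed
    ultimately show ?thesis using vL unfolding tensor_space_def by (intro CollectI conjI bexI[of _ G]) auto
  qed
  moreover have "alpha_rank d \<alpha> v \<le> enat (nat \<lfloor>2 * y * (1 + ln y) ^ (d - 2)\<rfloor>)"
    if \<alpha>: "\<alpha> \<noteq> {}" "\<alpha> \<subset> ?D" for \<alpha>
  proof -
    \<comment> \<open>A proper subset of {1..d} has at most d - 1 elements, hence at most d - 2
      logarithms. Both \<alpha> and its complement are proper, which gives the factor 2.\<close>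
    have card: "real (card (hyperbolic \<beta> m y)) \<le> y * (1 + ln y) ^ (d - 2)" if "\<beta> \<noteq> {}" "\<beta> \<subset> ?D" for \<beta>
    proof -
      have fin: "finite \<beta>" using that finite_subset[of \<beta> ?D] by auto
      have "card \<beta> < d" using psubset_card_mono[of ?D \<beta>] that by simp
      then have "(1 + ln y) ^ (card \<beta> - 1) \<le> (1 + ln y) ^ (d - 2)"
        using y by (intro power_increasing) auto
      then show ?thesis
        using card_hyperbolic_le[OF fin that(1) y, of m] y by (meson mult_left_mono order_trans zero_le_one)
    qed
    have "alpha_rank d \<alpha> v \<le> enat (card (hyperbolic \<alpha> m y) + card (hyperbolic (?D - \<alpha>) m y))"
      unfolding v_def using \<alpha> y pL by (intro alpha_rank_hyperbolic) (auto simp: c'_def)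
    moreover have "?D - \<alpha> \<noteq> {}" "?D - \<alpha> \<subset> ?D" using \<alpha> by auto
    then have "card (hyperbolic \<alpha> m y) + card (hyperbolic (?D - \<alpha>) m y) \<le> nat \<lfloor>2 * y * (1 + ln y) ^ (d - 2)\<rfloor>"
      using card[OF \<alpha>] card[of "?D - \<alpha>"] by (intro le_nat_floor) simp
    ultimately show ?thesis by (meson enat_ord_simps(1) order_trans)
  qed
  moreover have "(L2_norm ?C (\<lambda>x. tensor_fun d F x - v x))\<^sup>2
      \<le> 2 * ((B ^ d * (y\<^sup>2) powr - s)\<^sup>2 + (real d * M * real n powr - s)\<^sup>2) * (mix_norm d s F)\<^sup>2"
  proof -
    let ?N = "\<Sum>k\<in>indices ?D m. (c k)\<^sup>2"
    have N: "(mix_norm d s F)\<^sup>2 = ?N" unfolding c_def by (rule mix_norm_sq(1)[OF e sp])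
    have le1: "(\<Sum>k\<in>indices ?D m. (c k - c' k)\<^sup>2) \<le> ?N" and le2: "(\<Sum>k\<in>indices ?D m. (c' k)\<^sup>2) \<le> ?N"
      by (auto simp: c'_def intro!: sum_mono)
    have 1: "(L2_norm ?C (?t (\<lambda>k. c k - c' k)))\<^sup>2 \<le> (B ^ d * (y\<^sup>2) powr - s)\<^sup>2 * ?N"
    proof -
      have "(L2_norm ?C (?t (\<lambda>k. c k - c' k)))\<^sup>2
          \<le> (B ^ d * (y\<^sup>2) powr - s)\<^sup>2 * (\<Sum>k\<in>indices ?D m. (c k - c' k)\<^sup>2)"
        using y d singular_value_bound[OF U _ s sb]
        by (intro hyperbolic_truncation_error sb s) (auto simp: c'_def B_def)
      also have "\<dots> \<le> (B ^ d * (y\<^sup>2) powr - s)\<^sup>2 * ?N" by (intro mult_left_mono le1) auto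
      finally show ?thesis .
    qed
    have 2: "(L2_norm ?C (\<lambda>x. ?t c' x - v x))\<^sup>2 \<le> (real d * M * real n powr - s)\<^sup>2 * ?N"
    proof -
      have "(L2_norm ?C (\<lambda>x. ?t c' x - v x))\<^sup>2
          \<le> (real d)\<^sup>2 * (M * real n powr - s)\<^sup>2 * (\<Sum>k\<in>indices ?D m. (c' k)\<^sup>2)"
        unfolding v_def
      proof (rule tensor_sum_replace_bound)
        fix \<nu> assume \<nu>: "\<nu> \<in> ?D"
        show "frame m e 1" by (rule frame_basis[OF e])
        show "frame m (p \<nu>) 1" unfolding p_def[abs_def] by (rule frame_projection[OF e b[OF \<nu>]])
        show "frame m (\<lambda>k t. e k t - p \<nu> k t) ((M * real n powr - s)\<^sup>2)"
          unfolding p_def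
        proof (rule frame_residual[OF e b[OF \<nu>]])
          fix u assume u: "u \<in> Hs s"
          have "best_error ?U u (U \<nu> n) \<le> M * real n powr - s * Hs_norm s u"
            using U \<nu> n u by (simp add: approx_spaces_def)
          then show "L2_norm ?U (\<lambda>t. u t - L2.proj ?U (q \<nu>) (b \<nu>) u t) \<le> M * real n powr - s * Hs_norm s u"
            using berr[OF \<nu> Hs_L2[OF u]] by simp
        qed
      qed
      also have "\<dots> \<le> (real d)\<^sup>2 * (M * real n powr - s)\<^sup>2 * ?N" by (intro mult_left_mono le2) auto
      finally show ?thesis by (simp add: power_mult_distrib mult.assoc)
    qed
    have AE: "AE x in ?C. tensor_fun d F x - v x = ?t (\<lambda>k. c k - c' k) x + (?t c' x - v x)"
      using tensor_fun_eq_tensor_sum[OF sp]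
      by eventually_elim (simp add: c_def tensor_sum_def left_diff_distrib sum_subtractf)
    have eq: "L2_norm ?C (\<lambda>x. tensor_fun d F x - v x) = L2_norm ?C (\<lambda>x. ?t (\<lambda>k. c k - c' k) x + (?t c' x - v x))"
      by (intro L2_norm_cong_AE AE L2.diff_mem L2.add_mem tL vL tensor_fun_Hs_L2[OF F])
    have "(L2_norm ?C (\<lambda>x. tensor_fun d F x - v x))\<^sup>2
        \<le> 2 * (L2_norm ?C (?t (\<lambda>k. c k - c' k)))\<^sup>2 + 2 * (L2_norm ?C (\<lambda>x. ?t c' x - v x))\<^sup>2"
      unfolding eq by (intro L2_norm_add_sq_le L2.diff_mem tL vL)
    also have "\<dots> \<le> 2 * ((B ^ d * (y\<^sup>2) powr - s)\<^sup>2 * ?N) + 2 * ((real d * M * real n powr - s)\<^sup>2 * ?N)"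
      using 1 2 by (intro add_mono mult_left_mono) auto
    finally show ?thesis unfolding N by (simp only: distrib_left distrib_right mult.assoc)
  qed
  ultimately show ?thesis by blast
qed

section \<open>Approximation in the mixed Sobolev space\<close>

lemma mix_norm_nonneg:
  assumes "F \<in> tensors_over d (\<lambda>_. Hs s)"
  shows "0 \<le> mix_norm d s F"
  using order_trans[OF L2_norm_nonneg L2_norm_tensor_fun_le[OF assms]] .

lemma mix_approx_norm_convergent:
  assumes "mix_approx d s f F"
  shows "convergent (\<lambda>i. mix_norm d s (F i))"
proof (rule real_Cauchy_convergent, rule CauchyI)
  have F: "\<And>i. F i \<in> tensors_over d (\<lambda>_. Hs s)" using assms by (simp add: mix_approx_def)
  fix r :: real assume "0 < r"
  then obtain N where "\<And>i j. i \<ge> N \<Longrightarrow> j \<ge> N \<Longrightarrow> mix_dist d s (F i) (F j) < r"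
    using assms unfolding mix_approx_def by blast
  then show "\<exists>N. \<forall>i\<ge>N. \<forall>j\<ge>N. norm (mix_norm d s (F i) - mix_norm d s (F j)) < r"
    using order.strict_trans1[OF mix_norm_triangle[OF F F]] by (intro exI[of _ N]) auto
qed

text \<open>Mixed norms converge along a Cauchy sequence, so the infimum runs over a nonempty set. A
  late member of a sequence with nearly minimal limit is close to f in L^2 and has nearly minimal
  norm.\<close>

lemma Hmix_norm_approximation:
  assumes f: "f \<in> Hmix d s"
  shows "0 \<le> Hmix_norm d s f"
    and "0 < \<eta> \<Longrightarrow> \<exists>F\<in>tensors_over d (\<lambda>_. Hs s).
      L2_norm (cube_meas {1..d}) (\<lambda>x. f x - tensor_fun d F x) \<le> \<eta> \<and> mix_norm d s F \<le> Hmix_norm d s f + \<eta>"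
proof -
  define S where "S = {c. \<exists>F. mix_approx d s f F \<and> (\<lambda>i. mix_norm d s (F i)) \<longlonglongrightarrow> c}"
  have h: "Hmix_norm d s f = Inf S" by (simp add: Hmix_norm_def S_def mix_norm_def)
  obtain F0 where "mix_approx d s f F0" using f by (auto simp: Hmix_def)
  moreover from mix_approx_norm_convergent[OF this] obtain c where "(\<lambda>i. mix_norm d s (F0 i)) \<longlonglongrightarrow> c"
    by (auto simp: convergent_def)
  ultimately have ne: "S \<noteq> {}" by (auto simp: S_def)
  show "0 \<le> Hmix_norm d s f"
    unfolding h
  proof (rule cInf_greatest[OF ne])
    fix c assume "c \<in> S"
    then obtain F where "mix_approx d s f F" "(\<lambda>i. mix_norm d s (F i)) \<longlonglongrightarrow> c" by (auto simp: S_def)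
    then show "0 \<le> c" by (intro LIMSEQ_le_const) (auto simp: mix_approx_def intro: mix_norm_nonneg)
  qed
  assume \<eta>: "0 < \<eta>"
  then have "Inf S < Inf S + \<eta>" by simp
  then obtain c where "c \<in> S" and c: "c < Inf S + \<eta>" using cInf_lessD[OF ne] by blast
  then obtain F where F: "mix_approx d s f F" "(\<lambda>i. mix_norm d s (F i)) \<longlonglongrightarrow> c" by (auto simp: S_def)
  have "\<forall>\<^sub>F i in sequentially. mix_norm d s (F i) < Inf S + \<eta>" by (rule order_tendstoD(2)[OF F(2) c])
  moreover have "\<forall>\<^sub>F i in sequentially. L2_norm (cube_meas {1..d}) (\<lambda>x. f x - tensor_fun d (F i) x) < \<eta>"
    using F(1) \<eta> by (intro order_tendstoD(2)) (auto simp: mix_approx_def)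
  ultimately have "\<forall>\<^sub>F i in sequentially. mix_norm d s (F i) < Inf S + \<eta> \<and>
      L2_norm (cube_meas {1..d}) (\<lambda>x. f x - tensor_fun d (F i) x) < \<eta>"
    by eventually_elim simp
  then obtain i where "mix_norm d s (F i) < Inf S + \<eta>"
      "L2_norm (cube_meas {1..d}) (\<lambda>x. f x - tensor_fun d (F i) x) < \<eta>"
    using eventually_happens'[OF sequentially_bot] by blast
  then show "\<exists>F\<in>tensors_over d (\<lambda>_. Hs s).
      L2_norm (cube_meas {1..d}) (\<lambda>x. f x - tensor_fun d F x) \<le> \<eta> \<and> mix_norm d s F \<le> Hmix_norm d s f + \<eta>"
    using F(1) unfolding h by (intro bexI[of _ "F i"]) (auto simp: mix_approx_def)
qed

lemma Hmix_L2: "f \<in> Hmix d s \<Longrightarrow> f \<in> L2 (cube_meas {1..d})"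
  by (simp add: Hmix_def)

text \<open>For mixed norm 0 the relative accuracy leaves no room for an intermediate tensor, so
  this case is settled separately by the zero approximant.\<close>

lemma Hmix_norm_eq_0:
  assumes f: "f \<in> Hmix d s" and 0: "Hmix_norm d s f = 0"
  shows "L2_norm (cube_meas {1..d}) f = 0"
proof (rule ccontr)
  let ?C = "cube_meas {1..d}"
  assume "L2_norm ?C f \<noteq> 0"
  then have pos: "0 < L2_norm ?C f" using L2_norm_nonneg[of ?C f] by linarith
  \<comment> \<open>With a quarter of the norm, the squared estimate
    \<open>4 * \<eta>\<^sup>2\<close> falls short of the true value
    \<open>16 * \<eta>\<^sup>2\<close>.\<close>
  define \<eta> where "\<eta> = L2_norm ?C f / 4"
  have \<eta>: "0 < \<eta>" using pos by (simp add: \<eta>_def)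
  obtain F where F: "F \<in> tensors_over d (\<lambda>_. Hs s)"
    and 1: "L2_norm ?C (\<lambda>x. f x - tensor_fun d F x) \<le> \<eta>" and 2: "mix_norm d s F \<le> \<eta>"
    using Hmix_norm_approximation(2)[OF f \<eta>] 0 by auto
  note FL = tensor_fun_Hs_L2[OF F]
  have "(L2_norm ?C (\<lambda>x. (f x - tensor_fun d F x) + tensor_fun d F x))\<^sup>2
      \<le> 2 * (L2_norm ?C (\<lambda>x. f x - tensor_fun d F x))\<^sup>2 + 2 * (L2_norm ?C (tensor_fun d F))\<^sup>2"
    by (intro L2_norm_add_sq_le L2.diff_mem Hmix_L2[OF f] FL)
  also have "\<dots> \<le> 2 * \<eta>\<^sup>2 + 2 * \<eta>\<^sup>2"
    using 1 order_trans[OF L2_norm_tensor_fun_le[OF F] 2] by (intro add_mono mult_left_mono power_mono) auto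
  finally have "(4 * \<eta>)\<^sup>2 \<le> 4 * \<eta>\<^sup>2" by (simp add: \<eta>_def)
  then show False using \<eta> by (simp add: power_mult_distrib)
qed

text \<open>The power of d is the constant of the truncation error, the factor d that of the
  replacement error. With \<open>(y\<^sup>2) powr - s\<close> equal to \<epsilon> over this
  constant, the 8 makes each of the two at most \<epsilon> / 8 relative to the mixed norm.\<close>

definition accuracy_const :: "nat \<Rightarrow> real \<Rightarrow> real \<Rightarrow> real" where
  "accuracy_const d s M = 8 * real d * max 1 (\<bar>M\<bar> * 2 powr s) ^ d"

lemma tree_approximant:
  assumes U: "approx_spaces d s M U" and d: "2 \<le> d" and s: "0 < s" and f: "f \<in> Hmix d s"
    and \<epsilon>: "0 < \<epsilon>" "\<epsilon> < 1"
  defines "y \<equiv> (accuracy_const d s M / \<epsilon>) powr (1 / (2 * s))"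
  defines "n \<equiv> nat \<lceil>y\<^sup>2\<rceil>"
  shows "\<exists>v\<in>tensor_space d (\<lambda>\<nu>. U \<nu> n).
    (\<forall>\<alpha>. \<alpha> \<noteq> {} \<longrightarrow> \<alpha> \<subset> {1..d} \<longrightarrow> alpha_rank d \<alpha> v \<le> enat (nat \<lfloor>2 * y * (1 + ln y) ^ (d - 2)\<rfloor>)) \<and>
    L2_norm (cube_meas {1..d}) (\<lambda>x. f x - v x) \<le> \<epsilon> * Hmix_norm d s f"
proof (cases "Hmix_norm d s f = 0")
  case True
  have "(\<lambda>_. 0) \<in> tensor_space d (\<lambda>\<nu>. U \<nu> n)"
    unfolding tensor_space_def
    by (intro CollectI conjI L2.zero_mem bexI[of _ "[]"]) (auto simp: tensor_fun_def tensors_over_def)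
  moreover have "alpha_rank d \<alpha> (\<lambda>_. 0) \<le> enat k" for \<alpha> k
  proof -
    have "alpha_rank d \<alpha> (\<lambda>_. 0) \<le> enat (card ({} :: nat set))"
      by (intro alpha_rank_le_card) auto
    then show ?thesis by (simp flip: zero_enat_def)
  qed
  ultimately show ?thesis using Hmix_norm_eq_0[OF f True] True by (intro bexI[of _ "\<lambda>_. 0"]) auto
next
  case False
  let ?C = "cube_meas {1..d}"
  define h where "h = Hmix_norm d s f"
  have h: "0 < h" using False Hmix_norm_approximation(1)[OF f] by (simp add: h_def)
  define B where "B = max 1 (\<bar>M\<bar> * 2 powr s)"
  define K where "K = accuracy_const d s M"
  have B: "1 \<le> B" "1 \<le> B ^ d" by (auto simp: B_def)
  have MB: "\<bar>M\<bar> \<le> B ^ d"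
  proof -
    have "\<bar>M\<bar> * 1 \<le> \<bar>M\<bar> * 2 powr s" using s by (intro mult_left_mono ge_one_powr_ge_zero) auto
    then have "\<bar>M\<bar> \<le> B" by (simp add: B_def)
    also have "B \<le> B ^ d" using B d by (simp add: self_le_power)
    finally show ?thesis .
  qed
  have K: "K = 8 * real d * B ^ d" by (simp add: K_def accuracy_const_def B_def)
  have "1 * 1 \<le> (8 * real d) * B ^ d" using B d by (intro mult_mono) auto
  then have K1: "1 \<le> K" by (simp add: K)
  have y: "1 \<le> y"
    unfolding y_def K_def[symmetric] using K1 \<epsilon> s by (intro ge_one_powr_ge_zero) auto
  have y2: "(y\<^sup>2) powr - s = \<epsilon> / K"
  proof -
    have "(y\<^sup>2) powr - s = y powr (- 2 * s)"
      using y by (simp add: powr_powr flip: powr_numeral)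
    also have "\<dots> = (K / \<epsilon>) powr - 1"
      unfolding y_def K_def[symmetric] powr_powr using s by simp
    finally show ?thesis using K1 \<epsilon> by (simp add: powr_minus)
  qed
  have n: "1 \<le> n" "y\<^sup>2 \<le> real n"
  proof -
    have "1 \<le> y\<^sup>2" using y by simp
    then show "y\<^sup>2 \<le> real n" unfolding n_def by linarith
    then show "1 \<le> n" using \<open>1 \<le> y\<^sup>2\<close> by linarith
  qed
  have \<eta>: "0 < \<epsilon> * h / 2" using \<epsilon> h by simp
  obtain F where F: "F \<in> tensors_over d (\<lambda>_. Hs s)"
    and f1: "L2_norm ?C (\<lambda>x. f x - tensor_fun d F x) \<le> \<epsilon> * h / 2" and f2: "mix_norm d s F \<le> h + \<epsilon> * h / 2"
    using Hmix_norm_approximation(2)[OF f \<eta>] by (auto simp: h_def)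
  have f2': "mix_norm d s F \<le> 2 * h"
    using f2 mult_right_mono[of \<epsilon> 1 h] \<epsilon> h by linarith
  obtain v where v: "v \<in> tensor_space d (\<lambda>\<nu>. U \<nu> n)"
    and rank: "\<forall>\<alpha>. \<alpha> \<noteq> {} \<longrightarrow> \<alpha> \<subset> {1..d} \<longrightarrow> alpha_rank d \<alpha> v \<le> enat (nat \<lfloor>2 * y * (1 + ln y) ^ (d - 2)\<rfloor>)"
    and err: "(L2_norm ?C (\<lambda>x. tensor_fun d F x - v x))\<^sup>2
      \<le> 2 * ((B ^ d * (y\<^sup>2) powr - s)\<^sup>2 + (real d * M * real n powr - s)\<^sup>2) * (mix_norm d s F)\<^sup>2"
    using approximant[OF U d s y n(1) F] unfolding B_def by blast
  have e1: "(B ^ d * (y\<^sup>2) powr - s)\<^sup>2 \<le> (\<epsilon> / 8)\<^sup>2"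
  proof (rule power_mono)
    have "B ^ d * (y\<^sup>2) powr - s = \<epsilon> / (8 * real d)" unfolding y2 K using B d by (simp add: field_simps)
    also have "\<dots> \<le> \<epsilon> / 8" using d \<epsilon> by (intro divide_left_mono) auto
    finally show "B ^ d * (y\<^sup>2) powr - s \<le> \<epsilon> / 8" .
  qed (use B in auto)
  have e2: "(real d * M * real n powr - s)\<^sup>2 \<le> (\<epsilon> / 8)\<^sup>2"
  proof -
    have "real n powr - s \<le> (y\<^sup>2) powr - s" using n y s by (intro powr_mono2') auto
    then have "real d * \<bar>M\<bar> * real n powr - s \<le> real d * B ^ d * (\<epsilon> / K)"
      unfolding y2 using MB B by (intro mult_mono) auto
    also have "\<dots> = \<epsilon> / 8" unfolding K using B d by (simp add: field_simps)
    finally have "\<bar>real d * M * real n powr - s\<bar> \<le> \<bar>\<epsilon> / 8\<bar>" using \<epsilon> by (simp add: abs_mult)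
    then show ?thesis unfolding abs_le_square_iff .
  qed
  have "(L2_norm ?C (\<lambda>x. tensor_fun d F x - v x))\<^sup>2 \<le> 2 * ((\<epsilon> / 8)\<^sup>2 + (\<epsilon> / 8)\<^sup>2) * (2 * h)\<^sup>2"
  proof -
    have "(mix_norm d s F)\<^sup>2 \<le> (2 * h)\<^sup>2" by (intro power_mono f2' mix_norm_nonneg[OF F])
    with e1 e2 show ?thesis by (intro order_trans[OF err] mult_mono mult_left_mono add_mono) auto
  qed
  moreover have "(L2_norm ?C (\<lambda>x. (f x - tensor_fun d F x) + (tensor_fun d F x - v x)))\<^sup>2
      \<le> 2 * (L2_norm ?C (\<lambda>x. f x - tensor_fun d F x))\<^sup>2 + 2 * (L2_norm ?C (\<lambda>x. tensor_fun d F x - v x))\<^sup>2"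
    using v by (intro L2_norm_add_sq_le L2.diff_mem Hmix_L2[OF f] tensor_fun_Hs_L2[OF F]) (auto simp: tensor_space_def)
  moreover have "(L2_norm ?C (\<lambda>x. f x - tensor_fun d F x))\<^sup>2 \<le> (\<epsilon> * h / 2)\<^sup>2"
    using f1 by (intro power_mono) auto
  \<comment> \<open>The budget is spent exactly: both squared errors are at most
    \<open>(\<epsilon> * h)\<^sup>2 / 4\<close>, each is doubled, and together they give
    \<open>(\<epsilon> * h)\<^sup>2\<close>.\<close>
  ultimately have "(L2_norm ?C (\<lambda>x. f x - v x))\<^sup>2 \<le> (\<epsilon> * h)\<^sup>2"
    by (simp add: power2_eq_square algebra_simps)
  then have "L2_norm ?C (\<lambda>x. f x - v x) \<le> \<epsilon> * h"
    using \<epsilon> h by (auto intro: power2_le_imp_le)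
  then show ?thesis using v rank unfolding h_def by blast
qed

section \<open>Complexity of a tree format with one rank R at all nodes below the root\<close>

lemma min_complexity_le:
  assumes d: "2 \<le> d" and T: "partition_tree d T" and n: "1 \<le> n"
    and v: "v \<in> tensor_space d (\<lambda>\<nu>. U \<nu> n)"
    and rank: "\<forall>\<alpha>. \<alpha> \<noteq> {} \<longrightarrow> \<alpha> \<subset> {1..d} \<longrightarrow> alpha_rank d \<alpha> v \<le> enat R"
    and err: "L2_norm (cube_meas {1..d}) (\<lambda>x. f x - v x) \<le> \<epsilon> * Hmix_norm d s f"
  shows "min_complexity d s T U f \<epsilon>
    \<le> ereal (real (tree_complexity d T (\<lambda>\<alpha>. if \<alpha> = {1..d} then 1 else R) (\<lambda>\<nu>. U \<nu> n)))"
proof -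
  define r where "r \<alpha> = (if \<alpha> = {1..d} then 1 else R)" for \<alpha>
  let ?V = "tensor_space d (\<lambda>\<nu>. U \<nu> n)"
  have "alpha_rank d \<alpha> v \<le> enat (r \<alpha>)" if "\<alpha> \<in> T" "\<alpha> \<noteq> {1..d}" for \<alpha>
  proof -
    have "\<alpha> \<noteq> {}" "\<alpha> \<subset> {1..d}" using T that unfolding partition_tree_def by blast+
    then show ?thesis using rank that(2) by (simp add: r_def)
  qed
  \<comment> \<open>One function serves both purposes: it bounds the error within the tensor space,
    and it witnesses that the ranks are admissible.\<close>
  then have v': "v \<in> tree_format d T r ?V" "v \<in> tree_format d T r (L2 (cube_meas {1..d}))"
    using v by (auto simp: tree_format_def tensor_space_def)
  have "admissible d T r" using v'(2) by (auto simp: admissible_def r_def)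
  moreover have "tree_error d T r ?V f \<le> \<epsilon> * Hmix_norm d s f"
  proof -
    have "tree_error d T r ?V f \<le> L2_norm (cube_meas {1..d}) (\<lambda>x. f x - v x)"
      unfolding tree_error_def best_error_def
      by (rule cINF_lower[OF _ v'(1)]) (auto intro: bdd_belowI2[of _ 0])
    then show ?thesis using err by linarith
  qed
  ultimately show ?thesis
    unfolding min_complexity_def r_def[abs_def, symmetric] using n
    by (intro Inf_lower CollectI exI[of _ r] exI[of _ "\<lambda>_. n"]) auto
qed

lemma tree_complexity_le:
  assumes T: "partition_tree d T" and R: "1 \<le> R" and dim: "\<And>\<nu>. \<nu> \<in> {1..d} \<Longrightarrow> L2_dim unit_meas (V \<nu>) \<le> n"
  defines "r \<equiv> \<lambda>\<alpha>. if \<alpha> = {1..d} then 1 else R"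
  shows "tree_complexity d T r V \<le> (\<Sum>\<alpha>\<in>interior_nodes T. r \<alpha> * R ^ card (sons T \<alpha>)) + d * (R * n)"
  unfolding tree_complexity_def
proof (rule add_mono)
  have r: "r \<alpha> \<le> R" for \<alpha> using R by (simp add: r_def)
  have "(\<Prod>\<beta>\<in>sons T \<alpha>. r \<beta>) \<le> R ^ card (sons T \<alpha>)" for \<alpha>
    using prod_mono[of "sons T \<alpha>" r "\<lambda>_. R"] r by simp
  then show "(\<Sum>\<alpha>\<in>interior_nodes T. r \<alpha> * (\<Prod>\<beta>\<in>sons T \<alpha>. r \<beta>))
      \<le> (\<Sum>\<alpha>\<in>interior_nodes T. r \<alpha> * R ^ card (sons T \<alpha>))"
    by (intro sum_mono mult_left_mono) auto
  have "(\<Sum>\<nu>=1..d. r {\<nu>} * L2_dim unit_meas (V \<nu>)) \<le> (\<Sum>\<nu>=1..d. R * n)"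
    by (intro sum_mono mult_mono r dim) auto
  then show "(\<Sum>\<nu>=1..d. r {\<nu>} * L2_dim unit_meas (V \<nu>)) \<le> d * (R * n)" by simp
qed

lemma interior_sum_trivial_le:
  fixes R :: nat
  assumes T: "partition_tree d T" and d: "2 \<le> d" and R: "1 \<le> R" and triv: "T = trivial_tree d"
  shows "(\<Sum>\<alpha>\<in>interior_nodes T. (if \<alpha> = {1..d} then 1 else R) * R ^ card (sons T \<alpha>)) \<le> R ^ d"
proof -
  have sub: "interior_nodes T \<subseteq> {{1..d}}"
  proof
    fix \<alpha> assume \<alpha>: "\<alpha> \<in> interior_nodes T"
    then obtain \<beta> where \<beta>: "\<beta> \<in> T" "\<beta> \<subset> \<alpha>" and "\<alpha> \<in> T" by (auto simp: interior_nodes_def sons_def)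
    have "\<beta> \<noteq> {}" using T \<beta> by (auto simp: partition_tree_def)
    then have "\<alpha> \<noteq> {\<nu>}" for \<nu> using \<beta>(2) by auto
    then show "\<alpha> \<in> {{1..d}}" using \<open>\<alpha> \<in> T\<close> by (auto simp: triv trivial_tree_def)
  qed
  have "sons T {1..d} \<subseteq> (\<lambda>\<nu>. {\<nu>}) ` {1..d}" by (auto simp: triv trivial_tree_def sons_def)
  then have "card (sons T {1..d}) \<le> d" using surj_card_le[of "{1..d}"] by simp
  then have le: "R ^ card (sons T {1..d}) \<le> R ^ d" using R by (intro power_increasing)
  have "(\<Sum>\<alpha>\<in>interior_nodes T. (if \<alpha> = {1..d} then 1 else R) * R ^ card (sons T \<alpha>))
      \<le> (\<Sum>\<alpha>\<in>{{1..d}}. (if \<alpha> = {1..d} then 1 else R) * R ^ card (sons T \<alpha>))"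
    using sub by (intro sum_mono2) auto
  then show ?thesis using le by simp
qed

text \<open>Each interior node contributes at most R^3, a factor R for the node and one for each
  son. Counting nodes as subsets of {1..d} is crude, but the constant may grow exponentially in
  d.\<close>

lemma interior_sum_binary_le:
  fixes R :: nat
  assumes T: "partition_tree d T" and R: "1 \<le> R" and bin: "binary_tree T"
  shows "(\<Sum>\<alpha>\<in>interior_nodes T. (if \<alpha> = {1..d} then 1 else R) * R ^ card (sons T \<alpha>)) \<le> 2 ^ d * R ^ 3"
proof -
  have sub: "interior_nodes T \<subseteq> Pow {1..d}"
    using T by (auto simp: interior_nodes_def partition_tree_def)
  have "(\<Sum>\<alpha>\<in>interior_nodes T. (if \<alpha> = {1..d} then 1 else R) * R ^ card (sons T \<alpha>))
      \<le> (\<Sum>\<alpha>\<in>interior_nodes T. R ^ 3)"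
    using bin R by (intro sum_mono) (auto simp: binary_tree_def power3_eq_cube power2_eq_square)
  also have "\<dots> \<le> 2 ^ d * R ^ 3"
    using card_mono[OF _ sub] by (simp add: card_Pow)
  finally show ?thesis .
qed

text \<open>The logarithm is replaced by its maximum with 1 because it tends to 0 as \<epsilon>
  tends to 1, whereas a nonzero constant f needs positive complexity for every \<epsilon> below 1.
  Part (i) asks for d \<ge> 3 because the leaf term of order \<open>\<epsilon>^(-3/(2s))\<close>
  must be dominated by \<open>\<epsilon>^(-d/(2s))\<close>; for d = 2 the trivial tree is binary and
  falls under (ii).\<close>

theorem theorem3p8:
  fixes d :: nat and s M :: real
  assumes "2 \<le> d" and "0 < s"
  shows "\<exists>C :: real. \<forall>U T f \<epsilon>.
    approx_spaces d s M U \<longrightarrow> partition_tree d T \<longrightarrow> f \<in> Hmix d s \<longrightarrow> 0 < \<epsilon> \<longrightarrow> \<epsilon> < 1 \<longrightarrow>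
      (3 \<le> d \<and> T = trivial_tree d \<longrightarrow>
        min_complexity d s T U f \<epsilon>
          \<le> ereal (C * \<epsilon> powr (- (real d / (2 * s))) * max 1 (ln (1 / \<epsilon>)) ^ (d * (d - 2)))) \<and>
      (binary_tree T \<longrightarrow>
        min_complexity d s T U f \<epsilon>
          \<le> ereal (C * \<epsilon> powr (- (3 / (2 * s))) * max 1 (ln (1 / \<epsilon>)) ^ (3 * (d - 2))))"
proof -
  define K where "K = accuracy_const d s M"
  have "1 * 1 \<le> (8 * real d) * max 1 (\<bar>M\<bar> * 2 powr s) ^ d" using assms(1) by (intro mult_mono) auto
  then have K: "1 \<le> K" by (simp add: K_def accuracy_const_def)
  define \<kappa> where "\<kappa> = K powr (1 / (2 * s))"
  have \<kappa>: "1 \<le> \<kappa>" unfolding \<kappa>_def using K assms(2) by (intro ge_one_powr_ge_zero) auto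
  \<comment> \<open>Gives 1 + ln y \<le> A l with l the truncated logarithm; together with y =
    \<kappa> E this turns the rank bound into R \<le> Q E l^(d-2).\<close>
  define A where "A = 1 + (ln K + 1) / (2 * s)"
  have A: "1 \<le> A" using K assms(2) by (simp add: A_def)
  define Q where "Q = 2 * \<kappa> * A ^ (d - 2)"
  have Q: "0 \<le> Q" using \<kappa> A by (simp add: Q_def)
  \<comment> \<open>The summands pay for the root of the trivial tree, for the interior nodes of a
    binary tree, and for the leaf bases.\<close>
  define C where "C = Q ^ d + 2 ^ d * Q ^ 3 + 2 * real d * Q * \<kappa>\<^sup>2"
  show ?thesis
  proof (intro exI[of _ C] allI impI)
    fix U T f \<epsilon>
    assume U: "approx_spaces d s M U" and T: "partition_tree d T" and f: "f \<in> Hmix d s"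
      and \<epsilon>: "0 < \<epsilon>" "\<epsilon> < (1 :: real)"
    define E where "E = \<epsilon> powr (- (1 / (2 * s)))"
    define l where "l = max 1 (ln (1 / \<epsilon>))"
    define y where "y = (K / \<epsilon>) powr (1 / (2 * s))"
    define n where "n = nat \<lceil>y\<^sup>2\<rceil>"
    define R where "R = nat \<lfloor>2 * y * (1 + ln y) ^ (d - 2)\<rfloor>"
    have l: "1 \<le> l" "ln (1 / \<epsilon>) \<le> l" by (auto simp: l_def)
    have E_pow: "E ^ k = \<epsilon> powr (- (real k / (2 * s)))" for k
      using \<epsilon> by (simp add: E_def powr_powr flip: powr_realpow)
    have E: "1 \<le> E"
      unfolding E_def powr_minus using \<epsilon> assms(2) by (intro one_le_inverse) (auto intro: powr_le1)
    have yE: "y = \<kappa> * E"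
    proof -
      have "y = K powr (1 / (2 * s)) / \<epsilon> powr (1 / (2 * s))"
        unfolding y_def using K \<epsilon> by (intro powr_divide)
      then show ?thesis unfolding \<kappa>_def E_def powr_minus by (simp only: divide_inverse)
    qed
    have y: "1 \<le> y" unfolding yE using mult_mono[OF \<kappa> E] \<kappa> by simp
    have lny: "0 \<le> ln y" "1 + ln y \<le> A * l"
    proof -
      show "0 \<le> ln y" using y by simp
      have "ln y = (ln K + ln (1 / \<epsilon>)) / (2 * s)"
        using K \<epsilon> by (simp add: y_def ln_powr ln_div)
      also have "\<dots> \<le> (ln K * l + l) / (2 * s)"
        using K l assms(2) mult_left_mono[of 1 l "ln K"] by (intro divide_right_mono) auto
      also have "\<dots> = A * l - l"
        by (simp add: A_def algebra_simps add_divide_distrib)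
      finally show "1 + ln y \<le> A * l" using l by linarith
    qed
    have R1: "1 \<le> R"
    proof -
      have "1 * 1 \<le> (2 * y) * (1 + ln y) ^ (d - 2)" using y lny by (intro mult_mono) auto
      then show ?thesis unfolding R_def by (simp add: le_nat_iff le_floor_iff)
    qed
    have R: "real R \<le> Q * E * l ^ (d - 2)"
    proof -
      have "real R \<le> 2 * y * (1 + ln y) ^ (d - 2)"
        unfolding R_def using y lny by (intro of_nat_floor) auto
      also have "\<dots> \<le> 2 * y * (A * l) ^ (d - 2)"
        using y lny by (intro mult_left_mono power_mono) auto
      also have "\<dots> = Q * E * l ^ (d - 2)" by (simp add: Q_def yE power_mult_distrib mult_ac)
      finally show ?thesis .
    qed
    have y2: "1 \<le> y\<^sup>2" using y by simp
    have n: "1 \<le> n" "real n \<le> 2 * \<kappa>\<^sup>2 * E\<^sup>2"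
    proof -
      have "y\<^sup>2 \<le> real n" "real n \<le> y\<^sup>2 + 1" using y2 unfolding n_def by linarith+
      then show "1 \<le> n" "real n \<le> 2 * \<kappa>\<^sup>2 * E\<^sup>2"
        using y2 by (auto simp: yE power_mult_distrib)
    qed
    obtain v where v: "v \<in> tensor_space d (\<lambda>\<nu>. U \<nu> n)"
        "\<forall>\<alpha>. \<alpha> \<noteq> {} \<longrightarrow> \<alpha> \<subset> {1..d} \<longrightarrow> alpha_rank d \<alpha> v \<le> enat R"
        "L2_norm (cube_meas {1..d}) (\<lambda>x. f x - v x) \<le> \<epsilon> * Hmix_norm d s f"
      using tree_approximant[OF U assms f \<epsilon>] unfolding R_def n_def y_def K_def by blast
    have dim: "L2_dim unit_meas (U \<nu> n) \<le> n" if "\<nu> \<in> {1..d}" for \<nu>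
      unfolding L2_dim_def using U that n(1) by (intro Least_le) (simp add: approx_spaces_def)
    let ?S = "\<Sum>\<alpha>\<in>interior_nodes T. (if \<alpha> = {1..d} then 1 else R) * R ^ card (sons T \<alpha>)"
    have "real (tree_complexity d T (\<lambda>\<alpha>. if \<alpha> = {1..d} then 1 else R) (\<lambda>\<nu>. U \<nu> n)) \<le> real (?S + d * (R * n))"
      unfolding of_nat_le_iff by (rule tree_complexity_le[OF T R1 dim])
    then have min: "min_complexity d s T U f \<epsilon> \<le> ereal (real ?S + real d * (real R * real n))"
      using order_trans[OF min_complexity_le[where U = U and n = n and v = v and f = f, OF assms(1) T n(1) v]] by simp
    \<comment> \<open>R contributes E and n contributes E^2, each up to constants and logarithms.
      The resulting E^3 fits under E^k exactly from k = 3 on.\<close>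
    have leaves: "real d * (real R * real n) \<le> (2 * real d * Q * \<kappa>\<^sup>2) * (E ^ k * l ^ (k * (d - 2)))"
      if k: "3 \<le> k" for k
    proof -
      have "real d * (real R * real n) \<le> real d * ((Q * E * l ^ (d - 2)) * (2 * \<kappa>\<^sup>2 * E\<^sup>2))"
        using R n Q E l by (intro mult_left_mono mult_mono) auto
      also have "\<dots> = (2 * real d * Q * \<kappa>\<^sup>2) * (E ^ 3 * l ^ (d - 2))"
        by (simp add: power2_eq_square power3_eq_cube)
      also have "\<dots> \<le> (2 * real d * Q * \<kappa>\<^sup>2) * (E ^ k * l ^ (k * (d - 2)))"
        using k E l Q by (intro mult_left_mono mult_mono power_increasing) auto
      finally show ?thesis .
    qed
    have R_pow: "real R ^ k \<le> Q ^ k * (E ^ k * l ^ (k * (d - 2)))" for k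
    proof -
      have "real R ^ k \<le> (Q * E * l ^ (d - 2)) ^ k" using R by (intro power_mono) auto
      then show ?thesis by (simp add: power_mult_distrib mult.assoc mult.commute[of k] flip: power_mult)
    qed
    have C: "Q ^ d + 2 * real d * Q * \<kappa>\<^sup>2 \<le> C" "2 ^ d * Q ^ 3 + 2 * real d * Q * \<kappa>\<^sup>2 \<le> C"
      using Q by (auto simp: C_def)
    show "(3 \<le> d \<and> T = trivial_tree d \<longrightarrow>
        min_complexity d s T U f \<epsilon>
          \<le> ereal (C * \<epsilon> powr (- (real d / (2 * s))) * max 1 (ln (1 / \<epsilon>)) ^ (d * (d - 2)))) \<and>
      (binary_tree T \<longrightarrow>
        min_complexity d s T U f \<epsilon>
          \<le> ereal (C * \<epsilon> powr (- (3 / (2 * s))) * max 1 (ln (1 / \<epsilon>)) ^ (3 * (d - 2))))"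
    proof (intro conjI impI)
      assume triv: "3 \<le> d \<and> T = trivial_tree d"
      let ?B = "E ^ d * l ^ (d * (d - 2))"
      have "real ?S \<le> real (R ^ d)"
        unfolding of_nat_le_iff using interior_sum_trivial_le[OF T assms(1) R1] triv by blast
      then have "real ?S + real d * (real R * real n) \<le> Q ^ d * ?B + (2 * real d * Q * \<kappa>\<^sup>2) * ?B"
        using R_pow[of d] leaves[of d] triv by (intro add_mono) auto
      also have "\<dots> = (Q ^ d + 2 * real d * Q * \<kappa>\<^sup>2) * ?B" by (simp add: distrib_right)
      also have "\<dots> \<le> C * ?B" using C E l by (intro mult_right_mono) auto
      finally have "real ?S + real d * (real R * real n)
          \<le> C * \<epsilon> powr (- (real d / (2 * s))) * max 1 (ln (1 / \<epsilon>)) ^ (d * (d - 2))"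
        by (simp add: E_pow l_def mult.assoc)
      then show "min_complexity d s T U f \<epsilon>
          \<le> ereal (C * \<epsilon> powr (- (real d / (2 * s))) * max 1 (ln (1 / \<epsilon>)) ^ (d * (d - 2)))"
        using order_trans[OF min] by simp
    next
      assume bin: "binary_tree T"
      let ?B = "E ^ 3 * l ^ (3 * (d - 2))"
      have "real ?S \<le> real (2 ^ d * R ^ 3)"
        unfolding of_nat_le_iff by (rule interior_sum_binary_le[OF T R1 bin])
      then have "real ?S \<le> 2 ^ d * real R ^ 3" by simp
      also have "\<dots> \<le> 2 ^ d * (Q ^ 3 * ?B)" by (intro mult_left_mono R_pow) auto
      finally have "real ?S + real d * (real R * real n) \<le> 2 ^ d * (Q ^ 3 * ?B) + (2 * real d * Q * \<kappa>\<^sup>2) * ?B"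
        using leaves[of 3] by (intro add_mono) auto
      also have "\<dots> = (2 ^ d * Q ^ 3 + 2 * real d * Q * \<kappa>\<^sup>2) * ?B" by (simp add: distrib_right)
      also have "\<dots> \<le> C * ?B" using C E l by (intro mult_right_mono) auto
      finally have "real ?S + real d * (real R * real n)
          \<le> C * \<epsilon> powr (- (3 / (2 * s))) * max 1 (ln (1 / \<epsilon>)) ^ (3 * (d - 2))"
        by (simp add: E_pow l_def mult.assoc)
      then show "min_complexity d s T U f \<epsilon>
          \<le> ereal (C * \<epsilon> powr (- (3 / (2 * s))) * max 1 (ln (1 / \<epsilon>)) ^ (3 * (d - 2)))"
        using order_trans[OF min] by simp
    qed
  qed
qed

end
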